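(* Let $R$ be a discrete valuation ring (not a field) with maximal ideal $\mathfrak{p}$, let $P := E(R/\mathfrak{p})$ be the injective hull of $R/\mathfrak{p}$ and let $A := \varprojlim_n R/\mathfrak{p}^n$. Then the Hilbert polynomial detects being zero at $P \oplus A$, i.e. for all $\mathcal{G} \in R\text{-}\mathbf{mod}\text{-}\mathbf{mod}$: \[ \mathrm{HilbP}(\mathcal{G})(\mathfrak{p},x) = 0 \in \mathbb{Z}[x] \iff \mathcal{G}(P \oplus A) \cong 0 . \]
   Context: $R\text{-}\mathbf{mod}$ is the category of finitely presented $R$-modules, and $|R\text{-}\mathbf{mod}|$ the same category regarded merely as an additive category. $R\text{-}\mathbf{mod}\text{-}\mathbf{mod}$ is the abelian category of finitely presented functors: additive functors $\mathcal{G}: R\text{-}\mathbf{mod} \to \mathbf{Ab}$ for which there is a morphism $\alpha: M \to N$ in $R\text{-}\mathbf{mod}$ and an exact sequence $\mathrm{Hom}(N,-) \xrightarrow{\mathrm{Hom}(\alpha,-)} \mathrm{Hom}(M,-) \to \mathcal{G} \to 0$ (a presentation given by $\alpha$). Such $\mathcal{G}$ is evaluated at an arbitrary $R$-module $X$ by $\mathcal{G}(X) := \mathrm{coker}(\mathrm{Hom}_R(N,X) \to \mathrm{Hom}_R(M,X))$. For a Dedekind domain $R$ (commutative noetherian domain of Krull dimension $1$ with all $R_{\mathfrak{p}}$, $\mathfrak{p}$ maximal, discrete valuation rings; in particular for a DVR), every $M \in R\text{-}\mathbf{mod}$ is isomorphic to $\mathrm{pr}(M) \oplus \bigoplus_{\mathfrak{p},\,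 l\geq 1} (R/\mathfrak{p}^l)^{\oplus \mathrm{mult}^M_{\mathfrak{p},l}}$ with $\mathrm{pr}(M)$ projective and uniquely determined integers $\mathrm{mult}^M_{\mathfrak{p},l}\geq 0$, almost all zero. $M \mapsto \mathrm{mult}^M_{\mathfrak{p},l}$ is additive on direct sums and hence induces a homomorphism $\mathrm{mult}_{\mathfrak{p},l}: K_0(|R\text{-}\mathbf{mod}|)\to\mathbb{Z}$, where $K_0(|R\text{-}\mathbf{mod}|)$ is the abelian group generated by symbols $[M]$ subject to $[C]=[A]+[B]$ whenever $C\cong A\oplus B$. For $\mathcal{G}$ with a presentation given by $\alpha: M\to N$ put $\mathrm{lmc}(\mathcal{G}) := [M]-[N]+[\mathrm{coker}(\alpha)]$ (independent of the presentation) and $\mathrm{mult}^{\mathcal{G}}_{\mathfrak{p},l} := \mathrm{mult}_{\mathfrak{p},l}(\mathrm{lmc}(\mathcal{G})) \in \mathbb{Z}$. With $Q := \mathrm{Quot}(R)$, $\mathrm{rank}(\mathcal{G}) := \dim_Q \mathcal{G}(Q)$. The Hilbert polynomial of $\mathcal{G}$ at $\mathfrak{p}$ is \[ \mathrm{HilbP}(\mathcal{G})(\mathfrak{p},x) := \mathrm{rank}(\mathcal{G})\cdot x + \sum_{l\geq 1}\mathrm{mult}^{\mathcal{G}}_{\mathfrak{p},l}\cdot l \in \mathbb{Z}[x]. \] *)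

theory Defs
  imports
    "Jordan_Normal_Form.Missing_VectorSpace"
    "HOL-Algebra.Free_Abelian_Groups"
    "HOL-Algebra.Elementary_Groups"
    "HOL-Algebra.Ideal_Product"
    "HOL-Algebra.Ring_Divisibility"
    "HOL-Computational_Algebra.Polynomial"
begin

hide_const (open) Modules.module Modules.module_hom
  Polynomial.smult Multiset.mult Wellorder_Constructions.zero

section \<open>Modules\<close>

text \<open>
  A \<^typ>\<open>('r, 'm) module\<close> record also carries the fields \<open>mult\<close> and \<open>one\<close> of a ring. They
  play no role for modules; the modules constructed below fill them with a dummy value.
\<close>

text \<open>
  The abelian group \<open>Hom\<^sub>R(M, X)\<close>, with scalars acting on values through \<open>act\<close>. Homomorphisms
  are restricted to be \<open>undefined\<close> outside \<open>carrier M\<close>, so that equal homomorphisms are equal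
  functions. The scalars need not lie in \<open>R\<close>: for a field \<open>Q\<close> over \<open>R\<close>, the group
  \<open>Hom\<^sub>R(M, Q)\<close> is a \<open>Q\<close>-vector space.
\<close>

definition hom_set ::
  "('r, 'e) ring_scheme \<Rightarrow> ('r, 'm) module \<Rightarrow> ('r, 'x) module \<Rightarrow> ('m \<Rightarrow> 'x) set"
  where "hom_set R M X = module_hom R M X \<inter> extensional (carrier M)"

definition hom_module ::
  "('r, 'e) ring_scheme \<Rightarrow> ('s \<Rightarrow> 'x \<Rightarrow> 'x) \<Rightarrow> ('r, 'm) module \<Rightarrow> ('r, 'x) module
    \<Rightarrow> ('s, 'm \<Rightarrow> 'x) module"
  where "hom_module R act M X =
    \<lparr> carrier = hom_set R M X,
      mult = (\<lambda>f g. \<lambda>m\<in>carrier M. \<zero>\<^bsub>X\<^esub>),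
      one = (\<lambda>m\<in>carrier M. \<zero>\<^bsub>X\<^esub>),
      zero = (\<lambda>m\<in>carrier M. \<zero>\<^bsub>X\<^esub>),
      add = (\<lambda>f g. \<lambda>m\<in>carrier M. f m \<oplus>\<^bsub>X\<^esub> g m),
      smult = (\<lambda>s f. \<lambda>m\<in>carrier M. act s (f m)) \<rparr>"

definition mod_iso :: "('r, 'e) ring_scheme \<Rightarrow> ('r, 'm) module \<Rightarrow> ('r, 'n) module \<Rightarrow> bool"
  where "mod_iso R M N \<longleftrightarrow>
    (\<exists>f \<in> module_hom R M N. bij_betw f (carrier M) (carrier N))"

definition regular_module :: "('r, 'e) ring_scheme \<Rightarrow> ('r, 'r) module"
  where "regular_module R =
    \<lparr> carrier = carrier R, mult = mult R, one = one R, zero = zero R, add = add R,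
      smult = mult R \<rparr>"

definition quot_module :: "('s, 'm) module \<Rightarrow> 'm set \<Rightarrow> ('s, 'm set) module"
  where "quot_module M K =
    \<lparr> carrier = a_rcosets\<^bsub>M\<^esub> K,
      mult = (\<lambda>X Y. K), one = K, zero = K,
      add = (\<lambda>X Y. X <+>\<^bsub>M\<^esub> Y),
      smult = (\<lambda>s X. \<Union>x\<in>X. K +>\<^bsub>M\<^esub> (s \<odot>\<^bsub>M\<^esub> x)) \<rparr>"

definition product_module :: "'i set \<Rightarrow> ('i \<Rightarrow> ('r, 'm) module) \<Rightarrow> ('r, 'i \<Rightarrow> 'm) module"
  where "product_module I M =
    \<lparr> carrier = (\<Pi>\<^sub>E i\<in>I. carrier (M i)),
      mult = (\<lambda>v w. \<lambda>i\<in>I. \<zero>\<^bsub>M i\<^esub>),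
      one = (\<lambda>i\<in>I. \<zero>\<^bsub>M i\<^esub>),
      zero = (\<lambda>i\<in>I. \<zero>\<^bsub>M i\<^esub>),
      add = (\<lambda>v w. \<lambda>i\<in>I. v i \<oplus>\<^bsub>M i\<^esub> w i),
      smult = (\<lambda>r v. \<lambda>i\<in>I. r \<odot>\<^bsub>M i\<^esub> v i) \<rparr>"

abbreviation free_module :: "('r, 'e) ring_scheme \<Rightarrow> nat \<Rightarrow> ('r, nat \<Rightarrow> 'r) module"
  where "free_module R n \<equiv> product_module {..<n} (\<lambda>_. regular_module R)"

definition finitely_presented :: "('r, 'e) ring_scheme \<Rightarrow> ('r, 'm) module \<Rightarrow> bool"
  where "finitely_presented R M \<longleftrightarrow> module R M \<and>
    (\<exists>n A. finite A \<and> A \<subseteq> carrier (free_module R n) \<and>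
      mod_iso R M (quot_module (free_module R n)
        (LinearCombinations.module.span R (free_module R n) A)))"

text \<open>
  HOL cannot quantify over all types inside a formula. Modules that have to be quantified over are
  taken with carrier in the type \<^typ>\<open>(nat \<Rightarrow> 'r) set\<close>, in which all quotients of the modules
  \<open>R\<^sup>n\<close> live. So \<open>Rmod R\<close> contains every finitely presented module up to isomorphism.
\<close>

type_synonym 'r umodule = "('r, (nat \<Rightarrow> 'r) set) module"

definition Rmod :: "('r, 'e) ring_scheme \<Rightarrow> 'r umodule set"
  where "Rmod R = {M. finitely_presented R M}"

text \<open>
  The lifting and extension problems below range over all modules on \<^typ>\<open>(nat \<Rightarrow> 'r) set\<close>. For
  injectivity this is no restriction by Baer's criterion, since copies of \<open>R\<close> and its ideals are
  among the test modules; for finitely generated modules it is no restriction on projectivity either,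
  since copies of the modules \<open>R\<^sup>n\<close> are among them.
\<close>

definition projective_module :: "('r, 'e) ring_scheme \<Rightarrow> ('r, 'm) module \<Rightarrow> bool"
  where "projective_module R F \<longleftrightarrow> module R F \<and>
    (\<forall>(X :: 'r umodule) (Y :: 'r umodule). \<forall>g \<in> hom_set R X Y. \<forall>f \<in> hom_set R F Y.
      module R X \<longrightarrow> module R Y \<longrightarrow> g ` carrier X = carrier Y \<longrightarrow>
      (\<exists>h \<in> hom_set R F X. compose (carrier F) g h = f))"

definition injective_module :: "('r, 'e) ring_scheme \<Rightarrow> ('r, 'm) module \<Rightarrow> bool"
  where "injective_module R E \<longleftrightarrow> module R E \<and>
    (\<forall>(X :: 'r umodule) (Y :: 'r umodule). \<forall>i \<in> hom_set R X Y. \<forall>f \<in> hom_set R X E.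
      module R X \<longrightarrow> module R Y \<longrightarrow> inj_on i (carrier X) \<longrightarrow>
      (\<exists>h \<in> hom_set R Y E. compose (carrier X) h i = f))"

definition injective_hull ::
  "('r, 'e) ring_scheme \<Rightarrow> ('r, 's) module \<Rightarrow> ('r, 'm) module \<Rightarrow> bool"
  where "injective_hull R S E \<longleftrightarrow> injective_module R E \<and>
    (\<exists>\<iota> \<in> module_hom R S E. inj_on \<iota> (carrier S) \<and>
      (\<forall>U. Module.submodule U R E \<longrightarrow> U \<noteq> {\<zero>\<^bsub>E\<^esub>} \<longrightarrow> U \<inter> \<iota> ` carrier S \<noteq> {\<zero>\<^bsub>E\<^esub>}))"


section \<open>Rings\<close>

definition discrete_valuation_ring :: "('r, 'e) ring_scheme \<Rightarrow> bool"
  where "discrete_valuation_ring R \<longleftrightarrow>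
    principal_domain R \<and> \<not> field R \<and> (\<exists>!I. maximalideal I R)"

abbreviation ideal_pow :: "('r, 'e) ring_scheme \<Rightarrow> 'r set \<Rightarrow> nat \<Rightarrow> 'r set"
  where "ideal_pow R I n \<equiv> I [^]\<^bsub>ideals_set R\<^esub> n"

abbreviation residue_module :: "('r, 'e) ring_scheme \<Rightarrow> 'r set \<Rightarrow> ('r, 'r set) module"
  where "residue_module R I \<equiv> quot_module (regular_module R) I"

text \<open>
  The inverse limit of the \<open>R/I\<^sup>n\<close> as an \<open>R\<close>-module. The transition map \<open>R/I\<^sup>n \<rightarrow> R/I\<^sup>m\<close> for
  \<open>m \<le> n\<close> sends a coset \<open>X\<close> to \<open>I\<^sup>m + X\<close>. The index \<open>n = 0\<close> contributes \<open>R/R = 0\<close>.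
\<close>

definition adic_completion :: "('r, 'e) ring_scheme \<Rightarrow> 'r set \<Rightarrow> ('r, nat \<Rightarrow> 'r set) module"
  where "adic_completion R I =
    (product_module UNIV (\<lambda>n. residue_module R (ideal_pow R I n)))
      \<lparr> carrier := {s. (\<forall>n. s n \<in> carrier (residue_module R (ideal_pow R I n))) \<and>
                       (\<forall>m n. m \<le> n \<longrightarrow> s m = ideal_pow R I m <+>\<^bsub>R\<^esub> s n)} \<rparr>"

text \<open>The fraction \<open>a/b\<close> is the equivalence class of the pair \<open>(a, b)\<close>.\<close>

definition fraction :: "('r, 'e) ring_scheme \<Rightarrow> 'r \<Rightarrow> 'r \<Rightarrow> ('r \<times> 'r) set"
  where "fraction R a b =
    {(c, d). c \<in> carrier R \<and> d \<in> carrier R - {\<zero>\<^bsub>R\<^esub>} \<and> a \<otimes>\<^bsub>R\<^esub> d = c \<otimes>\<^bsub>R\<^esub> b}"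

definition quot_field :: "('r, 'e) ring_scheme \<Rightarrow> ('r \<times> 'r) set ring"
  where "quot_field R =
    \<lparr> carrier = {fraction R a b | a b. a \<in> carrier R \<and> b \<in> carrier R - {\<zero>\<^bsub>R\<^esub>}},
      mult = (\<lambda>X Y. \<Union>(a, b)\<in>X. \<Union>(c, d)\<in>Y. fraction R (a \<otimes>\<^bsub>R\<^esub> c) (b \<otimes>\<^bsub>R\<^esub> d)),
      one = fraction R \<one>\<^bsub>R\<^esub> \<one>\<^bsub>R\<^esub>,
      zero = fraction R \<zero>\<^bsub>R\<^esub> \<one>\<^bsub>R\<^esub>,
      add = (\<lambda>X Y. \<Union>(a, b)\<in>X. \<Union>(c, d)\<in>Y.
               fraction R (a \<otimes>\<^bsub>R\<^esub> d \<oplus>\<^bsub>R\<^esub> c \<otimes>\<^bsub>R\<^esub> b) (b \<otimes>\<^bsub>R\<^esub> d)) \<rparr>"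

definition quot_field_module :: "('r, 'e) ring_scheme \<Rightarrow> ('r, ('r \<times> 'r) set) module"
  where "quot_field_module R =
    ring.extend (quot_field R)
      \<lparr> smult = (\<lambda>r X. fraction R r \<one>\<^bsub>R\<^esub> \<otimes>\<^bsub>quot_field R\<^esub> X) \<rparr>"


section \<open>Finitely presented functors\<close>

text \<open>Abelian groups are written multiplicatively, as usual in HOL-Algebra.\<close>

record ('r, 'g) ab_functor =
  fobj :: "'r umodule \<Rightarrow> 'g monoid"
  fmor :: "'r umodule \<Rightarrow> 'r umodule \<Rightarrow> ((nat \<Rightarrow> 'r) set \<Rightarrow> (nat \<Rightarrow> 'r) set) \<Rightarrow> 'g \<Rightarrow> 'g"

locale additive_functor =
  fixes R :: "('r, 'e) ring_scheme" and G :: "('r, 'g) ab_functor"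
  assumes obj_comm_group: "X \<in> Rmod R \<Longrightarrow> comm_group (fobj G X)"
    and mor_hom:
      "\<lbrakk>X \<in> Rmod R; Y \<in> Rmod R; f \<in> hom_set R X Y\<rbrakk>
        \<Longrightarrow> fmor G X Y f \<in> hom (fobj G X) (fobj G Y)"
    and mor_ident:
      "\<lbrakk>X \<in> Rmod R; x \<in> carrier (fobj G X)\<rbrakk> \<Longrightarrow> fmor G X X (\<lambda>m\<in>carrier X. m) x = x"
    and mor_compose:
      "\<lbrakk>X \<in> Rmod R; Y \<in> Rmod R; Z \<in> Rmod R; f \<in> hom_set R X Y; g \<in> hom_set R Y Z;
        x \<in> carrier (fobj G X)\<rbrakk>
        \<Longrightarrow> fmor G X Z (compose (carrier X) g f) x = fmor G Y Z g (fmor G X Y f x)"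
    and mor_add:
      "\<lbrakk>X \<in> Rmod R; Y \<in> Rmod R; f \<in> hom_set R X Y; g \<in> hom_set R X Y;
        x \<in> carrier (fobj G X)\<rbrakk>
        \<Longrightarrow> fmor G X Y (f \<oplus>\<^bsub>hom_module R (smult Y) X Y\<^esub> g) x
            = fmor G X Y f x \<otimes>\<^bsub>fobj G Y\<^esub> fmor G X Y g x"

text \<open>
  \<open>presents R G M N \<alpha>\<close>: there is a natural transformation \<open>\<eta>\<close> making
  \<open>Hom(N, -) \<rightarrow> Hom(M, -) \<rightarrow> G \<rightarrow> 0\<close> exact, where the first map is precomposition with
  \<open>\<alpha> : M \<rightarrow> N\<close>.
\<close>

definition precomp_image ::
  "('r, 'e) ring_scheme \<Rightarrow> ('r, 'm) module \<Rightarrow> ('r, 'n) module \<Rightarrow> ('m \<Rightarrow> 'n) \<Rightarrow> ('r, 'x) module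
    \<Rightarrow> ('m \<Rightarrow> 'x) set"
  where "precomp_image R M N \<alpha> X = (\<lambda>h. compose (carrier M) h \<alpha>) ` hom_set R N X"

definition presents ::
  "('r, 'e) ring_scheme \<Rightarrow> ('r, 'g) ab_functor \<Rightarrow> 'r umodule \<Rightarrow> 'r umodule
    \<Rightarrow> ((nat \<Rightarrow> 'r) set \<Rightarrow> (nat \<Rightarrow> 'r) set) \<Rightarrow> bool"
  where "presents R G M N \<alpha> \<longleftrightarrow>
    M \<in> Rmod R \<and> N \<in> Rmod R \<and> \<alpha> \<in> hom_set R M N \<and>
    (\<exists>\<eta>.
      (\<forall>X\<in>Rmod R. \<eta> X \<in> hom (add_monoid (hom_module R (smult X) M X)) (fobj G X)) \<and>
      (\<forall>X\<in>Rmod R. \<forall>Y\<in>Rmod R. \<forall>f\<in>hom_set R X Y. \<forall>h\<in>hom_set R M X.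
        \<eta> Y (compose (carrier M) f h) = fmor G X Y f (\<eta> X h)) \<and>
      (\<forall>X\<in>Rmod R. \<eta> X ` hom_set R M X = carrier (fobj G X)) \<and>
      (\<forall>X\<in>Rmod R. {h \<in> hom_set R M X. \<eta> X h = \<one>\<^bsub>fobj G X\<^esub>} = precomp_image R M N \<alpha> X))"

locale fp_functor = additive_functor +
  assumes ex_presentation: "\<exists>M N \<alpha>. presents R G M N \<alpha>"

text \<open>
  The quantities attached to \<open>G\<close> below are computed from some presentation of \<open>G\<close>; they do not
  depend on it (the value at a module up to isomorphism).
\<close>

definition presentation ::
  "('r, 'e) ring_scheme \<Rightarrow> ('r, 'g) ab_functor
    \<Rightarrow> 'r umodule \<times> 'r umodule \<times> ((nat \<Rightarrow> 'r) set \<Rightarrow> (nat \<Rightarrow> 'r) set)"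
  where "presentation R G = (SOME (M, N, \<alpha>). presents R G M N \<alpha>)"

definition eval_with ::
  "('r, 'e) ring_scheme \<Rightarrow> ('s \<Rightarrow> 'x \<Rightarrow> 'x) \<Rightarrow> ('r, 'g) ab_functor \<Rightarrow> ('r, 'x) module
    \<Rightarrow> ('s, ((nat \<Rightarrow> 'r) set \<Rightarrow> 'x) set) module"
  where "eval_with R act G X =
    (case presentation R G of (M, N, \<alpha>) \<Rightarrow>
      quot_module (hom_module R act M X) (precomp_image R M N \<alpha> X))"

definition eval_functor ::
  "('r, 'e) ring_scheme \<Rightarrow> ('r, 'g) ab_functor \<Rightarrow> ('r, 'x) module
    \<Rightarrow> ('r, ((nat \<Rightarrow> 'r) set \<Rightarrow> 'x) set) module"
  where "eval_functor R G X = eval_with R (smult X) G X"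

definition functor_rank :: "('r, 'e) ring_scheme \<Rightarrow> ('r, 'g) ab_functor \<Rightarrow> nat"
  where "functor_rank R G =
    vectorspace.dim (quot_field R)
      (eval_with R (mult (quot_field R)) G (quot_field_module R))"


section \<open>Multiplicities and the Hilbert polynomial\<close>

text \<open>
  A decomposition \<open>M \<cong> F \<oplus> \<Oplus> R/\<pp>\<^sup>l\<close> with \<open>F\<close> projective; the list \<open>L\<close> contains the pair
  \<open>(\<pp>, l)\<close> once for each summand \<open>R/\<pp>\<^sup>l\<close>.
\<close>

definition decomposition ::
  "('r, 'e) ring_scheme \<Rightarrow> ('r, 'm) module \<Rightarrow> 'r umodule \<Rightarrow> ('r set \<times> nat) list \<Rightarrow> bool"
  where "decomposition R M F L \<longleftrightarrow>
    F \<in> Rmod R \<and> projective_module R F \<and>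
    (\<forall>(I, l) \<in> set L. maximalideal I R \<and> 1 \<le> l) \<and>
    mod_iso R M (direct_sum F
      (product_module {..<length L}
        (\<lambda>i. residue_module R (ideal_pow R (fst (L ! i)) (snd (L ! i))))))"

definition module_mult :: "('r, 'e) ring_scheme \<Rightarrow> ('r, 'm) module \<Rightarrow> 'r set \<Rightarrow> nat \<Rightarrow> nat"
  where "module_mult R M I l =
    (THE k. \<exists>F L. decomposition R M F L \<and> k = count_list L (I, l))"

definition K0_relations :: "('r, 'e) ring_scheme \<Rightarrow> ('r umodule \<Rightarrow>\<^sub>0 int) set"
  where "K0_relations R =
    {frag_of C - (frag_of A + frag_of B) | A B C.
      A \<in> Rmod R \<and> B \<in> Rmod R \<and> C \<in> Rmod R \<and> mod_iso R C (direct_sum A B)}"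

definition K0_kernel :: "('r, 'e) ring_scheme \<Rightarrow> ('r umodule \<Rightarrow>\<^sub>0 int) set"
  where "K0_kernel R = generate (free_Abelian_group (Rmod R)) (K0_relations R)"

definition K0 :: "('r, 'e) ring_scheme \<Rightarrow> ('r umodule \<Rightarrow>\<^sub>0 int) set monoid"
  where "K0 R = free_Abelian_group (Rmod R) Mod K0_kernel R"

text \<open>
  The class \<open>[M]\<close> of a finitely presented module on an arbitrary type, through an isomorphic
  member of \<open>Rmod R\<close>. (Cokernels of morphisms in \<open>Rmod R\<close> have a carrier of larger type.)
\<close>

definition K0_class ::
  "('r, 'e) ring_scheme \<Rightarrow> ('r, 'm) module \<Rightarrow> ('r umodule \<Rightarrow>\<^sub>0 int) set"
  where "K0_class R M =
    K0_kernel R #>\<^bsub>free_Abelian_group (Rmod R)\<^esub>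
      frag_of (SOME M'. M' \<in> Rmod R \<and> mod_iso R M' M)"

definition lmc ::
  "('r, 'e) ring_scheme \<Rightarrow> ('r, 'g) ab_functor \<Rightarrow> ('r umodule \<Rightarrow>\<^sub>0 int) set"
  where "lmc R G =
    (case presentation R G of (M, N, \<alpha>) \<Rightarrow>
      K0_class R M \<otimes>\<^bsub>K0 R\<^esub> inv\<^bsub>K0 R\<^esub> (K0_class R N)
        \<otimes>\<^bsub>K0 R\<^esub> K0_class R (quot_module N (\<alpha> ` carrier M)))"

text \<open>
  The homomorphism \<open>K\<^sub>0 \<rightarrow> \<int>\<close> induced by \<open>module_mult\<close>: the additive extension to the free
  abelian group is constant on each coset, and \<open>the_elem\<close> extracts its value there.
\<close>

definition K0_mult ::
  "('r, 'e) ring_scheme \<Rightarrow> 'r set \<Rightarrow> nat \<Rightarrow> ('r umodule \<Rightarrow>\<^sub>0 int) set \<Rightarrow> int"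
  where "K0_mult R I l x =
    the_elem ((\<lambda>c. \<Sum>M\<in>Poly_Mapping.keys c.
                 Poly_Mapping.lookup c M * int (module_mult R M I l)) ` x)"

definition functor_mult ::
  "('r, 'e) ring_scheme \<Rightarrow> ('r, 'g) ab_functor \<Rightarrow> 'r set \<Rightarrow> nat \<Rightarrow> int"
  where "functor_mult R G I l = K0_mult R I l (lmc R G)"

definition HilbP ::
  "('r, 'e) ring_scheme \<Rightarrow> ('r, 'g) ab_functor \<Rightarrow> 'r set \<Rightarrow> int poly"
  where "HilbP R G I =
    [: \<Sum>l | 1 \<le> l \<and> functor_mult R G I l \<noteq> 0. functor_mult R G I l * int l,
       int (functor_rank R G) :]"

end

theory Submission
  imports "HOL-Library.Extended_Nat" Defs
begin

text \<open>
  Let \<open>G\<close> be presented by \<open>\<alpha> : M \<rightarrow> N\<close> with cokernel \<open>C\<close>. Then \<open>G(X) = 0\<close> means that every homomorphism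
  \<open>M \<rightarrow> X\<close> factors through \<open>\<alpha>\<close>. The rank of \<open>G\<close> vanishes iff this holds for \<open>X = Quot R\<close>, i.e. iff
  \<open>ker \<alpha>\<close> is torsion. The constant term of the Hilbert polynomial is
  \<open>len(t M) - len(t N) + len(t C)\<close>, where \<open>t\<close> denotes the torsion submodule. If \<open>ker \<alpha>\<close> is torsion, the
  kernel and image sequences turn it into \<open>len(ker \<alpha>) + len(t C / im (t N))\<close>, so that it vanishes
  iff \<open>\<alpha>\<close> is injective and \<open>t N \<rightarrow> t C\<close> is onto. The first condition means \<open>G(P) = 0\<close>, since \<open>P\<close> is an
  injective cogenerator. Given the first, the second means \<open>G(A) = 0\<close>, since \<open>A\<close> is torsion free and
  \<open>\<pi>\<close> does not divide its element \<open>1\<close>.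

  Multiplicities are detected by the lengths of the \<open>\<pi>\<^sup>k\<close>-torsion submodules, whose second difference
  at \<open>l\<close> counts the summands \<open>R/\<pp>\<^sup>l\<close>.
\<close>

section \<open>Linear combinations\<close>

text \<open>Multiplicities are defined through an arbitrary decomposition and the functor through an
  arbitrary presentation, so an intrinsic invariant has to connect them. Length is chosen because
  \<open>len_tors M k\<close> depends on \<open>M\<close> alone: this yields uniqueness of the
  decomposition, invariance under isomorphism and additivity on direct sums at once. One integer can
  express two separate conditions only because, for torsion \<open>ker \<alpha>\<close>, it is a sum
  of two non-negative lengths. In general it may be negative: for R -> R/p it is -1, and the rank is
  1. Decompositions, finite presentation of the cokernel and coordinate functions all rest on one
  tool, generators whose relations hold term by term. Maps into \<open>Quot R\<close> and into
  \<open>A\<close> are extended by one argument: into a torsion-free target the extension is forced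
  wherever a power of \<pi> leads into the image of \<alpha>, and it may be taken to be zero on a
  complement of this part.\<close>

primrec lin_comb :: "('r, 'm, 'x) module_scheme \<Rightarrow> (nat \<Rightarrow> 'r) \<Rightarrow> (nat \<Rightarrow> 'm) \<Rightarrow> nat \<Rightarrow> 'm"
  where
    "lin_comb M c x 0 = \<zero>\<^bsub>M\<^esub>"
  | "lin_comb M c x (Suc n) = lin_comb M c x n \<oplus>\<^bsub>M\<^esub> c n \<odot>\<^bsub>M\<^esub> x n"

text \<open>Families indexed by \<open>i < n\<close> instead of sets: entries may repeat or be zero,
  and replacing one entry leaves the number of generators unchanged, as the exchange argument
  requires.\<close>

definition generates ::
  "('r, 'e) ring_scheme \<Rightarrow> ('r, 'm, 'x) module_scheme \<Rightarrow> (nat \<Rightarrow> 'm) \<Rightarrow> nat \<Rightarrow> bool"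
  where "generates R M x n \<longleftrightarrow> (\<forall>i<n. x i \<in> carrier M) \<and>
    (\<forall>m\<in>carrier M. \<exists>c. (\<forall>i<n. c i \<in> carrier R) \<and> m = lin_comb M c x n)"

definition independent ::
  "('r, 'e) ring_scheme \<Rightarrow> ('r, 'm, 'x) module_scheme \<Rightarrow> (nat \<Rightarrow> 'm) \<Rightarrow> nat \<Rightarrow> bool"
  where "independent R M x n \<longleftrightarrow>
    (\<forall>c. (\<forall>i<n. c i \<in> carrier R) \<longrightarrow> lin_comb M c x n = \<zero>\<^bsub>M\<^esub> \<longrightarrow>
      (\<forall>i<n. c i \<odot>\<^bsub>M\<^esub> x i = \<zero>\<^bsub>M\<^esub>))"

lemma lin_comb_cong:
  "(\<And>i. i < n \<Longrightarrow> c i = d i) \<Longrightarrow> (\<And>i. i < n \<Longrightarrow> x i = y i) \<Longrightarrow>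
    lin_comb M c x n = lin_comb M d y n"
  by (induction n) simp_all

context Module.module
begin

lemma lin_comb_closed [simp]:
  "(\<And>i. i < n \<Longrightarrow> c i \<in> carrier R) \<Longrightarrow> (\<And>i. i < n \<Longrightarrow> x i \<in> carrier M) \<Longrightarrow>
    lin_comb M c x n \<in> carrier M"
  by (induction n) simp_all

lemma lin_comb_add:
  assumes "\<And>i. i < n \<Longrightarrow> c i \<in> carrier R" "\<And>i. i < n \<Longrightarrow> d i \<in> carrier R"
    "\<And>i. i < n \<Longrightarrow> x i \<in> carrier M"
  shows "lin_comb M (\<lambda>i. c i \<oplus> d i) x n = lin_comb M c x n \<oplus>\<^bsub>M\<^esub> lin_comb M d x n"
  using assms by (induction n) (simp_all add: smult_l_distr M.a_ac)

lemma lin_comb_smult: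
  assumes "\<And>i. i < n \<Longrightarrow> c i \<in> carrier R" "r \<in> carrier R"
    "\<And>i. i < n \<Longrightarrow> x i \<in> carrier M"
  shows "lin_comb M (\<lambda>i. r \<otimes> c i) x n = r \<odot>\<^bsub>M\<^esub> lin_comb M c x n"
  using assms by (induction n) (simp_all add: smult_r_distr smult_assoc1)

lemma lin_comb_minus:
  assumes "\<And>i. i < n \<Longrightarrow> c i \<in> carrier R" "\<And>i. i < n \<Longrightarrow> d i \<in> carrier R"
    "\<And>i. i < n \<Longrightarrow> x i \<in> carrier M"
  shows "lin_comb M (\<lambda>i. c i \<ominus> d i) x n = lin_comb M c x n \<ominus>\<^bsub>M\<^esub> lin_comb M d x n"
proof -
  have "lin_comb M (\<lambda>i. c i \<ominus> d i) x n = lin_comb M (\<lambda>i. c i \<oplus> (\<ominus> \<one>) \<otimes> d i) x n"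
    using assms by (intro lin_comb_cong) (auto simp: R.minus_eq R.l_minus)
  also have "\<dots> = lin_comb M c x n \<oplus>\<^bsub>M\<^esub> (\<ominus> \<one>) \<odot>\<^bsub>M\<^esub> lin_comb M d x n"
    using assms by (subst lin_comb_add) (auto simp: lin_comb_smult)
  finally show ?thesis
    using assms by (simp add: smult_minus_1 M.minus_eq)
qed

lemma lin_comb_all_zero:
  "(\<And>i. i < n \<Longrightarrow> c i \<odot>\<^bsub>M\<^esub> x i = \<zero>\<^bsub>M\<^esub>) \<Longrightarrow> lin_comb M c x n = \<zero>\<^bsub>M\<^esub>"
  by (induction n) simp_all

lemma lin_comb_single:
  assumes "i < n" "\<And>j. j < n \<Longrightarrow> x j \<in> carrier M" "r \<in> carrier R"
  shows "lin_comb M (\<lambda>j. if j = i then r else \<zero>) x n = r \<odot>\<^bsub>M\<^esub> x i"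
  using assms
proof (induction n)
  case (Suc n)
  show ?case
  proof (cases "i = n")
    case True
    have "lin_comb M (\<lambda>j. if j = i then r else \<zero>) x n = \<zero>\<^bsub>M\<^esub>"
      using Suc.prems True by (intro lin_comb_all_zero) auto
    then show ?thesis using True Suc.prems by simp
  next
    case False
    then show ?thesis using Suc by simp
  qed
qed simp

lemma lin_comb_in_submodule:
  assumes "submodule R U M" "\<And>i. i < n \<Longrightarrow> c i \<in> carrier R" "\<And>i. i < n \<Longrightarrow> x i \<in> U"
  shows "lin_comb M c x n \<in> U"
  using assms(2,3)
  by (induction n) (simp_all add: submodule.zero_closed[OF assms(1)]
      submodule.m_closed[OF assms(1)] submodule.smult_closed[OF assms(1)])

lemma submoduleI':
  assumes "U \<subseteq> carrier M" "\<zero>\<^bsub>M\<^esub> \<in> U" "\<And>v w. v \<in> U \<Longrightarrow> w \<in> U \<Longrightarrow> v \<oplus>\<^bsub>M\<^esub> w \<in> U"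
    "\<And>c v. c \<in> carrier R \<Longrightarrow> v \<in> U \<Longrightarrow> c \<odot>\<^bsub>M\<^esub> v \<in> U"
  shows "submodule R U M"
  using assms module_axioms by (simp add: LinearCombinations.submodule_def)

lemma minus_zero_right [simp]: "x \<in> carrier M \<Longrightarrow> x \<ominus>\<^bsub>M\<^esub> \<zero>\<^bsub>M\<^esub> = x"
  by (metis M.minus_eq M.minus_equality M.r_zero M.zero_closed)

lemma submodule_uminus: "submodule R U M \<Longrightarrow> v \<in> U \<Longrightarrow> \<ominus>\<^bsub>M\<^esub> v \<in> U"
  by (metis R.add.inv_closed R.one_closed smult_minus_1 submodule.smult_closed submodule.subset
      subsetD)

lemma submodule_diff: "submodule R U M \<Longrightarrow> v \<in> U \<Longrightarrow> w \<in> U \<Longrightarrow> v \<ominus>\<^bsub>M\<^esub> w \<in> U"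
  by (simp add: M.minus_eq submodule.m_closed submodule_uminus)

lemma submodule_carrier: "submodule R (carrier M) M"
  by (rule submoduleI') auto

lemma submodule_zero: "submodule R {\<zero>\<^bsub>M\<^esub>} M"
  by (rule submoduleI') auto

lemma submodule_lin_combs:
  assumes "\<And>i. i < n \<Longrightarrow> x i \<in> carrier M"
  shows "submodule R {lin_comb M c x n | c. \<forall>i<n. c i \<in> carrier R} M" (is "submodule R ?U M")
proof (rule submoduleI')
  show "?U \<subseteq> carrier M" using assms by auto
  have "lin_comb M (\<lambda>_. \<zero>) x n = \<zero>\<^bsub>M\<^esub>" using assms by (intro lin_comb_all_zero) auto
  then show "\<zero>\<^bsub>M\<^esub> \<in> ?U" by force
next
  fix v w assume "v \<in> ?U" "w \<in> ?U"
  then obtain c d where "v = lin_comb M c x n" "\<forall>i<n. c i \<in> carrier R"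
    "w = lin_comb M d x n" "\<forall>i<n. d i \<in> carrier R" by blast
  then show "v \<oplus>\<^bsub>M\<^esub> w \<in> ?U"
    using assms by (auto intro!: exI[of _ "\<lambda>i. c i \<oplus> d i"] simp: lin_comb_add)
next
  fix r v assume "r \<in> carrier R" "v \<in> ?U"
  then obtain c where "v = lin_comb M c x n" "\<forall>i<n. c i \<in> carrier R" by blast
  then show "r \<odot>\<^bsub>M\<^esub> v \<in> ?U"
    using assms \<open>r \<in> carrier R\<close>
    by (auto intro!: exI[of _ "\<lambda>i. r \<otimes> c i"] simp: lin_comb_smult)
qed

lemma lin_comb_mem_gens:
  assumes "i < n" "\<And>j. j < n \<Longrightarrow> x j \<in> carrier M"
  shows "x i \<in> {lin_comb M c x n | c. \<forall>i<n. c i \<in> carrier R}"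
  using lin_comb_single[OF assms, where r = \<one>] assms
  by (auto intro!: exI[of _ "\<lambda>j. if j = i then \<one> else \<zero>"])

text \<open>The linear combinations of the \<open>x i\<close> form one such \<open>U\<close>. The
  criterion avoids coefficients: a modified family still generates as soon as the old entries are
  recovered inside every \<open>U\<close>.\<close>

lemma generatesI:
  assumes "\<And>i. i < n \<Longrightarrow> x i \<in> carrier M"
    "\<And>U. submodule R U M \<Longrightarrow> (\<And>i. i < n \<Longrightarrow> x i \<in> U) \<Longrightarrow> carrier M \<subseteq> U"
  shows "generates R M x n"
proof -
  have "carrier M \<subseteq> {lin_comb M c x n | c. \<forall>i<n. c i \<in> carrier R}"
    using assms by (intro assms(2) submodule_lin_combs lin_comb_mem_gens) auto
  then show ?thesis using assms(1) by (auto simp: generates_def)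
qed

lemma generates_submodule:
  assumes "generates R M x n" "submodule R U M" "\<And>i. i < n \<Longrightarrow> x i \<in> U"
  shows "U = carrier M"
  using assms lin_comb_in_submodule[OF assms(2)] submodule.subset[OF assms(2)]
  unfolding generates_def by fastforce

end

section \<open>Homomorphisms\<close>

lemma mod_homI: "module R M \<Longrightarrow> module R N \<Longrightarrow> f \<in> module_hom R M N \<Longrightarrow> mod_hom R M N f"
  by (simp add: mod_hom_def mod_hom_axioms_def)

lemma module_homI:
  assumes "\<And>m. m \<in> carrier M \<Longrightarrow> f m \<in> carrier N"
    "\<And>m m'. m \<in> carrier M \<Longrightarrow> m' \<in> carrier M \<Longrightarrow> f (m \<oplus>\<^bsub>M\<^esub> m') = f m \<oplus>\<^bsub>N\<^esub> f m'"
    "\<And>r m. r \<in> carrier R \<Longrightarrow> m \<in> carrier M \<Longrightarrow> f (r \<odot>\<^bsub>M\<^esub> m) = r \<odot>\<^bsub>N\<^esub> f m"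
  shows "f \<in> module_hom R M N"
  using assms by (auto simp: LinearCombinations.module_hom_def)

lemma hom_setD:
  assumes "f \<in> hom_set R M N"
  shows "f \<in> module_hom R M N" "f \<in> extensional (carrier M)"
  using assms by (auto simp: hom_set_def)

lemma hom_set_closed: "f \<in> hom_set R M N \<Longrightarrow> m \<in> carrier M \<Longrightarrow> f m \<in> carrier N"
  by (auto simp: hom_set_def LinearCombinations.module_hom_def)

lemma restrict_hom_set:
  assumes "module R M" "f \<in> module_hom R M N"
  shows "restrict f (carrier M) \<in> hom_set R M N"
proof -
  interpret M: Module.module R M by fact
  show ?thesis using assms(2) by (auto simp: hom_set_def LinearCombinations.module_hom_def)
qed

lemma module_hom_compose:
  assumes "f \<in> module_hom R M N" "g \<in> module_hom R N L"
  shows "(\<lambda>m. g (f m)) \<in> module_hom R M L"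
  using assms by (auto simp: LinearCombinations.module_hom_def Pi_def)

lemma compose_hom_set:
  assumes "module R M" "f \<in> hom_set R M N" "g \<in> hom_set R N L"
  shows "compose (carrier M) g f \<in> hom_set R M L"
  using restrict_hom_set[OF assms(1) module_hom_compose[OF hom_setD(1)[OF assms(2)]
        hom_setD(1)[OF assms(3)]]]
  by (simp add: compose_def)

context mod_hom
begin

lemma hom_lin_comb:
  assumes "\<And>i. i < n \<Longrightarrow> c i \<in> carrier R" "\<And>i. i < n \<Longrightarrow> x i \<in> carrier M"
  shows "f (lin_comb M c x n) = lin_comb N c (\<lambda>i. f (x i)) n"
  using assms by (induction n) simp_all

lemma image_submodule:
  assumes "submodule R U M" shows "submodule R (f ` U) N"
proof (rule N.submoduleI')
  interpret U: LinearCombinations.submodule R U M by fact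
  have sub: "\<And>u. u \<in> U \<Longrightarrow> u \<in> carrier M" using U.subset by blast
  show "f ` U \<subseteq> carrier N" using sub by auto
  show "\<zero>\<^bsub>N\<^esub> \<in> f ` U" using f0_is_0 U.zero_closed by (metis imageI)
  show "v \<oplus>\<^bsub>N\<^esub> w \<in> f ` U" if vw: "v \<in> f ` U" "w \<in> f ` U" for v w
  proof -
    obtain a b where ab: "a \<in> U" "v = f a" "b \<in> U" "w = f b" using vw by blast
    then have "v \<oplus>\<^bsub>N\<^esub> w = f (a \<oplus>\<^bsub>M\<^esub> b)" using sub by simp
    then show ?thesis using ab by blast
  qed
  show "c \<odot>\<^bsub>N\<^esub> v \<in> f ` U" if cv: "c \<in> carrier R" "v \<in> f ` U" for c v
  proof -
    obtain a where a: "a \<in> U" "v = f a" using cv by blast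
    then have "c \<odot>\<^bsub>N\<^esub> v = f (c \<odot>\<^bsub>M\<^esub> a)" using sub cv by simp
    then show ?thesis using a cv by blast
  qed
qed

lemma generates_image:
  assumes "generates R M x n" "f ` carrier M = carrier N"
  shows "generates R N (\<lambda>i. f (x i)) n"
  unfolding generates_def
proof (intro conjI allI impI ballI)
  fix i assume "i < n"
  then show "f (x i) \<in> carrier N" using assms by (auto simp: generates_def)
next
  fix m assume "m \<in> carrier N"
  then obtain m' where m': "m' \<in> carrier M" "m = f m'" using assms(2) by blast
  then obtain c where "\<forall>i<n. c i \<in> carrier R" "m' = lin_comb M c x n"
    using assms(1) by (auto simp: generates_def)
  then show "\<exists>c. (\<forall>i<n. c i \<in> carrier R) \<and> m = lin_comb N c (\<lambda>i. f (x i)) n"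
    using hom_lin_comb[of n c x] assms(1) m' by (auto simp: generates_def)
qed

lemma inj_on_iff_kernel:
  "inj_on f (carrier M) \<longleftrightarrow> (\<forall>m\<in>carrier M. f m = \<zero>\<^bsub>N\<^esub> \<longrightarrow> m = \<zero>\<^bsub>M\<^esub>)"
proof
  assume "inj_on f (carrier M)"
  then show "\<forall>m\<in>carrier M. f m = \<zero>\<^bsub>N\<^esub> \<longrightarrow> m = \<zero>\<^bsub>M\<^esub>"
    using f0_is_0 M.M.zero_closed by (metis inj_onD)
next
  assume *: "\<forall>m\<in>carrier M. f m = \<zero>\<^bsub>N\<^esub> \<longrightarrow> m = \<zero>\<^bsub>M\<^esub>"
  show "inj_on f (carrier M)"
  proof (rule inj_onI)
    fix a b assume ab: "a \<in> carrier M" "b \<in> carrier M" "f a = f b"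
    then have "f (a \<ominus>\<^bsub>M\<^esub> b) = \<zero>\<^bsub>N\<^esub>" by simp
    then have "a \<ominus>\<^bsub>M\<^esub> b = \<zero>\<^bsub>M\<^esub>" using * ab by blast
    then show "a = b" using ab by simp
  qed
qed

end

lemma inv_into_module_hom:
  assumes "module R M" "f \<in> module_hom R M N" "bij_betw f (carrier M) (carrier N)"
  shows "inv_into (carrier M) f \<in> module_hom R N M"
proof (rule module_homI)
  interpret M: Module.module R M by fact
  let ?g = "inv_into (carrier M) f"
  have g: "?g n \<in> carrier M" "f (?g n) = n" if "n \<in> carrier N" for n
    using assms(3) that by (auto simp: bij_betw_def inv_into_into f_inv_into_f)
  have gf: "?g (f m) = m" if "m \<in> carrier M" for m
    using assms(3) that by (auto simp: bij_betw_def)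
  show "?g n \<in> carrier M" if "n \<in> carrier N" for n using g that by blast
  show "?g (n \<oplus>\<^bsub>N\<^esub> n') = ?g n \<oplus>\<^bsub>M\<^esub> ?g n'" if "n \<in> carrier N" "n' \<in> carrier N" for n n'
    using g[OF that(1)] g[OF that(2)] gf[of "?g n \<oplus>\<^bsub>M\<^esub> ?g n'"]
    by (simp add: LinearCombinations.module_hom_add[OF assms(2)])
  show "?g (r \<odot>\<^bsub>N\<^esub> n) = r \<odot>\<^bsub>M\<^esub> ?g n" if "r \<in> carrier R" "n \<in> carrier N" for r n
    using g[OF that(2)] gf[of "r \<odot>\<^bsub>M\<^esub> ?g n"] that
    by (simp add: LinearCombinations.module_hom_smult[OF assms(2)])
qed

lemma mod_iso_refl: "mod_iso R M M"
  unfolding mod_iso_def by (rule bexI[of _ "\<lambda>x. x"]) (auto simp: LinearCombinations.module_hom_def bij_betw_def)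

lemma mod_iso_sym: "module R M \<Longrightarrow> mod_iso R M N \<Longrightarrow> mod_iso R N M"
  unfolding mod_iso_def by (meson bij_betw_inv_into inv_into_module_hom)

text \<open>A homomorphism is given by its graph, or by any total functional submodule of \<open>M \<oplus> D\<close>.\<close>

lemma hom_of_graph:
  assumes M: "module R M" and D: "module R D"
    and sub: "\<And>m d. Q m d \<Longrightarrow> m \<in> carrier M \<and> d \<in> carrier D"
    and total: "\<And>m. m \<in> carrier M \<Longrightarrow> \<exists>d. Q m d"
    and add: "\<And>m d m' d'. Q m d \<Longrightarrow> Q m' d' \<Longrightarrow> Q (m \<oplus>\<^bsub>M\<^esub> m') (d \<oplus>\<^bsub>D\<^esub> d')"
    and smult: "\<And>r m d. r \<in> carrier R \<Longrightarrow> Q m d \<Longrightarrow> Q (r \<odot>\<^bsub>M\<^esub> m) (r \<odot>\<^bsub>D\<^esub> d)"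
    and zero: "\<And>d. Q \<zero>\<^bsub>M\<^esub> d \<Longrightarrow> d = \<zero>\<^bsub>D\<^esub>"
  shows "\<exists>f\<in>hom_set R M D. \<forall>m d. Q m d \<longrightarrow> f m = d"
proof -
  interpret M: Module.module R M by fact
  interpret D: Module.module R D by fact
  have uniq: "d = d'" if "Q m d" "Q m d'" for m d d'
  proof -
    \<comment> \<open>Only sums and scalar multiples of pairs are available, so the difference of
      the two pairs is formed with the scalar -1. Its second component is then a value at
      zero.\<close>
    have "Q (m \<oplus>\<^bsub>M\<^esub> (\<ominus>\<^bsub>R\<^esub> \<one>\<^bsub>R\<^esub>) \<odot>\<^bsub>M\<^esub> m) (d \<oplus>\<^bsub>D\<^esub> (\<ominus>\<^bsub>R\<^esub> \<one>\<^bsub>R\<^esub>) \<odot>\<^bsub>D\<^esub> d')"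
      using that by (intro add smult) auto
    moreover have "m \<in> carrier M" "d \<in> carrier D" "d' \<in> carrier D" using that sub by auto
    ultimately have "Q \<zero>\<^bsub>M\<^esub> (d \<ominus>\<^bsub>D\<^esub> d')"
      by (simp add: M.smult_minus_1 D.smult_minus_1 M.M.r_neg D.M.minus_eq)
    then show ?thesis using zero \<open>d \<in> carrier D\<close> \<open>d' \<in> carrier D\<close> by fastforce
  qed
  define f where "f = (\<lambda>m\<in>carrier M. THE d. Q m d)"
  have f: "f m = d" if "Q m d" for m d
    using sub[OF that] the_equality[where P = "Q m", OF that uniq[OF _ that]] by (simp add: f_def)
  have "f \<in> module_hom R M D"
  proof (rule module_homI)
    show "f m \<in> carrier D" if "m \<in> carrier M" for m using total[OF that] f sub by blast
    show "f (m \<oplus>\<^bsub>M\<^esub> m') = f m \<oplus>\<^bsub>D\<^esub> f m'" if "m \<in> carrier M" "m' \<in> carrier M" for m m'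
      using total[OF that(1)] total[OF that(2)] f add[THEN f] by auto
    show "f (r \<odot>\<^bsub>M\<^esub> m) = r \<odot>\<^bsub>D\<^esub> f m" if "r \<in> carrier R" "m \<in> carrier M" for r m
      using total[OF that(2)] f smult[OF that(1), THEN f] by auto
  qed
  then have "f \<in> hom_set R M D" by (simp add: hom_set_def f_def)
  then show ?thesis using f by blast
qed

section \<open>Quotients, sums and products\<close>

context Module.module
begin

lemma submodule_abelian_subgroup:
  assumes "submodule R U M" shows "abelian_subgroup U M"
proof -
  interpret U: LinearCombinations.submodule R U M by fact
  have "subgroup U (add_monoid M)"
    using U.subset submodule_uminus[OF assms]
    by (intro subgroup.intro) (auto simp: a_inv_def)
  then show ?thesis
    by (intro abelian_subgroupI3 additive_subgroup.intro M.abelian_group_axioms) auto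
qed

lemma coset_eq_iff:
  assumes "submodule R U M" "x \<in> carrier M" "y \<in> carrier M"
  shows "U +>\<^bsub>M\<^esub> x = U +>\<^bsub>M\<^esub> y \<longleftrightarrow> x \<ominus>\<^bsub>M\<^esub> y \<in> U"
proof -
  interpret U: abelian_subgroup U M using assms(1) by (rule submodule_abelian_subgroup)
  have "x \<in> U +>\<^bsub>M\<^esub> y \<longleftrightarrow> x \<ominus>\<^bsub>M\<^esub> y \<in> U"
    using assms U.a_rcos_module M.minus_eq by simp
  moreover have "U +>\<^bsub>M\<^esub> x = U +>\<^bsub>M\<^esub> y \<longleftrightarrow> x \<in> U +>\<^bsub>M\<^esub> y"
    using assms U.a_repr_independence' U.a_rcos_self by blast
  ultimately show ?thesis by simp
qed

end

lemma carrier_quot_module: "carrier (quot_module M U) = (\<lambda>x. U +>\<^bsub>M\<^esub> x) ` carrier M"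
  by (auto simp: quot_module_def A_RCOSETS_def')

context
  fixes R :: "('r, 'e) ring_scheme" and M :: "('r, 'm) module" and U :: "'m set"
  assumes module: "module R M" and submodule: "submodule R U M"
begin

interpretation M: Module.module R M by (rule module)

lemma quot_module_add:
  assumes "x \<in> carrier M" "y \<in> carrier M"
  shows "(U +>\<^bsub>M\<^esub> x) \<oplus>\<^bsub>quot_module M U\<^esub> (U +>\<^bsub>M\<^esub> y) = U +>\<^bsub>M\<^esub> (x \<oplus>\<^bsub>M\<^esub> y)"
proof -
  interpret U: abelian_subgroup U M using submodule by (rule M.submodule_abelian_subgroup)
  show ?thesis using assms by (simp add: quot_module_def U.a_rcos_sum)
qed

lemma quot_module_smult:
  assumes "x \<in> carrier M" "r \<in> carrier R"
  shows "r \<odot>\<^bsub>quot_module M U\<^esub> (U +>\<^bsub>M\<^esub> x) = U +>\<^bsub>M\<^esub> (r \<odot>\<^bsub>M\<^esub> x)"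
proof -
  interpret U: abelian_subgroup U M using submodule by (rule M.submodule_abelian_subgroup)
  interpret S: LinearCombinations.submodule R U M by (rule submodule)
  \<comment> \<open>The action on a coset is defined as a union over representatives. All members of
    the union agree, since \<open>y - x \<in> U\<close> implies
    \<open>r (y - x) \<in> U\<close>.\<close>
  have eq: "U +>\<^bsub>M\<^esub> (r \<odot>\<^bsub>M\<^esub> y) = U +>\<^bsub>M\<^esub> (r \<odot>\<^bsub>M\<^esub> x)" if "y \<in> U +>\<^bsub>M\<^esub> x" for y
  proof -
    have y: "y \<in> carrier M" using that assms U.a_elemrcos_carrier by blast
    then have "y \<ominus>\<^bsub>M\<^esub> x \<in> U"
      using that assms U.a_rcos_module M.M.minus_eq by simp
    then have "r \<odot>\<^bsub>M\<^esub> (y \<ominus>\<^bsub>M\<^esub> x) \<in> U" using assms by simp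
    then have "r \<odot>\<^bsub>M\<^esub> y \<ominus>\<^bsub>M\<^esub> r \<odot>\<^bsub>M\<^esub> x \<in> U"
      using assms y by (simp add: M.M.minus_eq M.smult_r_distr M.smult_r_minus)
    then show ?thesis using M.coset_eq_iff[OF submodule] assms y by simp
  qed
  have "(\<Union>y\<in>U +>\<^bsub>M\<^esub> x. U +>\<^bsub>M\<^esub> (r \<odot>\<^bsub>M\<^esub> y)) = (\<Union>y\<in>U +>\<^bsub>M\<^esub> x. U +>\<^bsub>M\<^esub> (r \<odot>\<^bsub>M\<^esub> x))"
    using eq by (rule SUP_cong[OF refl])
  also have "\<dots> = U +>\<^bsub>M\<^esub> (r \<odot>\<^bsub>M\<^esub> x)"
    using U.a_rcos_self[OF assms(1)] by blast
  finally show ?thesis by (simp add: quot_module_def)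
qed

lemma quot_module_zero: "\<zero>\<^bsub>quot_module M U\<^esub> = U +>\<^bsub>M\<^esub> \<zero>\<^bsub>M\<^esub>"
  by (simp add: quot_module_def
      M.M.a_coset_add_zero[OF LinearCombinations.submodule.subset[OF submodule]])

lemma quot_module_is_module:
  shows "module R (quot_module M U)"
proof -
  note quot = quot_module_add quot_module_smult quot_module_zero
  have closed: "U +>\<^bsub>M\<^esub> x \<in> carrier (quot_module M U)" if "x \<in> carrier M" for x
    using that by (simp add: carrier_quot_module)
  have repr: "\<exists>x\<in>carrier M. v = U +>\<^bsub>M\<^esub> x" if "v \<in> carrier (quot_module M U)" for v
    using that unfolding carrier_quot_module image_iff .
  show ?thesis
  proof (rule module_criteria, goal_cases)
    case 1
    show ?case by (rule M.R.cring_axioms)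
  next
    case 2
    show ?case by (simp add: quot closed)
  next
    case 4
    show ?case
    proof
      fix v assume "v \<in> carrier (quot_module M U)"
      then obtain x where x: "x \<in> carrier M" "v = U +>\<^bsub>M\<^esub> x" using repr by blast
      then have "v \<oplus>\<^bsub>quot_module M U\<^esub> (U +>\<^bsub>M\<^esub> (\<ominus>\<^bsub>M\<^esub> x)) = \<zero>\<^bsub>quot_module M U\<^esub>"
        by (simp add: quot M.M.r_neg)
      then show "\<exists>n\<in>carrier (quot_module M U). v \<oplus>\<^bsub>quot_module M U\<^esub> n = \<zero>\<^bsub>quot_module M U\<^esub>"
        using closed x by blast
    qed
  qed (intro allI ballI impI; (elim conjE)?; (drule repr)+; clarify;
      simp add: quot closed M.M.a_ac M.smult_assoc1 M.smult_l_distr M.smult_r_distr)+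
qed

lemma coset_hom: "(\<lambda>x. U +>\<^bsub>M\<^esub> x) \<in> module_hom R M (quot_module M U)"
  by (rule module_homI) (simp_all add: carrier_quot_module quot_module_add quot_module_smult)

lemma coset_eq_zero_iff:
  assumes "x \<in> carrier M"
  shows "U +>\<^bsub>M\<^esub> x = \<zero>\<^bsub>quot_module M U\<^esub> \<longleftrightarrow> x \<in> U"
  using assms by (simp add: quot_module_zero M.coset_eq_iff[OF submodule])

end

text \<open>The isomorphism is obtained in the direction from \<open>M\<close> to the quotient, from
  the graph of all pairs (f x, K + x). That \<open>K\<close> is the kernel makes it single-valued
  and injective, and no preimages have to be chosen.\<close>

lemma first_iso:
  assumes "module R X" "module R M" "f \<in> module_hom R X M" "f ` carrier X = carrier M"
    and K: "K = {x \<in> carrier X. f x = \<zero>\<^bsub>M\<^esub>}"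
  shows "mod_iso R M (quot_module X K)"
proof -
  interpret f: mod_hom R X M f using assms by (intro mod_homI)
  have sub: "submodule R K X" using f.ker_is_submodule by (simp add: K f.ker_def)
  interpret Q: Module.module R "quot_module X K" by (rule quot_module_is_module[OF assms(1) sub])
  note qadd = quot_module_add[OF assms(1) sub] and qsmult = quot_module_smult[OF assms(1) sub]
  let ?Q = "\<lambda>m d. \<exists>x\<in>carrier X. m = f x \<and> d = K +>\<^bsub>X\<^esub> x"
  have "\<exists>g\<in>hom_set R M (quot_module X K). \<forall>m d. ?Q m d \<longrightarrow> g m = d"
  proof (rule hom_of_graph[OF assms(2) Q.module_axioms])
    show "\<exists>d. ?Q m d" if "m \<in> carrier M" for m
      using that unfolding assms(4)[symmetric] by (elim imageE) blast
    show "?Q (m \<oplus>\<^bsub>M\<^esub> m') (d \<oplus>\<^bsub>quot_module X K\<^esub> d')" if Q: "?Q m d" "?Q m' d'" for m d m' d'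
    proof -
      obtain x x' where "x \<in> carrier X" "m = f x" "d = K +>\<^bsub>X\<^esub> x"
         "x' \<in> carrier X" "m' = f x'" "d' = K +>\<^bsub>X\<^esub> x'" using Q by blast
      then show ?thesis by (intro bexI[of _ "x \<oplus>\<^bsub>X\<^esub> x'"]) (simp_all add: qadd)
    qed
    show "?Q (r \<odot>\<^bsub>M\<^esub> m) (r \<odot>\<^bsub>quot_module X K\<^esub> d)" if "r \<in> carrier R" and Q: "?Q m d" for r m d
    proof -
      obtain x where "x \<in> carrier X" "m = f x" "d = K +>\<^bsub>X\<^esub> x" using Q by blast
      then show ?thesis using that(1) by (intro bexI[of _ "r \<odot>\<^bsub>X\<^esub> x"]) (simp_all add: qsmult)
    qed
    show "d = \<zero>\<^bsub>quot_module X K\<^esub>" if Q: "?Q \<zero>\<^bsub>M\<^esub> d" for d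
    proof -
      obtain x where x: "x \<in> carrier X" "\<zero>\<^bsub>M\<^esub> = f x \<and> d = K +>\<^bsub>X\<^esub> x"
        using Q ..
      then have "x \<in> K" unfolding K by simp
      then show ?thesis using x(2) coset_eq_zero_iff[OF assms(1) sub x(1)] by simp
    qed
  qed (elim bexE conjE; simp add: carrier_quot_module)
  then obtain g where g: "g \<in> hom_set R M (quot_module X K)"
    "\<And>x. x \<in> carrier X \<Longrightarrow> g (f x) = K +>\<^bsub>X\<^esub> x" by blast
  interpret g: mod_hom R M "quot_module X K" g
    by (rule mod_homI[OF assms(2) Q.module_axioms hom_setD(1)[OF g(1)]])
  have "inj_on g (carrier M)"
    unfolding g.inj_on_iff_kernel
  proof (intro ballI impI)
    fix m assume m: "m \<in> carrier M" "g m = \<zero>\<^bsub>quot_module X K\<^esub>"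
    then obtain x where x: "x \<in> carrier X" "m = f x"
      unfolding assms(4)[symmetric] by (elim imageE)
    then have "x \<in> K" using m(2) g(2)[OF x(1)] coset_eq_zero_iff[OF assms(1) sub x(1)] by simp
    then show "m = \<zero>\<^bsub>M\<^esub>" using x(2) unfolding K by simp
  qed
  moreover have "g ` carrier M = carrier (quot_module X K)"
    unfolding carrier_quot_module assms(4)[symmetric] image_image using g(2) by simp
  ultimately show ?thesis
    unfolding mod_iso_def bij_betw_def by (intro bexI[where x = g] conjI hom_setD(1)[OF g(1)])
qed

lemma product_module_simps:
  "carrier (product_module I M) = (\<Pi>\<^sub>E i\<in>I. carrier (M i))"
  "\<zero>\<^bsub>product_module I M\<^esub> = (\<lambda>i\<in>I. \<zero>\<^bsub>M i\<^esub>)"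
  "v \<oplus>\<^bsub>product_module I M\<^esub> w = (\<lambda>i\<in>I. v i \<oplus>\<^bsub>M i\<^esub> w i)"
  "r \<odot>\<^bsub>product_module I M\<^esub> v = (\<lambda>i\<in>I. r \<odot>\<^bsub>M i\<^esub> v i)"
  by (simp_all add: product_module_def)

lemma product_module_is_module:
  assumes "cring R" "\<And>i. i \<in> I \<Longrightarrow> module R (M i)"
  shows "module R (product_module I M)"
proof -
  have neg: "\<exists>n\<in>carrier (product_module I M). v \<oplus>\<^bsub>product_module I M\<^esub> n = \<zero>\<^bsub>product_module I M\<^esub>"
    if "v \<in> carrier (product_module I M)" for v
  proof (intro bexI)
    have *: "\<And>i. i \<in> I \<Longrightarrow> abelian_group (M i)" using assms(2) by (simp add: Module.module_def)
    show "v \<oplus>\<^bsub>product_module I M\<^esub> (\<lambda>i\<in>I. \<ominus>\<^bsub>M i\<^esub> v i) = \<zero>\<^bsub>product_module I M\<^esub>"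
      using that abelian_group.r_neg[OF *]
      by (auto simp: product_module_simps fun_eq_iff PiE_iff)
    show "(\<lambda>i\<in>I. \<ominus>\<^bsub>M i\<^esub> v i) \<in> carrier (product_module I M)"
      using that abelian_group.a_inv_closed[OF *] by (auto simp: product_module_simps)
  qed
  have ab: "\<And>i. i \<in> I \<Longrightarrow> abelian_monoid (M i)"
    using assms(2) by (simp add: Module.module_def abelian_group_def)
  have eqI: "(\<lambda>i\<in>I. f i) = (\<lambda>i\<in>I. g i)" if "\<And>i. i \<in> I \<Longrightarrow> f i = g i" for f g
    using that by auto
  note facts = abelian_monoid.a_closed[OF ab] abelian_monoid.zero_closed[OF ab]
    module.smult_closed[OF assms(2)]
    module.smult_l_distr[OF assms(2)] module.smult_r_distr[OF assms(2)]
    module.smult_assoc1[OF assms(2)] module.smult_one[OF assms(2)]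
    abelian_monoid.a_assoc[OF ab] abelian_monoid.r_zero[OF ab]
  interpret cring R by fact
  note [simp] = product_module_simps PiE_iff facts
  show ?thesis
  proof (rule module_criteria, goal_cases)
    case 4
    show ?case using neg by blast
  next
    case 6
    show ?case
    proof (intro allI impI, elim conjE)
      fix v w assume "v \<in> carrier (product_module I M)" "w \<in> carrier (product_module I M)"
      then have "v i \<oplus>\<^bsub>M i\<^esub> w i = w i \<oplus>\<^bsub>M i\<^esub> v i" if "i \<in> I" for i
        using abelian_monoid.a_comm[OF ab[OF that], of "v i" "w i"] that by simp
      then show "v \<oplus>\<^bsub>product_module I M\<^esub> w = w \<oplus>\<^bsub>product_module I M\<^esub> v"
        unfolding product_module_simps by (rule eqI)
    qed
  next
    case 8
    show ?case
    proof
      fix v assume v: "v \<in> carrier (product_module I M)"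
      \<comment> \<open>The componentwise law only yields the restriction of \<open>v\<close> to
        \<open>I\<close>; this is \<open>v\<close> because elements of the product are
        extensional.\<close>
      then have "(\<lambda>i\<in>I. v i \<oplus>\<^bsub>M i\<^esub> (\<lambda>i\<in>I. \<zero>\<^bsub>M i\<^esub>) i) = (\<lambda>i\<in>I. v i)"
        by (intro eqI) simp
      then show "v \<oplus>\<^bsub>product_module I M\<^esub> \<zero>\<^bsub>product_module I M\<^esub> = v"
        using PiE_restrict[OF v[unfolded product_module_simps]]
        unfolding product_module_simps by metis
    qed
  next
    case 10
    show ?case
    proof
      fix v assume v: "v \<in> carrier (product_module I M)"
      then have "(\<lambda>i\<in>I. \<one>\<^bsub>R\<^esub> \<odot>\<^bsub>M i\<^esub> v i) = (\<lambda>i\<in>I. v i)"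
        by (intro eqI) simp
      then show "\<one>\<^bsub>R\<^esub> \<odot>\<^bsub>product_module I M\<^esub> v = v"
        using PiE_restrict[OF v[unfolded product_module_simps]]
        unfolding product_module_simps by metis
    qed
  qed (use assms(1) in \<open>simp_all cong: restrict_cong\<close>)
qed

lemma regular_module_is_module:
  assumes "cring R" shows "module R (regular_module R)"
proof -
  interpret cring R by fact
  show ?thesis
  proof (rule module_criteria, goal_cases)
    case 4
    show ?case
    proof
      fix v assume "v \<in> carrier (regular_module R)"
      then show "\<exists>n\<in>carrier (regular_module R).
          v \<oplus>\<^bsub>regular_module R\<^esub> n = \<zero>\<^bsub>regular_module R\<^esub>"
        by (intro bexI[where x = "\<ominus>\<^bsub>R\<^esub> v"]) (simp_all add: regular_module_def r_neg)
    qed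
  qed (simp_all add: regular_module_def a_ac m_assoc l_distr r_distr cring_axioms)
qed

lemma direct_sum_simps:
  "carrier (direct_sum M N) = carrier M \<times> carrier N"
  "\<zero>\<^bsub>direct_sum M N\<^esub> = (\<zero>\<^bsub>M\<^esub>, \<zero>\<^bsub>N\<^esub>)"
  "v \<oplus>\<^bsub>direct_sum M N\<^esub> w = (fst v \<oplus>\<^bsub>M\<^esub> fst w, snd v \<oplus>\<^bsub>N\<^esub> snd w)"
  "r \<odot>\<^bsub>direct_sum M N\<^esub> v = (r \<odot>\<^bsub>M\<^esub> fst v, r \<odot>\<^bsub>N\<^esub> snd v)"
  by (simp_all add: direct_sum_def)

section \<open>Length\<close>

text \<open>\<open>U\<close> is the top of a chain with \<open>n\<close> strict inclusions. Its
  bottom is arbitrary, which is harmless because only the supremum of all such \<open>n\<close> is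
  used.\<close>

inductive chain ::
  "('r, 'e) ring_scheme \<Rightarrow> ('r, 'm, 'x) module_scheme \<Rightarrow> 'm set \<Rightarrow> nat \<Rightarrow> bool"
  for R M
  where
    chain_0: "submodule R U M \<Longrightarrow> chain R M U 0"
  | chain_Suc: "chain R M U n \<Longrightarrow> submodule R V M \<Longrightarrow> U \<subset> V \<Longrightarrow> chain R M V (Suc n)"

text \<open>With values in \<open>enat\<close>, additivity along kernel and image holds for every
  submodule. Finiteness matters only when lengths are converted to integers in order to be
  subtracted.\<close>

definition len :: "('r, 'e) ring_scheme \<Rightarrow> ('r, 'm, 'x) module_scheme \<Rightarrow> 'm set \<Rightarrow> enat"
  where "len R M U = (SUP n\<in>{n. chain R M U n}. enat n)"

lemma chain_le_len: "chain R M U n \<Longrightarrow> enat n \<le> len R M U"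
  unfolding len_def by (rule SUP_upper) simp

lemma len_leI: "(\<And>n. chain R M U n \<Longrightarrow> enat n \<le> b) \<Longrightarrow> len R M U \<le> b"
  unfolding len_def by (rule SUP_least) simp

lemma chain_mono:
  assumes "chain R M U n" "U \<subseteq> V" "submodule R V M" shows "chain R M V n"
  using assms(1)
proof cases
  case chain_0
  then show ?thesis using chain.chain_0[OF assms(3)] by simp
next
  case (chain_Suc n' U')
  then show ?thesis using chain.chain_Suc[OF _ assms(3)] assms(2) by blast
qed

lemma len_mono: "U \<subseteq> V \<Longrightarrow> submodule R V M \<Longrightarrow> len R M U \<le> len R M V"
  by (intro len_leI chain_le_len) (rule chain_mono)

lemma len_strict:
  assumes "U \<subset> V" "submodule R U M" "submodule R V M" shows "len R M U + 1 \<le> len R M V"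
proof (cases "len R M V")
  case (enat m)
  have *: "Suc n \<le> m" if "chain R M U n" for n
    using chain_le_len[OF chain_Suc[OF that assms(3,1)]] enat by simp
  \<comment> \<open>The chain of length zero at \<open>U\<close> already gives this bound, so the
    truncated subtraction \<open>m - 1\<close> is exact.\<close>
  have "1 \<le> m" using *[OF chain_0[OF assms(2)]] by simp
  have "len R M U \<le> enat (m - 1)"
    using * by (intro len_leI) fastforce
  then have "len R M U + 1 \<le> enat (m - 1) + 1" by (rule add_right_mono)
  also have "\<dots> = enat m" using \<open>1 \<le> m\<close> by (simp add: one_enat_def)
  finally show ?thesis using enat by simp
qed simp

lemma chain_submodule: "chain R M U n \<Longrightarrow> submodule R U M"
  by (cases rule: chain.cases)

text \<open>Along a chain below \<open>W\<close> such a \<phi> gains at least one at each inclusion,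
  so it dominates every chain length. The upper bounds for lengths below come from suitable
  functions \<phi>.\<close>

lemma len_least:
  fixes \<phi> :: "'m set \<Rightarrow> enat"
  assumes "\<And>U V. submodule R U M \<Longrightarrow> submodule R V M \<Longrightarrow> U \<subset> V \<Longrightarrow> V \<subseteq> W \<Longrightarrow> \<phi> U + 1 \<le> \<phi> V"
  shows "len R M W \<le> \<phi> W"
proof (rule len_leI)
  have "U \<subseteq> W \<Longrightarrow> enat n \<le> \<phi> U" if "chain R M U n" for U n
    using that
  proof (induction rule: chain.induct)
    case (chain_0 U)
    then show ?case by (simp add: zero_enat_def[symmetric])
  next
    case (chain_Suc U n V)
    then have "enat n + 1 \<le> \<phi> U + 1" by (intro add_right_mono) auto
    also have "\<dots> \<le> \<phi> V"
      using chain_Suc by (intro assms) (auto dest: chain_submodule)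
    finally show ?case by (simp add: one_enat_def)
  qed
  then show "enat n \<le> \<phi> W" if "chain R M W n" for n using that by blast
qed

lemma (in Module.module) len_zero: "len R M {\<zero>\<^bsub>M\<^esub>} = 0"
proof -
  have "len R M {\<zero>\<^bsub>M\<^esub>} \<le> enat 0"
  proof (rule len_leI)
    fix n assume n: "chain R M {\<zero>\<^bsub>M\<^esub>} n"
    have "\<not> chain R M {\<zero>\<^bsub>M\<^esub>} (Suc m)" for m
    proof
      assume "chain R M {\<zero>\<^bsub>M\<^esub>} (Suc m)"
      then show False
      proof cases
        case (chain_Suc U)
        then have "\<zero>\<^bsub>M\<^esub> \<in> U"
          using chain_submodule LinearCombinations.submodule.zero_closed by blast
        then show False using chain_Suc by blast
      qed
    qed
    then show "enat n \<le> enat 0" using n by (cases n) simp_all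
  qed
  then show ?thesis by (simp add: zero_enat_def[symmetric])
qed

lemma (in Module.module) len_eq_0_iff:
  assumes "submodule R U M" shows "len R M U = 0 \<longleftrightarrow> U = {\<zero>\<^bsub>M\<^esub>}"
proof
  assume 0: "len R M U = 0"
  show "U = {\<zero>\<^bsub>M\<^esub>}"
  proof (rule ccontr)
    assume "U \<noteq> {\<zero>\<^bsub>M\<^esub>}"
    then have "{\<zero>\<^bsub>M\<^esub>} \<subset> U"
      using LinearCombinations.submodule.zero_closed[OF assms] by blast
    then have "len R M {\<zero>\<^bsub>M\<^esub>} + 1 \<le> 0"
      using len_strict[OF _ submodule_zero assms] 0 by metis
    then show False by simp
  qed
qed (simp add: len_zero)

text \<open>For the upper bound, the right-hand side is a rank function: of the kernel part and the
  image at least one grows with every strict inclusion. For the lower bound, chains in the image are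
  pulled back to chains above the kernel.\<close>

lemma (in mod_hom) len_ker_im:
  assumes U: "submodule R U M"
  shows "len R M U = len R M {x \<in> U. f x = \<zero>\<^bsub>N\<^esub>} + len R N (f ` U)"
proof (rule antisym)
  have ker: "submodule R {x \<in> V. f x = \<zero>\<^bsub>N\<^esub>} M" if V: "submodule R V M" for V
  proof (rule M.submoduleI')
    interpret V: LinearCombinations.submodule R V M by (rule V)
    have c: "\<And>v. v \<in> V \<Longrightarrow> v \<in> carrier M" using V.subset by blast
    show "{x \<in> V. f x = \<zero>\<^bsub>N\<^esub>} \<subseteq> carrier M" using c by blast
    show "\<zero>\<^bsub>M\<^esub> \<in> {x \<in> V. f x = \<zero>\<^bsub>N\<^esub>}" by simp
    show "v \<oplus>\<^bsub>M\<^esub> w \<in> {x \<in> V. f x = \<zero>\<^bsub>N\<^esub>}"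
      if "v \<in> {x \<in> V. f x = \<zero>\<^bsub>N\<^esub>}" "w \<in> {x \<in> V. f x = \<zero>\<^bsub>N\<^esub>}" for v w
      using that c by simp
    show "r \<odot>\<^bsub>M\<^esub> v \<in> {x \<in> V. f x = \<zero>\<^bsub>N\<^esub>}"
      if "r \<in> carrier R" "v \<in> {x \<in> V. f x = \<zero>\<^bsub>N\<^esub>}" for r v
      using that c by simp
  qed
  show "len R M U \<le> len R M {x \<in> U. f x = \<zero>\<^bsub>N\<^esub>} + len R N (f ` U)"
  proof (rule len_least)
    fix V W assume V: "submodule R V M" and W: "submodule R W M" and VW: "V \<subset> W"
    have sub: "\<And>v. v \<in> W \<Longrightarrow> v \<in> carrier M" "\<And>v. v \<in> V \<Longrightarrow> v \<in> carrier M"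
      using LinearCombinations.submodule.subset[OF W] VW by blast+
    have m1: "{x \<in> V. f x = \<zero>\<^bsub>N\<^esub>} \<subseteq> {x \<in> W. f x = \<zero>\<^bsub>N\<^esub>}" and m2: "f ` V \<subseteq> f ` W"
      using VW by auto
    have "{x \<in> V. f x = \<zero>\<^bsub>N\<^esub>} \<subset> {x \<in> W. f x = \<zero>\<^bsub>N\<^esub>} \<or> f ` V \<subset> f ` W"
    proof (rule ccontr)
      assume "\<not> ?thesis"
      then have e1: "{x \<in> V. f x = \<zero>\<^bsub>N\<^esub>} = {x \<in> W. f x = \<zero>\<^bsub>N\<^esub>}" and e2: "f ` V = f ` W"
        using m1 m2 by blast+
      \<comment> \<open>Modular law: if kernel parts and images agree, subtract from
        \<open>w\<close> an element \<open>v\<close> of the smaller submodule with the same image.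
        The difference lies in the common kernel part, so \<open>w\<close> lies in the smaller
        submodule after all.\<close>
      obtain w where w: "w \<in> W" "w \<notin> V" using VW by blast
      then obtain v where v: "v \<in> V" "f w = f v" using e2 by (metis imageE imageI)
      have cw: "w \<in> carrier M" and cv: "v \<in> carrier M" using w v sub by auto
      have "v \<in> W" using v VW by blast
      then have "w \<ominus>\<^bsub>M\<^esub> v \<in> W" using M.submodule_diff[OF W w(1)] by blast
      moreover have "f (w \<ominus>\<^bsub>M\<^esub> v) = \<zero>\<^bsub>N\<^esub>" using v cv cw by simp
      ultimately have "w \<ominus>\<^bsub>M\<^esub> v \<in> V" using e1 by blast
      then have "(w \<ominus>\<^bsub>M\<^esub> v) \<oplus>\<^bsub>M\<^esub> v \<in> V"
        using LinearCombinations.submodule.m_closed[OF V] v by blast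
      moreover have "(w \<ominus>\<^bsub>M\<^esub> v) \<oplus>\<^bsub>M\<^esub> v = w"
        using cv cw by (simp add: M.M.minus_eq M.M.a_assoc M.M.l_neg)
      ultimately show False using w by simp
    qed
    then show "len R M {x \<in> V. f x = \<zero>\<^bsub>N\<^esub>} + len R N (f ` V) + 1
      \<le> len R M {x \<in> W. f x = \<zero>\<^bsub>N\<^esub>} + len R N (f ` W)"
    proof
      assume "{x \<in> V. f x = \<zero>\<^bsub>N\<^esub>} \<subset> {x \<in> W. f x = \<zero>\<^bsub>N\<^esub>}"
      then have "len R M {x \<in> V. f x = \<zero>\<^bsub>N\<^esub>} + 1 \<le> len R M {x \<in> W. f x = \<zero>\<^bsub>N\<^esub>}"
        by (intro len_strict ker V W)
      from add_mono[OF this len_mono[OF m2 image_submodule[OF W]]] show ?thesis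
        by (simp add: ac_simps)
    next
      assume "f ` V \<subset> f ` W"
      then have "len R N (f ` V) + 1 \<le> len R N (f ` W)"
        by (intro len_strict image_submodule V W)
      from add_mono[OF len_mono[OF m1 ker[OF W]] this] show ?thesis
        by (simp add: ac_simps)
    qed
  qed
  have pre: "submodule R {x \<in> U. f x \<in> W} M" if W: "submodule R W N" for W
  proof -
    interpret U: LinearCombinations.submodule R U M by (rule U)
    interpret W: LinearCombinations.submodule R W N by (rule W)
    have c: "\<And>v. v \<in> U \<Longrightarrow> v \<in> carrier M" using U.subset by blast
    show ?thesis by (rule M.submoduleI') (use c in \<open>auto\<close>)
  qed
  \<comment> \<open>Preimages in \<open>U\<close> turn the chain into one of the same length that
    starts above the kernel part. The inclusions stay strict because \<open>W\<close> is contained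
    in the image of \<open>U\<close>.\<close>
  have key: "W \<subseteq> f ` U \<Longrightarrow> len R M {x \<in> U. f x = \<zero>\<^bsub>N\<^esub>} + enat n \<le> len R M {x \<in> U. f x \<in> W}"
    if "chain R N W n" for W n
    using that
  proof (induction rule: chain.induct)
    case (chain_0 W)
    then have "{x \<in> U. f x = \<zero>\<^bsub>N\<^esub>} \<subseteq> {x \<in> U. f x \<in> W}"
      using LinearCombinations.submodule.zero_closed by fastforce
    then show ?case using len_mono[OF _ pre[OF chain_0(1)]] by (simp add: zero_enat_def[symmetric])
  next
    case (chain_Suc V n W)
    obtain w where "w \<in> W" "w \<notin> V" using chain_Suc by blast
    moreover obtain u where "u \<in> U" "f u = w" using chain_Suc \<open>w \<in> W\<close> by blast
    ultimately have "{x \<in> U. f x \<in> V} \<subset> {x \<in> U. f x \<in> W}" using chain_Suc by blast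
    then have "len R M {x \<in> U. f x \<in> V} + 1 \<le> len R M {x \<in> U. f x \<in> W}"
      using chain_Suc by (intro len_strict pre) (auto dest: chain_submodule)
    moreover have "len R M {x \<in> U. f x = \<zero>\<^bsub>N\<^esub>} + enat n + 1 \<le> len R M {x \<in> U. f x \<in> V} + 1"
      using chain_Suc by (intro add_right_mono) auto
    moreover have "enat (Suc n) = enat n + 1" by (simp add: one_enat_def)
    ultimately show ?case by (metis (no_types, lifting) add.assoc order_trans)
  qed
  show "len R M {x \<in> U. f x = \<zero>\<^bsub>N\<^esub>} + len R N (f ` U) \<le> len R M U"
  \<comment> \<open>The supremum over chains in the image is taken by subtraction, so finite values
    are needed: if \<open>len R M U\<close> is \<open>m\<close>, the kernel part has some finite
    length \<open>a\<close> and every chain has at most \<open>m - a\<close> steps.\<close>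
  proof (cases "len R M U")
    case (enat m)
    have le: "len R M {x \<in> U. f x = \<zero>\<^bsub>N\<^esub>} + enat n \<le> enat m" if "chain R N (f ` U) n" for n
      using key[OF that] len_mono[of "{x \<in> U. f x \<in> f ` U}" U R M] U enat
      by (metis (no_types, lifting) mem_Collect_eq order_refl order_trans subsetI)
    obtain a where a: "len R M {x \<in> U. f x = \<zero>\<^bsub>N\<^esub>} = enat a"
      using le[OF chain_0[OF image_submodule[OF U]]] by (cases "len R M {x \<in> U. f x = \<zero>\<^bsub>N\<^esub>}") auto
    have "len R N (f ` U) \<le> enat (m - a)"
      using le a by (intro len_leI) fastforce
    moreover have "a \<le> m" using le[OF chain_0[OF image_submodule[OF U]]] a by simp
    ultimately show ?thesis
      unfolding a enat by (cases "len R N (f ` U)") auto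
  qed simp
qed

section \<open>Modules over a discrete valuation ring\<close>

text \<open>The valuation is used only as a factorisation of nonzero elements into a unit and a
  power of the uniformizer \<pi>; the exponent plays the part of the valuation.\<close>

locale dvr = domain R for R (structure) +
  fixes \<pi>
  assumes pi_closed [simp]: "\<pi> \<in> carrier R"
    and pi_nonzero: "\<pi> \<noteq> \<zero>"
    and pi_nonunit: "\<pi> \<notin> Units R"
    and unit_pow: "r \<in> carrier R \<Longrightarrow> r \<noteq> \<zero> \<Longrightarrow> \<exists>u\<in>Units R. \<exists>k::nat. r = u \<otimes> \<pi> [^] k"
begin

lemma pi_pow_closed [simp]: "\<pi> [^] (k::nat) \<in> carrier R"
  by simp

lemma pi_pow_nonzero [simp]: "\<pi> [^] (k::nat) \<noteq> \<zero>"
  using pi_nonzero by (induction k) (auto simp: integral_iff)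

lemma pi_mult_nonunit: "s \<in> carrier R \<Longrightarrow> \<pi> \<otimes> s \<notin> Units R"
  using pi_nonunit unit_factor pi_closed by blast

lemma nonunit_pi_mult:
  assumes "r \<in> carrier R" "r \<notin> Units R" shows "\<exists>s\<in>carrier R. r = \<pi> \<otimes> s"
proof (cases "r = \<zero>")
  case True
  then show ?thesis by (intro bexI[of _ \<zero>]) simp_all
next
  case False
  obtain u and k :: nat where uk: "u \<in> Units R" "r = u \<otimes> \<pi> [^] k" using unit_pow[OF assms(1) False] by blast
  have uc: "u \<in> carrier R" using uk(1) by (rule Units_closed)
  have "k \<noteq> 0" using uk assms(2) uc by (intro notI) simp
  then obtain j where j: "k = Suc j" by (cases k) simp_all
  have "r = \<pi> \<otimes> (u \<otimes> \<pi> [^] j)" using uk(2) uc j by (simp add: m_ac)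
  then show ?thesis using uc by (intro bexI[of _ "u \<otimes> \<pi> [^] j"]) simp_all
qed

text \<open>\<pi> lies in the Jacobson radical: if \<open>1 - \<pi> r\<close> were a multiple of
  \<pi>, so would be 1. This is the instance of Nakayama's lemma that makes chains of cyclic
  submodules strict.\<close>

lemma one_minus_unit:
  assumes "r \<in> carrier R" shows "\<one> \<ominus> \<pi> \<otimes> r \<in> Units R"
proof (rule ccontr)
  assume "\<one> \<ominus> \<pi> \<otimes> r \<notin> Units R"
  then obtain s where s: "s \<in> carrier R" "\<one> \<ominus> \<pi> \<otimes> r = \<pi> \<otimes> s"
    using nonunit_pi_mult[of "\<one> \<ominus> \<pi> \<otimes> r"] assms by auto
  have "\<one> = (\<one> \<ominus> \<pi> \<otimes> r) \<oplus> \<pi> \<otimes> r" using assms by (simp add: minus_eq a_assoc l_neg)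
  also have "\<dots> = \<pi> \<otimes> (s \<oplus> r)" unfolding s(2) using s(1) assms by (simp add: r_distr)
  finally show False using pi_mult_nonunit[of "s \<oplus> r"] s(1) assms Units_one_closed by simp
qed

definition tors :: "('a, 'm, 'x) module_scheme \<Rightarrow> nat \<Rightarrow> 'm set"
  where "tors M k = {x \<in> carrier M. \<pi> [^] k \<odot>\<^bsub>M\<^esub> x = \<zero>\<^bsub>M\<^esub>}"

text \<open>Only powers of \<pi> are tested. By \<open>smult_eq_zero_imp_tors\<close> an element
  killed by any nonzero scalar is included, since the unit part of the scalar can be
  cancelled.\<close>

definition torsion :: "('a, 'm, 'x) module_scheme \<Rightarrow> 'm set"
  where "torsion M = (\<Union>k. tors M k)"

context
  fixes M :: "('a, 'm, 'x) module_scheme"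
  assumes M: "module R M"
begin

interpretation M: Module.module R M by (rule M)

lemma smult_pow_add:
  "x \<in> carrier M \<Longrightarrow> \<pi> [^] (j + k :: nat) \<odot>\<^bsub>M\<^esub> x = \<pi> [^] j \<odot>\<^bsub>M\<^esub> (\<pi> [^] k \<odot>\<^bsub>M\<^esub> x)"
  by (simp add: nat_pow_mult[symmetric] M.smult_assoc1)

lemma smult_swap:
  "x \<in> carrier M \<Longrightarrow> r \<in> carrier R \<Longrightarrow> s \<in> carrier R \<Longrightarrow>
    r \<odot>\<^bsub>M\<^esub> (s \<odot>\<^bsub>M\<^esub> x) = s \<odot>\<^bsub>M\<^esub> (r \<odot>\<^bsub>M\<^esub> x)"
  by (simp add: M.smult_assoc1[symmetric] m_comm)

lemma tors_mono: assumes "j \<le> k" shows "tors M j \<subseteq> tors M k"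
proof
  fix x assume "x \<in> tors M j"
  then have x: "x \<in> carrier M" "\<pi> [^] j \<odot>\<^bsub>M\<^esub> x = \<zero>\<^bsub>M\<^esub>" by (simp_all add: tors_def)
  then have "\<pi> [^] (k - j + j) \<odot>\<^bsub>M\<^esub> x = \<zero>\<^bsub>M\<^esub>" by (simp only: smult_pow_add) simp
  then show "x \<in> tors M k" using assms x by (simp add: tors_def)
qed

lemma submodule_tors: "submodule R (tors M k) M"
  by (rule M.submoduleI') (auto simp: tors_def M.smult_r_distr smult_swap[of _ "\<pi> [^] k"])

lemma submodule_torsion: "submodule R (torsion M) M"
proof (rule M.submoduleI')
  have sub: "torsion M \<subseteq> carrier M" by (auto simp: torsion_def tors_def)
  show "torsion M \<subseteq> carrier M" by (rule sub)
  show "\<zero>\<^bsub>M\<^esub> \<in> torsion M" by (auto simp: torsion_def tors_def)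
  show "v \<oplus>\<^bsub>M\<^esub> w \<in> torsion M" if vw: "v \<in> torsion M" "w \<in> torsion M" for v w
  proof -
    obtain j k where "v \<in> tors M j" "w \<in> tors M k" using vw by (auto simp: torsion_def)
    then have "v \<in> tors M (max j k)" "w \<in> tors M (max j k)"
      using tors_mono[of j "max j k"] tors_mono[of k "max j k"] by auto
    then have "v \<oplus>\<^bsub>M\<^esub> w \<in> tors M (max j k)"
      using LinearCombinations.submodule.m_closed[OF submodule_tors] by blast
    then show ?thesis by (auto simp: torsion_def)
  qed
  show "c \<odot>\<^bsub>M\<^esub> v \<in> torsion M" if "c \<in> carrier R" "v \<in> torsion M" for c v
    using that LinearCombinations.submodule.smult_closed[OF submodule_tors]
    unfolding torsion_def by blast
qed

lemma smult_eq_zero_imp_tors: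
  assumes "x \<in> carrier M" "r \<in> carrier R" "r \<noteq> \<zero>" "r \<odot>\<^bsub>M\<^esub> x = \<zero>\<^bsub>M\<^esub>"
  shows "x \<in> torsion M"
proof -
  obtain u and k :: nat where uk: "u \<in> Units R" "r = u \<otimes> \<pi> [^] k"
    using unit_pow[OF assms(2,3)] by blast
  have c: "u \<in> carrier R" "inv u \<in> carrier R" using uk(1) by (auto intro: Units_closed)
  have "inv u \<odot>\<^bsub>M\<^esub> (r \<odot>\<^bsub>M\<^esub> x) = (inv u \<otimes> u) \<odot>\<^bsub>M\<^esub> (\<pi> [^] k \<odot>\<^bsub>M\<^esub> x)"
    unfolding uk(2) using c assms by (simp add: M.smult_assoc1)
  then have "\<pi> [^] k \<odot>\<^bsub>M\<^esub> x = \<zero>\<^bsub>M\<^esub>" using uk(1) c assms by (simp add: Units_l_inv)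
  then show ?thesis using assms(1) by (auto simp: torsion_def tors_def)
qed

lemma smult_unit_iff:
  assumes "x \<in> carrier M" "u \<in> Units R" "submodule R U M"
  shows "u \<odot>\<^bsub>M\<^esub> x \<in> U \<longleftrightarrow> x \<in> U"
proof
  have c: "u \<in> carrier R" "inv u \<in> carrier R" using assms(2) by (auto intro: Units_closed)
  assume "u \<odot>\<^bsub>M\<^esub> x \<in> U"
  then have "inv u \<odot>\<^bsub>M\<^esub> (u \<odot>\<^bsub>M\<^esub> x) \<in> U"
    by (rule LinearCombinations.submodule.smult_closed[OF assms(3) c(2)])
  then show "x \<in> U" using assms(1,2) c by (simp add: M.smult_assoc1[symmetric] Units_l_inv)
next
  assume "x \<in> U"
  then show "u \<odot>\<^bsub>M\<^esub> x \<in> U"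
    by (rule LinearCombinations.submodule.smult_closed[OF assms(3) Units_closed[OF assms(2)]])
qed

lemma lin_comb_cong_terms:
  "(\<And>i. i < n \<Longrightarrow> c i \<odot>\<^bsub>M\<^esub> x i = d i \<odot>\<^bsub>M\<^esub> y i) \<Longrightarrow> lin_comb M c x n = lin_comb M d y n"
  by (induction n) simp_all

end

text \<open>Meaningful for torsion elements only; for other \<open>x\<close> no exponent qualifies
  and \<open>LEAST\<close> is unspecified.\<close>

definition ord_of :: "('a, 'm, 'x) module_scheme \<Rightarrow> 'm \<Rightarrow> nat"
  where "ord_of M x = (LEAST k. \<pi> [^] k \<odot>\<^bsub>M\<^esub> x = \<zero>\<^bsub>M\<^esub>)"

text \<open>
  Among all generating \<open>n\<close>-tuples take one with as few torsion-free entries as possible and, subject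
  to that, with the least sum of orders of the torsion entries. In a relation
  \<open>\<Sum> u\<^sub>i \<pi>\<^sup>k\<^sup>i x\<^sub>i = 0\<close> with nonzero terms and \<open>k\<^sub>i\<close> minimal, replacing \<open>x\<^sub>i\<close> by
  \<open>\<Sum> u\<^sub>j \<pi>\<^sup>k\<^sup>j\<^sup>-\<^sup>k\<^sup>i x\<^sub>j\<close> would improve the tuple.
\<close>

lemma exchange:
  assumes M: "module R M" and gen: "generates R M x n"
    and c: "\<And>i. i < n \<Longrightarrow> c i \<in> carrier R" and rel: "lin_comb M c x n = \<zero>\<^bsub>M\<^esub>"
    and nonzero: "i0 < n" "c i0 \<odot>\<^bsub>M\<^esub> x i0 \<noteq> \<zero>\<^bsub>M\<^esub>"
  shows "\<exists>i<n. \<exists>z\<in>torsion M. generates R M (x(i := z)) n \<and>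
    (x i \<in> torsion M \<longrightarrow> ord_of M z < ord_of M (x i))"
proof -
  interpret M: Module.module R M by (rule M)
  have x: "x i \<in> carrier M" if "i < n" for i using gen that by (simp add: generates_def)
  define J where "J = {i. i < n \<and> c i \<odot>\<^bsub>M\<^esub> x i \<noteq> \<zero>\<^bsub>M\<^esub>}"
  have "\<exists>u k. u \<in> Units R \<and> c i = u \<otimes> \<pi> [^] (k::nat)" if i: "i \<in> J" for i
  proof -
    have "c i \<noteq> \<zero>" using i x[of i] by (auto simp: J_def)
    then show ?thesis using unit_pow[of "c i"] c[of i] i by (auto simp: J_def)
  qed
  then obtain u and k :: "nat \<Rightarrow> nat"
    where uk: "\<And>i. i \<in> J \<Longrightarrow> u i \<in> Units R" "\<And>i. i \<in> J \<Longrightarrow> c i = u i \<otimes> \<pi> [^] k i"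
    by metis
  have uc: "u i \<in> carrier R" if "i \<in> J" for i using uk(1)[OF that] by (rule Units_closed)
  have "i0 \<in> J" using nonzero by (simp add: J_def)
  then obtain i where i: "i \<in> J" and min: "\<And>j. j \<in> J \<Longrightarrow> k i \<le> k j"
    using arg_min_nat_lemma[of "\<lambda>i. i \<in> J" i0 k] by blast
  have i_n: "i < n" using i by (simp add: J_def)
  \<comment> \<open>The relation divided by \<pi> to the power \<open>k i\<close>. Terms that vanish
    are dropped, and the coefficient at \<open>i\<close> becomes the unit
    \<open>u i\<close>.\<close>
  define b where "b j = (if j \<in> J then u j \<otimes> \<pi> [^] (k j - k i) else \<zero>)" for j
  have b: "b j \<in> carrier R" for j using uc by (simp add: b_def)
  have bi: "b i = u i" using i uc by (simp add: b_def)
  define z where "z = lin_comb M b x n"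
  have zc: "z \<in> carrier M" unfolding z_def using b x by simp
  have "\<pi> [^] k i \<odot>\<^bsub>M\<^esub> z = lin_comb M (\<lambda>j. \<pi> [^] k i \<otimes> b j) x n"
    unfolding z_def using b x by (simp add: M.lin_comb_smult)
  also have "\<dots> = lin_comb M c x n"
  proof (rule lin_comb_cong_terms[OF M])
    fix j assume j: "j < n"
    show "(\<pi> [^] k i \<otimes> b j) \<odot>\<^bsub>M\<^esub> x j = c j \<odot>\<^bsub>M\<^esub> x j"
    proof (cases "j \<in> J")
      case True
      have "\<pi> [^] k i \<otimes> b j = u j \<otimes> (\<pi> [^] k i \<otimes> \<pi> [^] (k j - k i))"
        using True uc[OF True] by (simp add: b_def m_ac)
      also have "\<dots> = c j" using uk(2)[OF True] min[OF True] by (simp add: nat_pow_mult)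
      finally show ?thesis by simp
    next
      case False
      then show ?thesis using j x[OF j] by (simp add: b_def J_def)
    qed
  qed
  finally have kz: "\<pi> [^] k i \<odot>\<^bsub>M\<^esub> z = \<zero>\<^bsub>M\<^esub>" using rel by simp
  then have z_tor: "z \<in> torsion M" using zc by (auto simp: torsion_def tors_def)
  have ord: "ord_of M z < ord_of M (x i)" if tor: "x i \<in> torsion M"
  proof -
    have "ord_of M z \<le> k i" unfolding ord_of_def by (rule Least_le) (rule kz)
    moreover obtain m :: nat where m: "\<pi> [^] m \<odot>\<^bsub>M\<^esub> x i = \<zero>\<^bsub>M\<^esub>"
      using tor unfolding torsion_def tors_def by blast
    have o: "\<pi> [^] ord_of M (x i) \<odot>\<^bsub>M\<^esub> x i = \<zero>\<^bsub>M\<^esub>"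
      unfolding ord_of_def using m by (rule LeastI)
    \<comment> \<open>Up to the unit \<open>u i\<close>, the power \<open>k i\<close> of \<pi>
      applied to \<open>x i\<close> is the nonzero term of the relation; so the old order exceeds
      \<open>k i\<close>, whereas \<open>z\<close> is killed by this power.\<close>
    have "\<not> ord_of M (x i) \<le> k i"
    proof
      assume "ord_of M (x i) \<le> k i"
      then have "x i \<in> tors M (k i)"
        using tors_mono[OF M] o x[OF i_n] by (auto simp: tors_def)
      then have "c i \<odot>\<^bsub>M\<^esub> x i = \<zero>\<^bsub>M\<^esub>"
        unfolding uk(2)[OF i] using uc[OF i] x[OF i_n] by (simp add: tors_def M.smult_assoc1)
      then show False using i by (simp add: J_def)
    qed
    ultimately show ?thesis by simp
  qed
  have "generates R M (x(i := z)) n"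
  proof (rule M.generatesI)
    show "(x(i := z)) j \<in> carrier M" if "j < n" for j using that x zc by simp
  next
    fix U assume U: "submodule R U M" and mem: "\<And>j. j < n \<Longrightarrow> (x(i := z)) j \<in> U"
    interpret U: LinearCombinations.submodule R U M by (rule U)
    have zU: "z \<in> U" using mem[OF i_n] by simp
    \<comment> \<open>The \<open>i\<close>-th term of \<open>z\<close> is isolated: since its
      coefficient is a unit, \<open>x i\<close> can be recovered from \<open>z\<close> and the other
      generators.\<close>
    define b' where "b' j = (if j = i then \<zero> else b j)" for j
    have "z = lin_comb M (\<lambda>j. (if j = i then u i else \<zero>) \<oplus> b' j) x n"
      unfolding z_def using b uc[OF i] bi by (intro lin_comb_cong) (auto simp: b'_def)
    also have "\<dots> = u i \<odot>\<^bsub>M\<^esub> x i \<oplus>\<^bsub>M\<^esub> lin_comb M b' x n"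
      using b x uc[OF i] i_n by (subst M.lin_comb_add) (auto simp: b'_def M.lin_comb_single)
    finally have z_eq: "z = u i \<odot>\<^bsub>M\<^esub> x i \<oplus>\<^bsub>M\<^esub> lin_comb M b' x n" .
    \<comment> \<open>The coefficient at \<open>i\<close> is zero, so the vector there may be
      replaced by zero. Now all vectors are known to lie in \<open>U\<close>, although nothing is
      known yet about \<open>x i\<close>.\<close>
    have "lin_comb M b' x n = lin_comb M b' (x(i := \<zero>\<^bsub>M\<^esub>)) n"
      using x by (intro lin_comb_cong_terms[OF M]) (auto simp: b'_def)
    also have "\<dots> \<in> U"
    proof (rule M.lin_comb_in_submodule[OF U])
      show "b' j \<in> carrier R" for j using b by (simp add: b'_def)
      show "(x(i := \<zero>\<^bsub>M\<^esub>)) j \<in> U" if "j < n" for j using mem[OF that] by (auto split: if_splits)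
    qed
    finally have rest: "lin_comb M b' x n \<in> U" .
    have "z \<ominus>\<^bsub>M\<^esub> lin_comb M b' x n \<in> U" using zU rest by (rule M.submodule_diff[OF U])
    moreover have "z \<ominus>\<^bsub>M\<^esub> lin_comb M b' x n = u i \<odot>\<^bsub>M\<^esub> x i"
      unfolding z_eq using uc[OF i] x i_n U.subset rest
      by (simp add: M.M.minus_eq M.M.a_assoc M.M.r_neg subsetD)
    ultimately have "u i \<odot>\<^bsub>M\<^esub> x i \<in> U" by simp
    then have xi: "x i \<in> U" using smult_unit_iff[OF M x[OF i_n] uk(1)[OF i] U] by simp
    have "x j \<in> U" if "j < n" for j using mem[OF that] xi by (cases "j = i") simp_all
    then show "carrier M \<subseteq> U" using M.generates_submodule[OF gen U] by simp
  qed
  then show ?thesis using i_n z_tor ord by blast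
qed

theorem ex_independent_generators:
  assumes M: "module R M" and gen: "generates R M x n"
  shows "\<exists>y. generates R M y n \<and> independent R M y n"
proof -
  define free where "free y = (\<Sum>j<n. if y j \<in> torsion M then 0 else 1::nat)" for y
  define ords where "ords y = (\<Sum>j<n. if y j \<in> torsion M then ord_of M (y j) else 0)" for y
  show ?thesis
    using gen
  proof (induction x rule: wf_induct_rule[OF wf_measures[of "[free, ords]"]])
    case (1 x)
    show ?case
    proof (cases "independent R M x n")
      case False
      then obtain c i0 where "\<And>i. i < n \<Longrightarrow> c i \<in> carrier R" "lin_comb M c x n = \<zero>\<^bsub>M\<^esub>"
        "i0 < n" "c i0 \<odot>\<^bsub>M\<^esub> x i0 \<noteq> \<zero>\<^bsub>M\<^esub>"
        unfolding independent_def by blast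
      from exchange[OF M 1(2) this] obtain i z where i: "i < n" and z: "z \<in> torsion M"
        and gen': "generates R M (x(i := z)) n"
        and ord: "x i \<in> torsion M \<Longrightarrow> ord_of M z < ord_of M (x i)"
        by blast
      have split: "sum f {..<n} = f i + sum f ({..<n} - {i})" for f :: "nat \<Rightarrow> nat"
        using i by (intro sum.remove) simp_all
      have same: "(\<Sum>j\<in>{..<n} - {i}. F ((x(i := z)) j)) = (\<Sum>j\<in>{..<n} - {i}. F (x j))"
        for F :: "'c \<Rightarrow> nat"
        by (rule sum.cong) auto
      \<comment> \<open>Only the \<open>i\<close>-th summands change. Replacing a torsion entry
        keeps \<open>free\<close> and lowers \<open>ords\<close>; replacing a torsion-free entry
        lowers \<open>free\<close>, while \<open>ords\<close> may grow, which is why the order is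
        lexicographic.\<close>
      have "(x(i := z), x) \<in> measures [free, ords]"
      proof (cases "x i \<in> torsion M")
        case True
        then have "free (x(i := z)) = free x" "ords (x(i := z)) < ords x"
          unfolding free_def ords_def split
          using same[of "\<lambda>y. if y \<in> torsion M then 0 else 1"]
            same[of "\<lambda>y. if y \<in> torsion M then ord_of M y else 0"] z ord[OF True]
          by simp_all
        then show ?thesis by simp
      next
        case False
        then have "free (x(i := z)) < free x"
          unfolding free_def split using same[of "\<lambda>y. if y \<in> torsion M then 0 else 1"] z by simp
        then show ?thesis by simp
      qed
      from 1(1)[OF this gen'] show ?thesis .
    qed (use 1(2) in blast)
  qed
qed

end

section \<open>Lengths of cyclic modules and of their torsion submodules\<close>

definition cyclic :: "('r, 'e) ring_scheme \<Rightarrow> ('r, 'm, 'x) module_scheme \<Rightarrow> 'm \<Rightarrow> 'm set"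
  where "cyclic R M x = {r \<odot>\<^bsub>M\<^esub> x | r. r \<in> carrier R}"

lemma cyclicI: "r \<in> carrier R \<Longrightarrow> v = r \<odot>\<^bsub>M\<^esub> x \<Longrightarrow> v \<in> cyclic R M x"
  unfolding cyclic_def by blast

lemma (in Module.module) submodule_cyclic:
  assumes "x \<in> carrier M" shows "submodule R (cyclic R M x) M"
proof (rule submoduleI')
  show "cyclic R M x \<subseteq> carrier M" using assms by (auto simp: cyclic_def)
  show "\<zero>\<^bsub>M\<^esub> \<in> cyclic R M x" using assms by (force simp: cyclic_def)
  show "v \<oplus>\<^bsub>M\<^esub> w \<in> cyclic R M x" if vw: "v \<in> cyclic R M x" "w \<in> cyclic R M x" for v w
  proof -
    obtain r s where "r \<in> carrier R" "v = r \<odot>\<^bsub>M\<^esub> x" "s \<in> carrier R" "w = s \<odot>\<^bsub>M\<^esub> x"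
      using vw by (auto simp: cyclic_def)
    then have "v \<oplus>\<^bsub>M\<^esub> w = (r \<oplus> s) \<odot>\<^bsub>M\<^esub> x" "r \<oplus> s \<in> carrier R"
      using assms by (simp_all add: smult_l_distr)
    then show ?thesis unfolding cyclic_def by blast
  qed
  show "c \<odot>\<^bsub>M\<^esub> v \<in> cyclic R M x" if c: "c \<in> carrier R" and v: "v \<in> cyclic R M x" for c v
  proof -
    obtain r where "r \<in> carrier R" "v = r \<odot>\<^bsub>M\<^esub> x" using v by (auto simp: cyclic_def)
    then have "c \<odot>\<^bsub>M\<^esub> v = (c \<otimes> r) \<odot>\<^bsub>M\<^esub> x" "c \<otimes> r \<in> carrier R"
      using assms c by (simp_all add: smult_assoc1)
    then show ?thesis unfolding cyclic_def by blast
  qed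
qed

lemma (in mod_hom) len_image_inj:
  assumes "submodule R U M" "inj_on f (carrier M)"
  shows "len R N (f ` U) = len R M U"
proof -
  have "{x \<in> U. f x = \<zero>\<^bsub>N\<^esub>} = {\<zero>\<^bsub>M\<^esub>}"
    using assms(2) LinearCombinations.submodule.zero_closed[OF assms(1)]
      LinearCombinations.submodule.subset[OF assms(1)] f0_is_0
    unfolding inj_on_iff_kernel by blast
  then show ?thesis using len_ker_im[OF assms(1)] by (simp add: M.len_zero)
qed

context dvr
begin

text \<open>The submodules generated by the multiples of \<open>x\<close> by powers of \<pi> form a
  chain with \<open>l\<close> steps. Conversely every submodule of a cyclic torsion module is
  determined by the least power of \<pi> whose multiple of \<open>x\<close> it contains.\<close>

lemma len_cyclic:
  assumes M: "module R M" and x: "x \<in> carrier M" and l: "\<pi> [^] (l::nat) \<odot>\<^bsub>M\<^esub> x = \<zero>\<^bsub>M\<^esub>"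
    and min: "\<And>j. j < l \<Longrightarrow> \<pi> [^] j \<odot>\<^bsub>M\<^esub> x \<noteq> \<zero>\<^bsub>M\<^esub>"
  shows "len R M (cyclic R M x) = enat l"
proof (rule antisym)
  interpret M: Module.module R M by (rule M)
  show "enat l \<le> len R M (cyclic R M x)"
    using x l min
  proof (induction l arbitrary: x)
    case (Suc l)
    let ?y = "\<pi> \<odot>\<^bsub>M\<^esub> x"
    have pow: "\<pi> [^] j \<odot>\<^bsub>M\<^esub> ?y = \<pi> [^] Suc j \<odot>\<^bsub>M\<^esub> x" for j :: nat
      using Suc.prems(1) by (simp add: M.smult_assoc1)
    have "enat l \<le> len R M (cyclic R M ?y)"
      using Suc.prems by (intro Suc.IH) (simp_all only: pow, simp_all)
    have "cyclic R M ?y \<subseteq> cyclic R M x"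
    proof
      fix v assume "v \<in> cyclic R M ?y"
      then obtain r where r: "r \<in> carrier R" "v = r \<odot>\<^bsub>M\<^esub> ?y" by (auto simp: cyclic_def)
      then have "v = (r \<otimes> \<pi>) \<odot>\<^bsub>M\<^esub> x" using Suc.prems(1) by (simp add: M.smult_assoc1)
      then show "v \<in> cyclic R M x" using r(1) pi_closed unfolding cyclic_def by blast
    qed
    moreover have "x \<in> cyclic R M x"
      using M.smult_one[OF Suc.prems(1)] one_closed unfolding cyclic_def by force
    \<comment> \<open>From \<open>x = r \<pi> x\<close> it would follow that the unit
      \<open>1 - \<pi> r\<close> kills \<open>x\<close>, hence \<open>x = 0\<close>, against
      minimality of the positive number \<open>Suc l\<close>.\<close>
    moreover have "x \<notin> cyclic R M ?y"
    proof
      assume "x \<in> cyclic R M ?y"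
      then obtain r where r: "r \<in> carrier R" "x = r \<odot>\<^bsub>M\<^esub> ?y" by (auto simp: cyclic_def)
      then have "x = (\<pi> \<otimes> r) \<odot>\<^bsub>M\<^esub> x" using Suc.prems(1) by (simp add: M.smult_assoc1 smult_swap[OF M])
      moreover have "(\<one> \<ominus> \<pi> \<otimes> r) \<odot>\<^bsub>M\<^esub> x = x \<ominus>\<^bsub>M\<^esub> (\<pi> \<otimes> r) \<odot>\<^bsub>M\<^esub> x"
        using Suc.prems(1) r(1) by (simp add: minus_eq M.smult_l_distr M.smult_l_minus M.M.minus_eq)
      ultimately have "(\<one> \<ominus> \<pi> \<otimes> r) \<odot>\<^bsub>M\<^esub> x \<in> {\<zero>\<^bsub>M\<^esub>}"
        using Suc.prems(1) by simp
      then have "x \<in> {\<zero>\<^bsub>M\<^esub>}"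
        using smult_unit_iff[OF M Suc.prems(1) one_minus_unit[OF r(1)] M.submodule_zero] by simp
      then show False using Suc.prems(3)[of 0] by simp
    qed
    ultimately have "cyclic R M ?y \<subset> cyclic R M x" by blast
    then have "len R M (cyclic R M ?y) + 1 \<le> len R M (cyclic R M x)"
      using Suc.prems(1) by (intro len_strict M.submodule_cyclic) simp_all
    moreover have "enat (Suc l) \<le> len R M (cyclic R M ?y) + 1"
      using add_right_mono[OF \<open>enat l \<le> len R M (cyclic R M ?y)\<close>, of 1] by (simp add: one_enat_def)
    ultimately show ?case by (rule order_trans[rotated])
  qed (simp add: zero_enat_def[symmetric])
  \<comment> \<open>\<open>l - first U\<close> serves as rank function: an element of
    \<open>V\<close> outside \<open>U\<close> is a unit times a multiple of \<open>x\<close> by some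
    power \<open>k\<close> of \<pi>, and then \<open>first V \<le> k < first U\<close>.\<close>
  define first where "first U = (LEAST j. \<pi> [^] (j::nat) \<odot>\<^bsub>M\<^esub> x \<in> U)" for U
  have first: "\<pi> [^] first U \<odot>\<^bsub>M\<^esub> x \<in> U \<and> first U \<le> l" if "submodule R U M" for U
  proof -
    have "\<pi> [^] l \<odot>\<^bsub>M\<^esub> x \<in> U" using l LinearCombinations.submodule.zero_closed[OF that] by simp
    then show ?thesis unfolding first_def by (metis (mono_tags, lifting) LeastI Least_le)
  qed
  have "len R M (cyclic R M x) \<le> enat (l - first (cyclic R M x))"
  proof (rule len_least)
    fix U V assume U: "submodule R U M" and V: "submodule R V M" and UV: "U \<subset> V"
      and sub: "V \<subseteq> cyclic R M x"
    obtain v where v: "v \<in> V" "v \<notin> U" using UV by blast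
    then obtain r where r: "r \<in> carrier R" "v = r \<odot>\<^bsub>M\<^esub> x" using sub by (auto simp: cyclic_def)
    have "r \<noteq> \<zero>" using r v(2) x LinearCombinations.submodule.zero_closed[OF U] by auto
    then obtain u and k :: nat where uk: "u \<in> Units R" "r = u \<otimes> \<pi> [^] k"
      using unit_pow[OF r(1)] by blast
    have v_eq: "v = u \<odot>\<^bsub>M\<^esub> (\<pi> [^] k \<odot>\<^bsub>M\<^esub> x)"
      using r uk x Units_closed by (simp add: M.smult_assoc1)
    have inV: "\<pi> [^] k \<odot>\<^bsub>M\<^esub> x \<in> V" and notU: "\<pi> [^] k \<odot>\<^bsub>M\<^esub> x \<notin> U"
      using v smult_unit_iff[OF M _ uk(1) V, of "\<pi> [^] k \<odot>\<^bsub>M\<^esub> x"]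
        smult_unit_iff[OF M _ uk(1) U, of "\<pi> [^] k \<odot>\<^bsub>M\<^esub> x"] x unfolding v_eq by simp_all
    have "first V \<le> k" unfolding first_def using inV by (rule Least_le)
    moreover have "k < first U"
    proof (rule ccontr)
      assume "\<not> k < first U"
      then have "\<pi> [^] (k - first U) \<odot>\<^bsub>M\<^esub> (\<pi> [^] first U \<odot>\<^bsub>M\<^esub> x) = \<pi> [^] k \<odot>\<^bsub>M\<^esub> x"
        using smult_pow_add[OF M x, of "k - first U" "first U"] by simp
      then show False
        using notU first[OF U] LinearCombinations.submodule.smult_closed[OF U, of "\<pi> [^] (k - first U)"]
        by (metis pi_pow_closed)
    qed
    moreover have "first U \<le> l" using first[OF U] by simp
    ultimately have "Suc (l - first U) \<le> l - first V" by arith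
    then show "enat (l - first U) + 1 \<le> enat (l - first V)" by (simp add: one_enat_def)
  qed
  then show "len R M (cyclic R M x) \<le> enat l"
    by (rule order_trans) simp
qed

definition len_tors :: "('a, 'm, 'x) module_scheme \<Rightarrow> nat \<Rightarrow> enat"
  where "len_tors M k = len R M (tors M k)"

text \<open>The torsion submodule is again cyclic: a unit times the multiple of \<open>x\<close> by
  the power \<open>j\<close> of \<pi> is killed by the power \<open>k\<close> iff
  \<open>l \<le> k + j\<close>. Its generator has order \<open>min k l\<close>.\<close>

lemma len_tors_cyclic:
  assumes M: "module R M" and x: "x \<in> carrier M" and l: "\<pi> [^] (l::nat) \<odot>\<^bsub>M\<^esub> x = \<zero>\<^bsub>M\<^esub>"
    and min: "\<And>j. j < l \<Longrightarrow> \<pi> [^] j \<odot>\<^bsub>M\<^esub> x \<noteq> \<zero>\<^bsub>M\<^esub>" and gen: "carrier M = cyclic R M x"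
  shows "len_tors M k = enat (min k l)"
proof -
  interpret M: Module.module R M by (rule M)
  have zero_iff: "\<pi> [^] j \<odot>\<^bsub>M\<^esub> x = \<zero>\<^bsub>M\<^esub> \<longleftrightarrow> l \<le> j" for j :: nat
  proof
    assume "l \<le> j"
    then show "\<pi> [^] j \<odot>\<^bsub>M\<^esub> x = \<zero>\<^bsub>M\<^esub>" using smult_pow_add[OF M x, of "j - l" l] l by simp
  next
    assume "\<pi> [^] j \<odot>\<^bsub>M\<^esub> x = \<zero>\<^bsub>M\<^esub>"
    then show "l \<le> j" using min[of j] by (meson not_le)
  qed
  \<comment> \<open>Truncated subtraction is intended: for \<open>k \<ge> l\<close> this is
    \<open>x\<close> itself, and the torsion submodule is all of \<open>M\<close>.\<close>
  define y where "y = \<pi> [^] (l - k) \<odot>\<^bsub>M\<^esub> x"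
  have y: "y \<in> carrier M" using x by (simp add: y_def)
  have pow_y: "\<pi> [^] j \<odot>\<^bsub>M\<^esub> y = \<pi> [^] (j + (l - k)) \<odot>\<^bsub>M\<^esub> x" for j :: nat
    unfolding y_def using smult_pow_add[OF M x] by simp
  have "tors M k = cyclic R M y"
  proof (intro equalityI subsetI)
    fix v assume "v \<in> tors M k"
    then have v: "v \<in> carrier M" "\<pi> [^] k \<odot>\<^bsub>M\<^esub> v = \<zero>\<^bsub>M\<^esub>" by (simp_all add: tors_def)
    then obtain r where r: "r \<in> carrier R" "v = r \<odot>\<^bsub>M\<^esub> x" unfolding gen cyclic_def by blast
    show "v \<in> cyclic R M y"
    proof (cases "r = \<zero>")
      case True
      then show ?thesis
        using r x LinearCombinations.submodule.zero_closed[OF M.submodule_cyclic[OF y]] by simp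
    next
      case False
      then obtain u and j :: nat where uj: "u \<in> Units R" "r = u \<otimes> \<pi> [^] j"
        using unit_pow[OF r(1)] by blast
      have u: "u \<in> carrier R" using uj(1) by (rule Units_closed)
      have "\<pi> [^] k \<odot>\<^bsub>M\<^esub> v = u \<odot>\<^bsub>M\<^esub> (\<pi> [^] (k + j) \<odot>\<^bsub>M\<^esub> x)"
        using r uj u x by (simp add: M.smult_assoc1 smult_pow_add[OF M x] smult_swap[OF M, of _ "\<pi> [^] k" u])
      then have "\<pi> [^] (k + j) \<odot>\<^bsub>M\<^esub> x = \<zero>\<^bsub>M\<^esub>"
        using v(2) smult_unit_iff[OF M _ uj(1) M.submodule_zero, of "\<pi> [^] (k + j) \<odot>\<^bsub>M\<^esub> x"] x by simp
      then have "l \<le> k + j" using zero_iff by simp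
      then have j: "\<pi> [^] j = \<pi> [^] (j - (l - k)) \<otimes> \<pi> [^] (l - k)"
        by (simp add: nat_pow_mult)
      have "v = u \<odot>\<^bsub>M\<^esub> (\<pi> [^] j \<odot>\<^bsub>M\<^esub> x)" using r uj u x by (simp add: M.smult_assoc1)
      also have "\<dots> = (u \<otimes> \<pi> [^] (j - (l - k))) \<odot>\<^bsub>M\<^esub> y"
        unfolding y_def j using u x by (simp add: M.smult_assoc1)
      finally have "v = (u \<otimes> \<pi> [^] (j - (l - k))) \<odot>\<^bsub>M\<^esub> y" .
      then show ?thesis by (rule cyclicI[rotated]) (simp add: u)
    qed
  next
    fix v assume "v \<in> cyclic R M y"
    then obtain r where r: "r \<in> carrier R" "v = r \<odot>\<^bsub>M\<^esub> y" by (auto simp: cyclic_def)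
    have "\<pi> [^] k \<odot>\<^bsub>M\<^esub> y = \<zero>\<^bsub>M\<^esub>" unfolding pow_y zero_iff by simp
    then show "v \<in> tors M k"
      using r y by (simp add: tors_def smult_swap[OF M, of y "\<pi> [^] k" r])
  qed
  moreover have "len R M (cyclic R M y) = enat (min k l)"
  proof (rule len_cyclic[OF M y])
    show "\<pi> [^] min k l \<odot>\<^bsub>M\<^esub> y = \<zero>\<^bsub>M\<^esub>" unfolding pow_y zero_iff by simp
    show "\<pi> [^] j \<odot>\<^bsub>M\<^esub> y \<noteq> \<zero>\<^bsub>M\<^esub>" if "j < min k l" for j
      unfolding pow_y zero_iff using that by arith
  qed
  ultimately show ?thesis by (simp add: len_tors_def)
qed

lemma len_tors_iso:
  assumes M: "module R M" and N: "module R N" and iso: "mod_iso R M N"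
  shows "len_tors M k = len_tors N k"
proof -
  obtain f where f: "f \<in> module_hom R M N" "bij_betw f (carrier M) (carrier N)"
    using iso by (auto simp: mod_iso_def)
  interpret f: mod_hom R M N f by (rule mod_homI[OF M N f(1)])
  have inj: "inj_on f (carrier M)" and surj: "f ` carrier M = carrier N"
    using f(2) by (simp_all add: bij_betw_def)
  have "f ` tors M k = tors N k"
  proof (intro equalityI subsetI)
    fix y assume "y \<in> f ` tors M k"
    then obtain x where x: "x \<in> carrier M" "\<pi> [^] k \<odot>\<^bsub>M\<^esub> x = \<zero>\<^bsub>M\<^esub>" "y = f x"
      by (auto simp: tors_def)
    have "\<pi> [^] k \<odot>\<^bsub>N\<^esub> y = f (\<pi> [^] k \<odot>\<^bsub>M\<^esub> x)"
      unfolding x(3) using x(1) by (simp only: f.f_smult pi_pow_closed)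
    then show "y \<in> tors N k" using x by (simp add: tors_def)
  next
    fix y assume y: "y \<in> tors N k"
    then obtain x where x: "x \<in> carrier M" "y = f x" using surj by (auto simp: tors_def)
    have "f (\<pi> [^] k \<odot>\<^bsub>M\<^esub> x) = \<zero>\<^bsub>N\<^esub>"
      using y x(1) unfolding x(2) by (simp add: tors_def)
    then have "x \<in> tors M k" using inj x(1) unfolding f.inj_on_iff_kernel by (simp add: tors_def)
    then show "y \<in> f ` tors M k" using x by blast
  qed
  then show ?thesis
    using f.len_image_inj[OF submodule_tors[OF M] inj, of k] by (simp add: len_tors_def)
qed

text \<open>Additivity of length for the second projection, restricted to the torsion submodule; its
  kernel there is the copy of \<open>tors A k\<close> under the first injection.\<close>

lemma len_tors_direct_sum:
  assumes A: "module R A" and B: "module R B"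
  shows "len_tors (direct_sum A B) k = len_tors A k + len_tors B k"
proof -
  interpret A: Module.module R A by (rule A)
  interpret B: Module.module R B by (rule B)
  have S: "module R (direct_sum A B)" by (rule direct_sum_is_module[OF A B])
  have tors: "tors (direct_sum A B) k = tors A k \<times> tors B k"
    unfolding tors_def direct_sum_simps by auto
  have ker: "{x \<in> tors (direct_sum A B) k. snd x = \<zero>\<^bsub>B\<^esub>} = (\<lambda>a. (a, \<zero>\<^bsub>B\<^esub>)) ` tors A k"
    unfolding tors using LinearCombinations.submodule.zero_closed[OF submodule_tors[OF B]] by auto
  have im: "snd ` tors (direct_sum A B) k = tors B k"
    unfolding tors using LinearCombinations.submodule.zero_closed[OF submodule_tors[OF A]]
    by (metis empty_iff snd_image_times)
  interpret S: Module.module R "direct_sum A B" by (rule S)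
  have "snd \<in> module_hom R (direct_sum A B) B"
    by (rule module_homI) (simp_all add: direct_sum_simps mem_Times_iff)
  interpret p: mod_hom R "direct_sum A B" B snd by (rule mod_homI[OF S B]) fact
  have "(\<lambda>a. (a, \<zero>\<^bsub>B\<^esub>)) \<in> module_hom R A (direct_sum A B)"
    by (rule module_homI) (simp_all add: direct_sum_simps)
  interpret i: mod_hom R A "direct_sum A B" "\<lambda>a. (a, \<zero>\<^bsub>B\<^esub>)" by (rule mod_homI[OF A S]) fact
  have "inj_on (\<lambda>a. (a, \<zero>\<^bsub>B\<^esub>)) (carrier A)" by (rule inj_onI) simp
  then show ?thesis
    using p.len_ker_im[OF submodule_tors[OF S], of k] i.len_image_inj[OF submodule_tors[OF A], of k]
    unfolding ker im len_tors_def by (simp only:)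
qed

lemma len_tors_product:
  fixes n :: nat
  assumes "\<And>i. i < n \<Longrightarrow> module R (M i)"
  shows "len_tors (product_module {..<n} M) k = (\<Sum>i<n. len_tors (M i) k)"
  using assms
proof (induction n)
  case 0
  have m: "module R (product_module {..<0} M)"
    by (rule product_module_is_module[OF cring_axioms]) simp
  have "carrier (product_module {..<0} M) = {\<zero>\<^bsub>product_module {..<0} M\<^esub>}"
    by (auto simp: product_module_simps)
  then have "tors (product_module {..<0} M) k = {\<zero>\<^bsub>product_module {..<0} M\<^esub>}"
    using LinearCombinations.submodule.subset[OF submodule_tors[OF m, of k]]
      LinearCombinations.submodule.zero_closed[OF submodule_tors[OF m, of k]] by blast
  then show ?case unfolding len_tors_def by (simp only: module.len_zero[OF m]) simp
next
  case (Suc n)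
  let ?P = "product_module {..<n} M" and ?Q = "product_module {..<Suc n} M"
  have P: "module R ?P" and Q: "module R ?Q"
    by (rule product_module_is_module[OF cring_axioms], simp add: Suc.prems)+
  have Mn: "module R (M n)" using Suc.prems by simp
  have "mod_iso R ?Q (direct_sum ?P (M n))"
    unfolding mod_iso_def
  proof (rule bexI[where x = "\<lambda>v. (restrict v {..<n}, v n)"])
    show "(\<lambda>v. (restrict v {..<n}, v n)) \<in> module_hom R ?Q (direct_sum ?P (M n))"
    proof (rule module_homI)
      show "(restrict v {..<n}, v n) \<in> carrier (direct_sum ?P (M n))" if "v \<in> carrier ?Q" for v
        using that by (simp add: product_module_simps direct_sum_simps PiE_iff)
    qed (simp_all add: direct_sum_simps product_module_simps restrict_def fun_eq_iff)
    \<comment> \<open>The inverse map glues the last coordinate back on. The restrictions force the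
      value \<open>undefined\<close> outside the index set, without which the two maps would not be
      mutually inverse.\<close>
    let ?join = "\<lambda>p. \<lambda>i\<in>{..<Suc n}. if i = n then snd p else fst p i"
    show "bij_betw (\<lambda>v. (restrict v {..<n}, v n)) (carrier ?Q) (carrier (direct_sum ?P (M n)))"
    proof (rule bij_betw_byWitness[where f' = ?join])
      show "\<forall>v\<in>carrier ?Q. ?join (restrict v {..<n}, v n) = v"
      proof
        fix v assume "v \<in> carrier ?Q"
        then have "v i = undefined" if "\<not> i < Suc n" for i
          using that by (simp add: product_module_simps PiE_iff extensional_def)
        then show "?join (restrict v {..<n}, v n) = v" by (intro ext) (simp add: restrict_def)
      qed
      show "\<forall>p\<in>carrier (direct_sum ?P (M n)). (restrict (?join p) {..<n}, ?join p n) = p"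
      proof
        fix p assume "p \<in> carrier (direct_sum ?P (M n))"
        then have "fst p i = undefined" if "\<not> i < n" for i
          using that by (simp add: product_module_simps direct_sum_simps mem_Times_iff PiE_iff extensional_def)
        then have "restrict (?join p) {..<n} = fst p" by (intro ext) (simp add: restrict_def)
        then show "(restrict (?join p) {..<n}, ?join p n) = p" by simp
      qed
      show "(\<lambda>v. (restrict v {..<n}, v n)) ` carrier ?Q \<subseteq> carrier (direct_sum ?P (M n))"
        by (intro image_subsetI) (simp add: product_module_simps direct_sum_simps PiE_iff)
      show "?join ` carrier (direct_sum ?P (M n)) \<subseteq> carrier ?Q"
        by (intro image_subsetI)
          (simp add: product_module_simps direct_sum_simps PiE_iff mem_Times_iff)
    qed
  qed
  then have "len_tors ?Q k = len_tors (direct_sum ?P (M n)) k"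
    by (rule len_tors_iso[OF Q direct_sum_is_module[OF P Mn]])
  also have "\<dots> = (\<Sum>i<Suc n. len_tors (M i) k)"
    using len_tors_direct_sum[OF P Mn] Suc by simp
  finally show ?case .
qed

lemma submodule_pi_pow: "submodule R (PIdl (\<pi> [^] (l::nat))) (regular_module R)"
proof -
  interpret reg: Module.module R "regular_module R"
    by (rule regular_module_is_module[OF cring_axioms])
  have "submodule R (cyclic R (regular_module R) (\<pi> [^] l)) (regular_module R)"
    by (rule reg.submodule_cyclic) (simp add: regular_module_def)
  then show ?thesis by (simp add: cyclic_def cgenideal_def regular_module_def)
qed

lemma residue_module_is_module: "module R (residue_module R (PIdl (\<pi> [^] (l::nat))))"
  by (rule quot_module_is_module[OF regular_module_is_module[OF cring_axioms] submodule_pi_pow])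

lemma pi_pow_dvd_iff: "\<pi> [^] j \<in> PIdl (\<pi> [^] l) \<longleftrightarrow> l \<le> j" for j l :: nat
proof
  assume "l \<le> j"
  then have "\<pi> [^] (j - l) \<otimes> \<pi> [^] l = \<pi> [^] j" by (simp add: nat_pow_mult)
  then show "\<pi> [^] j \<in> PIdl (\<pi> [^] l)"
    unfolding cgenideal_def by (intro CollectI exI[where x = "\<pi> [^] (j - l)"]) simp
next
  assume "\<pi> [^] j \<in> PIdl (\<pi> [^] l)"
  then obtain r where r: "r \<in> carrier R" "\<pi> [^] j = r \<otimes> \<pi> [^] l" by (auto simp: cgenideal_def)
  show "l \<le> j"
  proof (rule ccontr)
    assume "\<not> l \<le> j"
    \<comment> \<open>Cancelling the power \<open>j\<close> would exhibit \<pi> as a factor of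
      1.\<close>
    then obtain d where d: "l = Suc d + j" by (metis add.commute add_Suc_right less_imp_Suc_add not_le)
    have "\<one> \<otimes> \<pi> [^] j = \<pi> [^] j" by simp
    also have "\<dots> = r \<otimes> \<pi> [^] (Suc d + j)" using r(2) unfolding d .
    also have "\<dots> = (\<pi> \<otimes> (r \<otimes> \<pi> [^] d)) \<otimes> \<pi> [^] j"
      using r(1) by (simp add: nat_pow_mult[symmetric] m_ac)
    finally have "\<one> = \<pi> \<otimes> (r \<otimes> \<pi> [^] d)"
      using r(1) m_rcancel[of "\<pi> [^] j" \<one> "\<pi> \<otimes> (r \<otimes> \<pi> [^] d)"] by simp
    then show False using pi_mult_nonunit[of "r \<otimes> \<pi> [^] d"] r(1) Units_one_closed by simp
  qed
qed

text \<open>The coset of 1 generates, and its order is exactly \<open>l\<close> because the power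
  \<open>j\<close> of \<pi> lies in the ideal generated by the power \<open>l\<close> iff
  \<open>l \<le> j\<close>.\<close>

lemma len_tors_residue:
  "len_tors (residue_module R (PIdl (\<pi> [^] (l::nat)))) k = enat (min k l)"
proof -
  let ?I = "PIdl (\<pi> [^] l)" and ?M = "regular_module R"
  note [simp] = regular_module_def
  have M: "module R ?M" by (rule regular_module_is_module[OF cring_axioms])
  have smult: "r \<odot>\<^bsub>residue_module R ?I\<^esub> (?I +>\<^bsub>?M\<^esub> \<one>) = ?I +>\<^bsub>?M\<^esub> r" if "r \<in> carrier R" for r
    using quot_module_smult[OF M submodule_pi_pow, of \<one> r l] that by simp
  have zero: "?I +>\<^bsub>?M\<^esub> r = \<zero>\<^bsub>residue_module R ?I\<^esub> \<longleftrightarrow> r \<in> ?I" if "r \<in> carrier R" for r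
    using coset_eq_zero_iff[OF M submodule_pi_pow, of r l] that by simp
  have car: "carrier (residue_module R ?I) = cyclic R (residue_module R ?I) (?I +>\<^bsub>?M\<^esub> \<one>)"
  proof (intro equalityI subsetI)
    fix v assume "v \<in> carrier (residue_module R ?I)"
    then obtain r where r: "r \<in> carrier R" "v = ?I +>\<^bsub>?M\<^esub> r"
      unfolding carrier_quot_module by auto
    show "v \<in> cyclic R (residue_module R ?I) (?I +>\<^bsub>?M\<^esub> \<one>)"
      unfolding r(2) by (rule cyclicI[OF r(1)]) (rule smult[OF r(1), symmetric])
  next
    fix v assume "v \<in> cyclic R (residue_module R ?I) (?I +>\<^bsub>?M\<^esub> \<one>)"
    then show "v \<in> carrier (residue_module R ?I)"
      unfolding carrier_quot_module cyclic_def using smult by auto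
  qed
  show ?thesis
  proof (rule len_tors_cyclic[OF residue_module_is_module, where x = "?I +>\<^bsub>?M\<^esub> \<one>"])
    show "?I +>\<^bsub>?M\<^esub> \<one> \<in> carrier (residue_module R ?I)" by (simp add: carrier_quot_module)
    show "\<pi> [^] l \<odot>\<^bsub>residue_module R ?I\<^esub> (?I +>\<^bsub>?M\<^esub> \<one>) = \<zero>\<^bsub>residue_module R ?I\<^esub>"
      using smult zero pi_pow_dvd_iff by simp
    show "\<pi> [^] j \<odot>\<^bsub>residue_module R ?I\<^esub> (?I +>\<^bsub>?M\<^esub> \<one>) \<noteq> \<zero>\<^bsub>residue_module R ?I\<^esub>" if "j < l" for j
      using smult zero pi_pow_dvd_iff that by simp
    show "carrier (residue_module R ?I) = cyclic R (residue_module R ?I) (?I +>\<^bsub>?M\<^esub> \<one>)"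
      by (rule car)
  qed
qed

end

section \<open>Homomorphisms out of finitely generated modules\<close>

text \<open>The universal property of generators and relations. The graph consists of the pairs of
  combinations with equal coefficients, and the condition on relations is what single-valuedness at
  zero demands.\<close>

lemma hom_of_generators:
  assumes M: "module R M" and D: "module R D" and gen: "generates R M x n"
    and y: "\<And>i. i < n \<Longrightarrow> y i \<in> carrier D"
    and rel: "\<And>c. (\<And>i. i < n \<Longrightarrow> c i \<in> carrier R) \<Longrightarrow> lin_comb M c x n = \<zero>\<^bsub>M\<^esub> \<Longrightarrow>
      lin_comb D c y n = \<zero>\<^bsub>D\<^esub>"
  shows "\<exists>f\<in>hom_set R M D. \<forall>c. (\<forall>i<n. c i \<in> carrier R) \<longrightarrow>
    f (lin_comb M c x n) = lin_comb D c y n"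
proof -
  interpret M: Module.module R M by (rule M)
  interpret D: Module.module R D by (rule D)
  have x: "\<And>i. i < n \<Longrightarrow> x i \<in> carrier M" using gen by (simp add: generates_def)
  let ?Q = "\<lambda>m d. \<exists>c. (\<forall>i<n. c i \<in> carrier R) \<and> m = lin_comb M c x n \<and> d = lin_comb D c y n"
  have "\<exists>f\<in>hom_set R M D. \<forall>m d. ?Q m d \<longrightarrow> f m = d"
  proof (rule hom_of_graph[OF M D])
    fix m d assume "?Q m d"
    then show "m \<in> carrier M \<and> d \<in> carrier D" using x y by auto
  next
    fix m assume "m \<in> carrier M"
    then show "\<exists>d. ?Q m d" using gen unfolding generates_def by blast
  next
    fix m d m' d' assume Q: "?Q m d" "?Q m' d'"
    from Q(1) obtain c where c: "\<forall>i<n. c i \<in> carrier R" "m = lin_comb M c x n" "d = lin_comb D c y n"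
      by blast
    from Q(2) obtain c' where c': "\<forall>i<n. c' i \<in> carrier R" "m' = lin_comb M c' x n"
      "d' = lin_comb D c' y n" by blast
    show "?Q (m \<oplus>\<^bsub>M\<^esub> m') (d \<oplus>\<^bsub>D\<^esub> d')"
      unfolding c(2,3) c'(2,3) using c(1) c'(1) x y
      by (intro exI[where x = "\<lambda>i. c i \<oplus>\<^bsub>R\<^esub> c' i"]) (simp add: M.lin_comb_add D.lin_comb_add)
  next
    fix r m d assume r: "r \<in> carrier R" and Q: "?Q m d"
    from Q obtain c where c: "\<forall>i<n. c i \<in> carrier R" "m = lin_comb M c x n" "d = lin_comb D c y n"
      by blast
    show "?Q (r \<odot>\<^bsub>M\<^esub> m) (r \<odot>\<^bsub>D\<^esub> d)"
      unfolding c(2,3) using c(1) r x y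
      by (intro exI[where x = "\<lambda>i. r \<otimes>\<^bsub>R\<^esub> c i"]) (simp add: M.lin_comb_smult D.lin_comb_smult)
  next
    fix d assume "?Q \<zero>\<^bsub>M\<^esub> d"
    then obtain c where c: "\<forall>i<n. c i \<in> carrier R" "\<zero>\<^bsub>M\<^esub> = lin_comb M c x n" "d = lin_comb D c y n"
      by blast
    then show "d = \<zero>\<^bsub>D\<^esub>" using rel[of c] by simp
  qed
  then obtain f where f: "f \<in> hom_set R M D" "\<forall>m d. ?Q m d \<longrightarrow> f m = d" ..
  have "\<forall>c. (\<forall>i<n. c i \<in> carrier R) \<longrightarrow> f (lin_comb M c x n) = lin_comb D c y n"
    using f(2) by blast
  then show ?thesis using f(1) ..
qed

section \<open>Free modules and generators of finitely presented modules\<close>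

definition freely_generates ::
  "('r, 'e) ring_scheme \<Rightarrow> ('r, 'm, 'x) module_scheme \<Rightarrow> (nat \<Rightarrow> 'm) \<Rightarrow> nat \<Rightarrow> bool"
  where "freely_generates R M x n \<longleftrightarrow> generates R M x n \<and>
    (\<forall>c. (\<forall>i<n. c i \<in> carrier R) \<longrightarrow> lin_comb M c x n = \<zero>\<^bsub>M\<^esub> \<longrightarrow> (\<forall>i<n. c i = \<zero>\<^bsub>R\<^esub>))"

lemma freely_generatesD:
  assumes "freely_generates R M x n" "\<And>i. i < n \<Longrightarrow> c i \<in> carrier R"
    "lin_comb M c x n = \<zero>\<^bsub>M\<^esub>" "i < n"
  shows "c i = \<zero>\<^bsub>R\<^esub>"
  using assms unfolding freely_generates_def by simp

text \<open>Preimages of the values on the basis determine the lift; the relations to be respected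
  are trivial because all their coefficients vanish.\<close>

lemma freely_generates_projective:
  assumes F: "module R F" and free: "freely_generates R F x n"
  shows "projective_module R F"
  unfolding projective_module_def
proof (intro conjI allI ballI impI F)
  interpret F: Module.module R F by (rule F)
  fix X Y :: "'a umodule" and g f
  assume g: "g \<in> hom_set R X Y" and f: "f \<in> hom_set R F Y" and X: "module R X" and Y: "module R Y"
    and surj: "g ` carrier X = carrier Y"
  interpret X: Module.module R X by (rule X)
  interpret g: mod_hom R X Y g by (rule mod_homI[OF X Y hom_setD(1)[OF g]])
  interpret f: mod_hom R F Y f by (rule mod_homI[OF F Y hom_setD(1)[OF f]])
  have gen: "generates R F x n" using free by (simp add: freely_generates_def)
  have x: "\<And>i. i < n \<Longrightarrow> x i \<in> carrier F" using gen by (simp add: generates_def)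
  have "\<exists>z\<in>carrier X. g z = f (x i)" if "i < n" for i
    using f.f_im[OF x[OF that]] unfolding surj[symmetric] by (metis imageE)
  then obtain z where z: "\<And>i. i < n \<Longrightarrow> z i \<in> carrier X" "\<And>i. i < n \<Longrightarrow> g (z i) = f (x i)"
    by metis
  have "\<exists>h\<in>hom_set R F X. \<forall>c. (\<forall>i<n. c i \<in> carrier R) \<longrightarrow>
    h (lin_comb F c x n) = lin_comb X c z n"
  proof (rule hom_of_generators[OF F X gen z(1)])
    fix c assume "\<And>i. i < n \<Longrightarrow> c i \<in> carrier R" "lin_comb F c x n = \<zero>\<^bsub>F\<^esub>"
    then have "\<forall>i<n. c i = \<zero>\<^bsub>R\<^esub>" using free by (simp add: freely_generates_def)
    then show "lin_comb X c z n = \<zero>\<^bsub>X\<^esub>" using z(1) by (intro X.lin_comb_all_zero) simp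
  qed simp
  then obtain h where h: "h \<in> hom_set R F X"
    "\<And>c. (\<forall>i<n. c i \<in> carrier R) \<Longrightarrow> h (lin_comb F c x n) = lin_comb X c z n" by blast
  have "compose (carrier F) g h = f"
  proof (rule extensionalityI[of _ "carrier F"])
    show "compose (carrier F) g h \<in> extensional (carrier F)" by simp
    show "f \<in> extensional (carrier F)" by (rule hom_setD(2)[OF f])
    fix m assume m: "m \<in> carrier F"
    then obtain c where c: "\<forall>i<n. c i \<in> carrier R" "m = lin_comb F c x n"
      using gen unfolding generates_def by blast
    have "g (h m) = lin_comb Y c (\<lambda>i. g (z i)) n"
      unfolding c(2) h(2)[OF c(1)] using c(1) z(1) by (intro g.hom_lin_comb) simp_all
    also have "\<dots> = lin_comb Y c (\<lambda>i. f (x i)) n" using z(2) by (intro lin_comb_cong) simp_all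
    also have "\<dots> = f m"
      unfolding c(2) using c(1) x by (intro f.hom_lin_comb[symmetric]) simp_all
    finally show "compose (carrier F) g h m = f m" using m by (simp add: compose_def)
  qed
  then show "\<exists>h\<in>hom_set R F X. compose (carrier F) g h = f" using h(1) by blast
qed

definition unit_vec :: "('r, 'e) ring_scheme \<Rightarrow> nat \<Rightarrow> nat \<Rightarrow> nat \<Rightarrow> 'r"
  where "unit_vec R n i = (\<lambda>j\<in>{..<n}. if j = i then \<one>\<^bsub>R\<^esub> else \<zero>\<^bsub>R\<^esub>)"

lemma free_module_simps:
  "carrier (free_module R n) = (\<Pi>\<^sub>E i\<in>{..<n}. carrier R)"
  "\<zero>\<^bsub>free_module R n\<^esub> = (\<lambda>i\<in>{..<n}. \<zero>\<^bsub>R\<^esub>)"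
  "v \<oplus>\<^bsub>free_module R n\<^esub> w = (\<lambda>i\<in>{..<n}. v i \<oplus>\<^bsub>R\<^esub> w i)"
  "r \<odot>\<^bsub>free_module R n\<^esub> v = (\<lambda>i\<in>{..<n}. r \<otimes>\<^bsub>R\<^esub> v i)"
  by (simp_all add: product_module_simps regular_module_def)

context cring
begin

lemma free_module_is_module: "module R (free_module R n)"
  by (intro product_module_is_module cring_axioms regular_module_is_module)

lemma unit_vec_closed: "unit_vec R n i \<in> carrier (free_module R n)"
  by (simp add: free_module_simps unit_vec_def)

lemma lin_comb_unit_vec:
  assumes "\<And>i. i < n \<Longrightarrow> c i \<in> carrier R"
  shows "lin_comb (free_module R n) c (unit_vec R n) n = restrict c {..<n}"
proof -
  \<comment> \<open>The partial sum over the first \<open>k\<close> unit vectors has the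
    coefficients in the first \<open>k\<close> coordinates and zeros in the others; the length
    \<open>n\<close> of the vectors stays fixed during the induction.\<close>
  have "k \<le> n \<Longrightarrow> lin_comb (free_module R n) c (unit_vec R n) k
      = (\<lambda>j\<in>{..<n}. if j < k then c j else \<zero>)" for k
  proof (induction k)
    case 0
    then show ?case by (simp add: free_module_simps)
  next
    case (Suc k)
    note IH = Suc.IH[OF Suc_leD[OF Suc.prems]]
    show ?case
      unfolding lin_comb.simps IH
      unfolding free_module_simps unit_vec_def
      using Suc.prems assms by (intro restrict_ext) (auto simp: less_Suc_eq)
  qed
  from this[of n] show ?thesis by (simp add: restrict_def fun_eq_iff)
qed

lemma unit_vec_freely_generates: "freely_generates R (free_module R n) (unit_vec R n) n"
  unfolding freely_generates_def generates_def
proof (intro conjI allI impI ballI)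
  show "unit_vec R n i \<in> carrier (free_module R n)" for i by (rule unit_vec_closed)
next
  fix v assume v: "v \<in> carrier (free_module R n)"
  have v': "\<And>i. i < n \<Longrightarrow> v i \<in> carrier R" using v by (simp add: free_module_simps PiE_iff)
  have "v = lin_comb (free_module R n) v (unit_vec R n) n"
    using lin_comb_unit_vec[of n v, OF v'] PiE_restrict[OF v[unfolded free_module_simps]] by simp
  then show "\<exists>c. (\<forall>i<n. c i \<in> carrier R) \<and> v = lin_comb (free_module R n) c (unit_vec R n) n"
    using v' by (intro exI[where x = v]) simp
next
  fix c i assume c: "\<forall>i<n. c i \<in> carrier R" and i: "i < n"
    and zero: "lin_comb (free_module R n) c (unit_vec R n) n = \<zero>\<^bsub>free_module R n\<^esub>"
  have "restrict c {..<n} = (\<lambda>i\<in>{..<n}. \<zero>)"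
    using zero lin_comb_unit_vec[of n c] c by (simp add: free_module_simps)
  from fun_cong[OF this, of i] show "c i = \<zero>" using i by simp
qed

end

lemma finitely_presented_imp_generates:
  assumes "finitely_presented R M"
  shows "module R M \<and> (\<exists>n x. generates R M x n)"
proof -
  obtain n A where M: "module R M" and A: "A \<subseteq> carrier (free_module R n)"
    and iso: "mod_iso R M (quot_module (free_module R n)
        (LinearCombinations.module.span R (free_module R n) A))"
    using assms unfolding finitely_presented_def by blast
  interpret M: Module.module R M by (rule M)
  have F: "module R (free_module R n)" by (rule M.R.free_module_is_module)
  interpret F: Module.module R "free_module R n" by (rule F)
  let ?K = "LinearCombinations.module.span R (free_module R n) A"
  have K: "submodule R ?K (free_module R n)" by (rule F.span_is_submodule[OF A])
  have Q: "module R (quot_module (free_module R n) ?K)" by (rule quot_module_is_module[OF F K])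
  interpret q: mod_hom R "free_module R n" "quot_module (free_module R n) ?K"
    "\<lambda>x. ?K +>\<^bsub>free_module R n\<^esub> x"
    by (rule mod_homI[OF F Q coset_hom[OF F K]])
  have "generates R (free_module R n) (unit_vec R n) n"
    using M.R.unit_vec_freely_generates by (simp add: freely_generates_def)
  from q.generates_image[OF this carrier_quot_module[symmetric]]
  have gen: "generates R (quot_module (free_module R n) ?K)
    (\<lambda>i. ?K +>\<^bsub>free_module R n\<^esub> unit_vec R n i) n" .
  have "mod_iso R (quot_module (free_module R n) ?K) M" by (rule mod_iso_sym[OF M iso])
  then obtain g where g: "g \<in> module_hom R (quot_module (free_module R n) ?K) M"
    "g ` carrier (quot_module (free_module R n) ?K) = carrier M"
    unfolding mod_iso_def bij_betw_def by blast
  interpret g: mod_hom R "quot_module (free_module R n) ?K" M g by (rule mod_homI[OF Q M g(1)])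
  show ?thesis using g.generates_image[OF gen g(2)] M by blast
qed

context dvr
begin

text \<open>The annihilator of a torsion element is generated by the power \<open>ord_of M x\<close>
  of \<pi>: after cancelling its unit part, a killing scalar is a power of \<pi> with at least this
  exponent.\<close>

lemma tors_coeff:
  assumes M: "module R M" and x: "x \<in> torsion M" and c: "c \<in> carrier R"
    and zero: "c \<odot>\<^bsub>M\<^esub> x = \<zero>\<^bsub>M\<^esub>"
  shows "\<exists>s\<in>carrier R. c = s \<otimes> \<pi> [^] ord_of M x"
proof (cases "c = \<zero>")
  case True
  then show ?thesis by (intro bexI[where x = \<zero>]) simp_all
next
  case False
  interpret M: Module.module R M by (rule M)
  have xc: "x \<in> carrier M" using x by (auto simp: torsion_def tors_def)
  obtain u and k :: nat where uk: "u \<in> Units R" "c = u \<otimes> \<pi> [^] k" using unit_pow[OF c False] by blast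
  have u: "u \<in> carrier R" using uk(1) by (rule Units_closed)
  have "u \<odot>\<^bsub>M\<^esub> (\<pi> [^] k \<odot>\<^bsub>M\<^esub> x) = \<zero>\<^bsub>M\<^esub>"
    using zero unfolding uk(2) using u xc by (simp add: M.smult_assoc1)
  then have "\<pi> [^] k \<odot>\<^bsub>M\<^esub> x = \<zero>\<^bsub>M\<^esub>"
    using smult_unit_iff[OF M _ uk(1) M.submodule_zero, of "\<pi> [^] k \<odot>\<^bsub>M\<^esub> x"] xc by simp
  then have "ord_of M x \<le> k" unfolding ord_of_def by (rule Least_le)
  then have "c = (u \<otimes> \<pi> [^] (k - ord_of M x)) \<otimes> \<pi> [^] ord_of M x"
    unfolding uk(2) using u by (simp add: m_assoc nat_pow_mult)
  then show ?thesis using u by (intro bexI[where x = "u \<otimes> \<pi> [^] (k - ord_of M x)"]) simp_all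
qed

lemma ord_of_kills: assumes "x \<in> torsion M" shows "\<pi> [^] ord_of M x \<odot>\<^bsub>M\<^esub> x = \<zero>\<^bsub>M\<^esub>"
proof -
  obtain k :: nat where "\<pi> [^] k \<odot>\<^bsub>M\<^esub> x = \<zero>\<^bsub>M\<^esub>"
    using assms unfolding torsion_def tors_def by blast
  then show ?thesis unfolding ord_of_def by (rule LeastI)
qed

lemma free_coeff:
  assumes "module R M" "x \<in> carrier M" "x \<notin> torsion M" "c \<in> carrier R" "c \<odot>\<^bsub>M\<^esub> x = \<zero>\<^bsub>M\<^esub>"
  shows "c = \<zero>"
  using smult_eq_zero_imp_tors[OF assms(1,2,4) _ assms(5)] assms(3) by (rule_tac ccontr) simp

text \<open>In a relation between independent generators the coefficient of a torsion-free generator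
  vanishes, so this coordinate is well defined even if other generators are torsion. Sending the
  generator to a test element \<open>d\<close> then detects properties of the coordinate.\<close>

lemma coordinate_hom:
  assumes M: "module R M" and D: "module R D" and gen: "generates R M x n"
    and indep: "independent R M x n" and i: "i < n" "x i \<notin> torsion M" and d: "d \<in> carrier D"
  shows "\<exists>f\<in>hom_set R M D. \<forall>c. (\<forall>i<n. c i \<in> carrier R) \<longrightarrow>
    f (lin_comb M c x n) = c i \<odot>\<^bsub>D\<^esub> d"
proof -
  interpret D: Module.module R D by (rule D)
  have x: "x i \<in> carrier M" using gen i(1) by (simp add: generates_def)
  define y where "y j = (if j = i then d else \<zero>\<^bsub>D\<^esub>)" for j
  have y: "y j \<in> carrier D" for j using d by (simp add: y_def)
  have lc: "lin_comb D c y n = c i \<odot>\<^bsub>D\<^esub> d" if c: "\<And>i. i < n \<Longrightarrow> c i \<in> carrier R" for c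
  proof -
    have "lin_comb D c y n = lin_comb D (\<lambda>j. if j = i then c i else \<zero>) y n"
      using c d by (intro lin_comb_cong_terms[OF D]) (auto simp: y_def)
    also have "\<dots> = c i \<odot>\<^bsub>D\<^esub> y i" using y c i(1) by (intro D.lin_comb_single) simp_all
    finally show ?thesis by (simp add: y_def)
  qed
  have "\<exists>f\<in>hom_set R M D. \<forall>c. (\<forall>i<n. c i \<in> carrier R) \<longrightarrow>
    f (lin_comb M c x n) = lin_comb D c y n"
  proof (rule hom_of_generators[OF M D gen y])
    fix c assume c: "\<And>i. i < n \<Longrightarrow> c i \<in> carrier R" "lin_comb M c x n = \<zero>\<^bsub>M\<^esub>"
    then have "c i \<odot>\<^bsub>M\<^esub> x i = \<zero>\<^bsub>M\<^esub>" using indep i(1) by (simp add: independent_def)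
    then have "c i = \<zero>" using free_coeff[OF M x i(2)] c(1) i(1) by blast
    then show "lin_comb D c y n = \<zero>\<^bsub>D\<^esub>" using lc[OF c(1)] d by simp
  qed
  then obtain f where f: "f \<in> hom_set R M D"
    "\<forall>c. (\<forall>i<n. c i \<in> carrier R) \<longrightarrow> f (lin_comb M c x n) = lin_comb D c y n" ..
  have "\<forall>c. (\<forall>i<n. c i \<in> carrier R) \<longrightarrow> f (lin_comb M c x n) = c i \<odot>\<^bsub>D\<^esub> d"
    using f(2) lc by simp
  then show ?thesis using f(1) ..
qed

text \<open>
  Over a discrete valuation ring finitely generated modules are finitely presented: the relations
  between independent generators \<open>x\<^sub>i\<close> are generated by those killing a single torsion \<open>x\<^sub>i\<close>.
\<close>

lemma ex_Rmod_iso: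
  assumes M: "module R M" and gen: "generates R M x n"
  shows "\<exists>M'\<in>Rmod R. mod_iso R M' M"
proof -
  obtain y where y: "generates R M y n" "independent R M y n"
    using ex_independent_generators[OF M gen] by blast
  interpret M: Module.module R M by (rule M)
  have yc: "\<And>i. i < n \<Longrightarrow> y i \<in> carrier M" using y(1) by (simp add: generates_def)
  let ?F = "free_module R n"
  have F: "module R ?F" by (rule free_module_is_module)
  interpret F: Module.module R ?F by (rule F)
  define f where "f v = lin_comb M v y n" for v
  have Fc: "\<And>i. i < n \<Longrightarrow> v i \<in> carrier R" if "v \<in> carrier ?F" for v
    using that by (simp add: free_module_simps PiE_iff)
  have f: "f \<in> module_hom R ?F M"
  proof (rule module_homI)
    show "f v \<in> carrier M" if "v \<in> carrier ?F" for v
      unfolding f_def using Fc[OF that] yc by simp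
    show "f (v \<oplus>\<^bsub>?F\<^esub> w) = f v \<oplus>\<^bsub>M\<^esub> f w" if "v \<in> carrier ?F" "w \<in> carrier ?F" for v w
      unfolding f_def using Fc[OF that(1)] Fc[OF that(2)] yc
      by (subst M.lin_comb_add[symmetric]) (auto intro!: lin_comb_cong simp: free_module_simps)
    show "f (r \<odot>\<^bsub>?F\<^esub> v) = r \<odot>\<^bsub>M\<^esub> f v" if "r \<in> carrier R" "v \<in> carrier ?F" for r v
      unfolding f_def using Fc[OF that(2)] that(1) yc
      by (subst M.lin_comb_smult[symmetric]) (auto intro!: lin_comb_cong simp: free_module_simps)
  qed
  have surj: "f ` carrier ?F = carrier M"
  proof (intro equalityI subsetI)
    fix m assume "m \<in> carrier M"
    then obtain c where c: "\<forall>i<n. c i \<in> carrier R" "m = lin_comb M c y n"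
      using y(1) unfolding generates_def by blast
    have "m = f (restrict c {..<n})"
      unfolding c(2) f_def by (intro lin_comb_cong) simp_all
    moreover have "restrict c {..<n} \<in> carrier ?F" using c(1) by (simp add: free_module_simps)
    ultimately show "m \<in> f ` carrier ?F" by blast
  next
    fix m assume "m \<in> f ` carrier ?F"
    then show "m \<in> carrier M" using module_hom_closed[OF f] by blast
  qed
  define K where "K = {v \<in> carrier ?F. f v = \<zero>\<^bsub>M\<^esub>}"
  interpret f: mod_hom R ?F M f by (rule mod_homI[OF F M f])
  have K: "submodule R K ?F" using f.ker_is_submodule by (simp add: K_def f.ker_def)
  \<comment> \<open>The smallest multiple of the \<open>i\<close>-th unit vector that maps to zero;
    only indices of torsion generators contribute a relation to \<open>A\<close>.\<close>
  define rel where "rel i = \<pi> [^] ord_of M (y i) \<odot>\<^bsub>?F\<^esub> unit_vec R n i" for i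
  define A where "A = rel ` {i. i < n \<and> y i \<in> torsion M}"
  have A_sub: "A \<subseteq> carrier ?F" unfolding A_def rel_def using unit_vec_closed by auto
  have f_unit: "f (unit_vec R n i) = y i" if "i < n" for i
  proof -
    have "f (unit_vec R n i) = lin_comb M (\<lambda>j. if j = i then \<one> else \<zero>) y n"
      unfolding f_def unit_vec_def by (intro lin_comb_cong) simp_all
    also have "\<dots> = \<one> \<odot>\<^bsub>M\<^esub> y i" using that yc by (intro M.lin_comb_single) simp_all
    finally show ?thesis using yc[OF that] by simp
  qed
  have "A \<subseteq> K"
  proof
    fix a assume "a \<in> A"
    then obtain i where i: "i < n" "y i \<in> torsion M" "a = rel i" by (auto simp: A_def)
    have "f a = \<pi> [^] ord_of M (y i) \<odot>\<^bsub>M\<^esub> y i"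
      unfolding i(3) rel_def using unit_vec_closed[of n i] f_unit[OF i(1)] by simp
    then show "a \<in> K"
      using ord_of_kills[OF i(2)] A_sub \<open>a \<in> A\<close> by (auto simp: K_def)
  qed
  then have span_K: "F.span A \<subseteq> K" by (rule F.span_is_subset[OF _ K])
  have span: "submodule R (F.span A) ?F" by (rule F.span_is_submodule[OF A_sub])
  have "K \<subseteq> F.span A"
  proof
    fix v assume v: "v \<in> K"
    then have vF: "v \<in> carrier ?F" and zero: "lin_comb M v y n = \<zero>\<^bsub>M\<^esub>" by (simp_all add: K_def f_def)
    \<comment> \<open>By independence each term of a relation vanishes separately. A torsion
      generator makes the coefficient a multiple of the one in \<open>rel i\<close>, any other
      generator makes it zero.\<close>
    have terms: "v i \<odot>\<^bsub>?F\<^esub> unit_vec R n i \<in> F.span A" if i: "i < n" for i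
    proof -
      have vi: "v i \<odot>\<^bsub>M\<^esub> y i = \<zero>\<^bsub>M\<^esub>"
        using y(2) zero Fc[OF vF] i by (simp add: independent_def)
      show ?thesis
      proof (cases "y i \<in> torsion M")
        case True
        obtain s where s: "s \<in> carrier R" "v i = s \<otimes> \<pi> [^] ord_of M (y i)"
          using tors_coeff[OF M True Fc[OF vF i] vi] by blast
        have "v i \<odot>\<^bsub>?F\<^esub> unit_vec R n i = s \<odot>\<^bsub>?F\<^esub> rel i"
          unfolding s(2) rel_def using s(1) unit_vec_closed[of n i] by (simp add: F.smult_assoc1)
        moreover have "rel i \<in> F.span A"
          using F.in_own_span[OF A_sub] i True by (auto simp: A_def)
        ultimately show ?thesis
          using LinearCombinations.submodule.smult_closed[OF span s(1)] by simp
      next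
        case False
        then have "v i = \<zero>" using free_coeff[OF M yc[OF i] False Fc[OF vF i] vi] by blast
        then show ?thesis
          using unit_vec_closed[of n i] LinearCombinations.submodule.zero_closed[OF span] by simp
      qed
    qed
    have "lin_comb ?F v (unit_vec R n) n \<in> F.span A"
    proof -
      have "k \<le> n \<Longrightarrow> lin_comb ?F v (unit_vec R n) k \<in> F.span A" for k
        using terms LinearCombinations.submodule.zero_closed[OF span]
          LinearCombinations.submodule.m_closed[OF span]
        by (induction k) simp_all
      then show ?thesis by blast
    qed
    moreover have "lin_comb ?F v (unit_vec R n) n = v"
      using lin_comb_unit_vec[of n v, OF Fc[OF vF]] PiE_restrict[OF vF[unfolded free_module_simps]] by simp
    ultimately show "v \<in> F.span A" by simp
  qed
  with span_K have K_eq: "K = F.span A" by blast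
  let ?M' = "quot_module ?F K"
  have "module R ?M'" by (rule quot_module_is_module[OF F K])
  moreover have "finite A" by (simp add: A_def)
  ultimately have "?M' \<in> Rmod R"
    unfolding Rmod_def finitely_presented_def K_eq
    using A_sub mod_iso_refl by blast
  moreover have "mod_iso R ?M' M"
    by (rule mod_iso_sym[OF M first_iso[OF F M f surj K_def]])
  ultimately show ?thesis by blast
qed

text \<open>A copy of \<open>free_module R n\<close> on the type over which \<open>Rmod R\<close>
  ranges. It provides the projective part of decompositions and the free cover of a projective
  module.\<close>

lemma ex_free_Rmod: "\<exists>X\<in>Rmod R. \<exists>x. freely_generates R X x n"
proof -
  let ?F = "free_module R n"
  have F: "module R ?F" by (rule free_module_is_module)
  interpret F: Module.module R ?F by (rule F)
  have gen: "generates R ?F (unit_vec R n) n"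
    using unit_vec_freely_generates by (simp add: freely_generates_def)
  obtain X where X: "X \<in> Rmod R" and iso: "mod_iso R X ?F" using ex_Rmod_iso[OF F gen] by blast
  have XM: "module R X" using X by (simp add: Rmod_def finitely_presented_def)
  obtain g where g: "g \<in> module_hom R ?F X" "bij_betw g (carrier ?F) (carrier X)"
    using mod_iso_sym[OF XM iso] by (auto simp: mod_iso_def)
  interpret g: mod_hom R ?F X g by (rule mod_homI[OF F XM g(1)])
  have inj: "inj_on g (carrier ?F)" and surj: "g ` carrier ?F = carrier X"
    using g(2) by (simp_all add: bij_betw_def)
  have "freely_generates R X (\<lambda>i. g (unit_vec R n i)) n"
    unfolding freely_generates_def
  proof (intro conjI allI impI)
    show "generates R X (\<lambda>i. g (unit_vec R n i)) n" by (rule g.generates_image[OF gen surj])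
    fix c i assume c: "\<forall>i<n. c i \<in> carrier R" and i: "i < n"
      and zero: "lin_comb X c (\<lambda>i. g (unit_vec R n i)) n = \<zero>\<^bsub>X\<^esub>"
    have "g (lin_comb ?F c (unit_vec R n) n) = \<zero>\<^bsub>X\<^esub>"
      using zero c g.hom_lin_comb[of n c "unit_vec R n"] unit_vec_closed by simp
    then have "lin_comb ?F c (unit_vec R n) n = \<zero>\<^bsub>?F\<^esub>"
      using inj c unit_vec_closed unfolding g.inj_on_iff_kernel by simp
    then show "c i = \<zero>" using unit_vec_freely_generates c i unfolding freely_generates_def by blast
  qed
  then show ?thesis using X by blast
qed

lemma freely_generates_torsion_free:
  assumes M: "module R M" and free: "freely_generates R M x n"
  shows "torsion M = {\<zero>\<^bsub>M\<^esub>}"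
proof -
  interpret M: Module.module R M by (rule M)
  have x: "\<And>i. i < n \<Longrightarrow> x i \<in> carrier M" using free by (simp add: freely_generates_def generates_def)
  have "m = \<zero>\<^bsub>M\<^esub>" if m: "m \<in> torsion M" for m
  proof -
    obtain k :: nat where k: "m \<in> carrier M" "\<pi> [^] k \<odot>\<^bsub>M\<^esub> m = \<zero>\<^bsub>M\<^esub>"
      using m unfolding torsion_def tors_def by blast
    obtain c where c: "\<And>i. i < n \<Longrightarrow> c i \<in> carrier R" "m = lin_comb M c x n"
      using free k(1) unfolding freely_generates_def generates_def by blast
    have "lin_comb M (\<lambda>i. \<pi> [^] k \<otimes> c i) x n = \<zero>\<^bsub>M\<^esub>"
      using k(2) c x M.lin_comb_smult[of n c "\<pi> [^] k" x] by simp
    then have "\<pi> [^] k \<otimes> c i = \<zero>" if "i < n" for i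
      using freely_generatesD[OF free, where c = "\<lambda>i. \<pi> [^] k \<otimes> c i" and i = i] c(1) that
      by simp
    then have "\<forall>i<n. c i = \<zero>" using c(1) by (simp add: integral_iff)
    then show ?thesis unfolding c(2) using x by (intro M.lin_comb_all_zero) simp
  qed
  then show ?thesis
    using LinearCombinations.submodule.zero_closed[OF submodule_torsion[OF M]] by blast
qed

lemma projective_torsion_free:
  assumes F: "F \<in> Rmod R" and proj: "projective_module R F"
  shows "torsion F = {\<zero>\<^bsub>F\<^esub>}"
proof -
  have FM: "module R F" using F by (simp add: Rmod_def finitely_presented_def)
  interpret F: Module.module R F by (rule FM)
  obtain n y where gen: "generates R F y n"
    using finitely_presented_imp_generates F unfolding Rmod_def by blast
  have y: "\<And>i. i < n \<Longrightarrow> y i \<in> carrier F" using gen by (simp add: generates_def)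
  obtain X x where X: "X \<in> Rmod R" and free: "freely_generates R X x n" using ex_free_Rmod by blast
  have XM: "module R X" using X by (simp add: Rmod_def finitely_presented_def)
  interpret X: Module.module R X by (rule XM)
  have "\<exists>g\<in>hom_set R X F. \<forall>c. (\<forall>i<n. c i \<in> carrier R) \<longrightarrow>
    g (lin_comb X c x n) = lin_comb F c y n"
  proof (rule hom_of_generators[OF XM FM _ y])
    show "generates R X x n" using free by (simp add: freely_generates_def)
    fix c assume c: "\<And>i. i < n \<Longrightarrow> c i \<in> carrier R" "lin_comb X c x n = \<zero>\<^bsub>X\<^esub>"
    then have "\<forall>i<n. c i = \<zero>" using free by (simp add: freely_generates_def)
    then show "lin_comb F c y n = \<zero>\<^bsub>F\<^esub>" using y by (intro F.lin_comb_all_zero) simp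
  qed simp
  then obtain g where g: "g \<in> hom_set R X F"
    and g_lc: "\<And>c. (\<forall>i<n. c i \<in> carrier R) \<Longrightarrow> g (lin_comb X c x n) = lin_comb F c y n" by blast
  interpret g: mod_hom R X F g by (rule mod_homI[OF XM FM hom_setD(1)[OF g]])
  have "carrier F \<subseteq> g ` carrier X"
  proof
    fix m assume "m \<in> carrier F"
    then obtain c where c: "\<forall>i<n. c i \<in> carrier R" "m = lin_comb F c y n"
      using gen unfolding generates_def by blast
    then have "m = g (lin_comb X c x n)" using g_lc by simp
    moreover have "lin_comb X c x n \<in> carrier X"
      using c(1) free by (simp add: freely_generates_def generates_def)
    ultimately show "m \<in> g ` carrier X" by blast
  qed
  then have surj: "g ` carrier X = carrier F" using g.f_im by blast
  have id: "(\<lambda>m\<in>carrier F. m) \<in> hom_set R F F"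
    by (rule restrict_hom_set[OF FM]) (simp add: LinearCombinations.module_hom_def)
  from proj[unfolded projective_module_def] have "\<exists>h\<in>hom_set R F X. compose (carrier F) g h = (\<lambda>m\<in>carrier F. m)"
    using g id XM FM surj by blast
  then obtain h where h: "h \<in> hom_set R F X" "compose (carrier F) g h = (\<lambda>m\<in>carrier F. m)" by blast
  interpret h: mod_hom R F X h by (rule mod_homI[OF FM XM hom_setD(1)[OF h(1)]])
  have "m = \<zero>\<^bsub>F\<^esub>" if m: "m \<in> torsion F" for m
  proof -
    obtain k :: nat where k: "m \<in> carrier F" "\<pi> [^] k \<odot>\<^bsub>F\<^esub> m = \<zero>\<^bsub>F\<^esub>"
      using m unfolding torsion_def tors_def by blast
    have "\<pi> [^] k \<odot>\<^bsub>X\<^esub> h m = h (\<pi> [^] k \<odot>\<^bsub>F\<^esub> m)" using k(1) by (simp only: h.f_smult pi_pow_closed)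
    then have "h m \<in> torsion X" using k unfolding torsion_def tors_def by auto
    then have "h m = \<zero>\<^bsub>X\<^esub>" using freely_generates_torsion_free[OF XM free] by simp
    moreover have "g (h m) = m" using fun_cong[OF h(2), of m] k(1) by (simp add: compose_def)
    ultimately show ?thesis using g.f0_is_0 by simp
  qed
  then show ?thesis
    using LinearCombinations.submodule.zero_closed[OF submodule_torsion[OF FM]] by blast
qed

end

section \<open>Discrete valuation rings\<close>

lemma (in cring) ideal_prod_cgenideal:
  assumes "a \<in> carrier R" "b \<in> carrier R"
  shows "ideal_prod R (PIdl a) (PIdl b) = PIdl (a \<otimes> b)"
proof (intro equalityI subsetI)
  fix x assume "x \<in> ideal_prod R (PIdl a) (PIdl b)"
  then show "x \<in> PIdl (a \<otimes> b)"
  proof (induction rule: ideal_prod.induct)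
    case (prod i j)
    then obtain r s where rs: "r \<in> carrier R" "i = r \<otimes> a" "s \<in> carrier R" "j = s \<otimes> b"
      unfolding cgenideal_def by blast
    then have "i \<otimes> j = (r \<otimes> s) \<otimes> (a \<otimes> b)" using assms by (simp add: m_ac)
    then show ?case unfolding cgenideal_def using rs by (intro CollectI exI[where x = "r \<otimes> s"]) simp
  next
    case (sum s1 s2)
    then show ?case
      using additive_subgroup.a_closed[OF ideal.axioms(1)[OF cgenideal_ideal]] assms by simp
  qed
next
  fix x assume "x \<in> PIdl (a \<otimes> b)"
  then obtain r where r: "r \<in> carrier R" "x = r \<otimes> (a \<otimes> b)" unfolding cgenideal_def by blast
  have "(r \<otimes> a) \<otimes> (\<one> \<otimes> b) \<in> ideal_prod R (PIdl a) (PIdl b)"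
    using r(1) by (intro ideal_prod.prod) (unfold cgenideal_def, blast+)
  then show "x \<in> ideal_prod R (PIdl a) (PIdl b)" using r assms by (simp add: m_assoc)
qed

lemma (in cring) ideal_pow_cgenideal:
  assumes "a \<in> carrier R" shows "ideal_pow R (PIdl a) n = PIdl (a [^] n)"
proof (induction n)
  case 0
  have "PIdl \<one> = carrier R" unfolding cgenideal_def by force
  then show ?case by (simp add: ideals_set_def nat_pow_def)
next
  case (Suc n)
  have "ideal_pow R (PIdl a) (Suc n) = ideal_prod R (ideal_pow R (PIdl a) n) (PIdl a)"
    by (simp add: ideals_set_def nat_pow_def)
  then show ?case using Suc ideal_prod_cgenideal[of "a [^] n" a] assms by simp
qed

text \<open>In a principal domain irreducible elements generate maximal ideals. There is just one
  maximal ideal, so every irreducible element is associated to \<pi>, and factorisation into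
  irreducibles gives a unit times a power of \<pi>.\<close>

lemma discrete_valuation_ring_imp_dvr:
  assumes dvr: "discrete_valuation_ring R" and max: "maximalideal \<pp> R"
  shows "\<exists>\<pi>. dvr R \<pi> \<and> \<pp> = cgenideal R \<pi>"
proof -
  interpret principal_domain R using dvr by (simp add: discrete_valuation_ring_def)
  have uniq: "I = \<pp>" if "maximalideal I R" for I
    using dvr max that unfolding discrete_valuation_ring_def by blast
  obtain \<pi> where pi: "\<pi> \<in> carrier R" "\<pp> = cgenideal R \<pi>"
    using exists_gen[OF maximalideal.axioms(1)[OF max]] by blast
  have nonzero: "\<pi> \<noteq> \<zero>\<^bsub>R\<^esub>"
  proof
    assume "\<pi> = \<zero>\<^bsub>R\<^esub>"
    then have "\<pp> = {\<zero>\<^bsub>R\<^esub>}" unfolding pi(2) cgenideal_def by force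
    then have "field R" using max zeromaximalideal_fieldI by simp
    then show False using dvr by (simp add: discrete_valuation_ring_def)
  qed
  have nonunit: "\<pi> \<notin> Units R"
    using ideal_eq_carrier_iff[OF pi(1)] maximalideal.I_notcarr[OF max] pi(2) by simp
  have irred: "\<exists>u\<in>Units R. f = u \<otimes>\<^bsub>R\<^esub> \<pi>" if f: "f \<in> carrier R" "ring_irreducible\<^bsub>R\<^esub> f" for f
  proof -
    have "maximalideal (cgenideal R f) R" by (rule irreducible_imp_maximalideal[OF f])
    then have "cgenideal R f = cgenideal R \<pi>" using uniq pi(2) by simp
    then show ?thesis
      using associated_iff_same_ideal[OF f(1) pi(1)] ring_associated_iff[OF f(1) pi(1)] by simp
  qed
  have "dvr R \<pi>"
  proof (unfold_locales)
    fix r assume r: "r \<in> carrier R" "r \<noteq> \<zero>\<^bsub>R\<^esub>"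
    show "\<exists>u\<in>Units R. \<exists>k::nat. r = u \<otimes>\<^bsub>R\<^esub> \<pi> [^]\<^bsub>R\<^esub> k"
    proof (cases "r \<in> Units R")
      case True
      then show ?thesis using r by (intro bexI[where x = r] exI[where x = 0]) simp_all
    next
      case False
      then obtain fs where fs: "set fs \<subseteq> carrier (mult_of R)" "wfactors (mult_of R) fs r"
        using factorization_property[of r] r by blast
      \<comment> \<open>The exponent of \<pi> is the number of irreducible factors, and the units of
        the single factors are collected in \<open>u\<close>.\<close>
      have prod: "\<exists>u\<in>Units R. foldr (mult R) gs \<one>\<^bsub>R\<^esub> = u \<otimes>\<^bsub>R\<^esub> \<pi> [^]\<^bsub>R\<^esub> length gs"
        if "set gs \<subseteq> carrier (mult_of R)" "\<forall>g\<in>set gs. Divisibility.irreducible (mult_of R) g" for gs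
        using that
      proof (induction gs)
        case Nil
        then show ?case by (intro bexI[where x = "\<one>\<^bsub>R\<^esub>"]) simp_all
      next
        case (Cons g gs)
        then obtain u where u: "u \<in> Units R"
          "foldr (mult R) gs \<one>\<^bsub>R\<^esub> = u \<otimes>\<^bsub>R\<^esub> \<pi> [^]\<^bsub>R\<^esub> length gs" by auto
        have g: "g \<in> carrier R - {\<zero>\<^bsub>R\<^esub>}" "Divisibility.irreducible (mult_of R) g" using Cons.prems by simp_all
        obtain v where v: "v \<in> Units R" "g = v \<otimes>\<^bsub>R\<^esub> \<pi>"
          using irred[of g] ring_irreducibleI'[OF g] g(1) by auto
        have c: "u \<in> carrier R" "v \<in> carrier R" using u v by (auto intro: Units_closed)
        have "foldr (mult R) (g # gs) \<one>\<^bsub>R\<^esub> = (v \<otimes>\<^bsub>R\<^esub> u) \<otimes>\<^bsub>R\<^esub> \<pi> [^]\<^bsub>R\<^esub> length (g # gs)"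
          using c pi(1) by (simp add: u(2) v(2) m_ac)
        moreover have "v \<otimes>\<^bsub>R\<^esub> u \<in> Units R" using u v by simp
        ultimately show ?case by (rule bexI)
      qed
      have "\<forall>g\<in>set fs. Divisibility.irreducible (mult_of R) g"
        and assoc: "foldr (mult (mult_of R)) fs \<one>\<^bsub>mult_of R\<^esub> \<sim>\<^bsub>mult_of R\<^esub> r"
        using fs(2) by (simp_all add: wfactors_def)
      from prod[OF fs(1) this(1)] obtain u where u: "u \<in> Units R"
        "foldr (mult R) fs \<one>\<^bsub>R\<^esub> = u \<otimes>\<^bsub>R\<^esub> \<pi> [^]\<^bsub>R\<^esub> length fs" ..
      have uc: "u \<in> carrier R" using u(1) by (rule Units_closed)
      have fold_c: "foldr (mult R) fs \<one>\<^bsub>R\<^esub> \<in> carrier R" unfolding u(2) using uc pi(1) by simp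
      have fold_nz: "foldr (mult R) fs \<one>\<^bsub>R\<^esub> \<noteq> \<zero>\<^bsub>R\<^esub>"
      proof -
        have "foldr (mult R) gs \<one>\<^bsub>R\<^esub> \<in> carrier R - {\<zero>\<^bsub>R\<^esub>}" if "set gs \<subseteq> carrier R - {\<zero>\<^bsub>R\<^esub>}" for gs
          using that by (induction gs) (auto simp: integral_iff)
        then show ?thesis using fs(1) by simp
      qed
      \<comment> \<open>The factorisation holds up to association in the monoid of nonzero elements.
        It is transferred to the ring, where association means a unit factor.\<close>
      have "r \<sim>\<^bsub>mult_of R\<^esub> foldr (mult R) fs \<one>\<^bsub>R\<^esub>"
        using assoc mult_of.associated_sym by simp
      then have "r \<sim>\<^bsub>R\<^esub> foldr (mult R) fs \<one>\<^bsub>R\<^esub>"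
        using assoc_iff_assoc_mult[of r "foldr (mult R) fs \<one>\<^bsub>R\<^esub>"] r fold_c fold_nz by simp
      then obtain v where v: "v \<in> Units R" "r = v \<otimes>\<^bsub>R\<^esub> foldr (mult R) fs \<one>\<^bsub>R\<^esub>"
        using ring_associated_iff[OF r(1) fold_c] by blast
      have "r = (v \<otimes>\<^bsub>R\<^esub> u) \<otimes>\<^bsub>R\<^esub> \<pi> [^]\<^bsub>R\<^esub> length fs"
        unfolding v(2) u(2) using Units_closed[OF v(1)] uc pi(1) by (simp add: m_assoc)
      then have "\<exists>k::nat. r = (v \<otimes>\<^bsub>R\<^esub> u) \<otimes>\<^bsub>R\<^esub> \<pi> [^]\<^bsub>R\<^esub> k" by (rule exI)
      moreover have "v \<otimes>\<^bsub>R\<^esub> u \<in> Units R" using u v by simp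
      ultimately show ?thesis by (rule bexI)
    qed
  qed (use pi nonzero nonunit in simp_all)
  then show ?thesis using pi(2) by blast
qed

section \<open>Decompositions and multiplicities\<close>

lemma product_module_cong:
  "(\<And>i. i \<in> I \<Longrightarrow> M i = N i) \<Longrightarrow> product_module I M = product_module I N"
  unfolding product_module_def by (simp cong: PiE_cong restrict_cong)

context dvr
begin

text \<open>A proper ideal contains no units, and every nonunit is a multiple of \<pi>; so it lies
  in the ideal generated by \<pi>, which is itself proper.\<close>

lemma maximalideal_eq: assumes "maximalideal I R" shows "I = PIdl \<pi>"
proof -
  interpret I: maximalideal I R by fact
  have "I \<subseteq> PIdl \<pi>"
  proof
    fix r assume r: "r \<in> I"
    have rc: "r \<in> carrier R" using r by (rule I.Icarr)
    have "r \<notin> Units R"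
    proof
      assume "r \<in> Units R"
      then have "\<one> \<in> I" using I.I_l_closed[OF r, of "inv r"] by simp
      then show False using I.one_imp_carrier I.I_notcarr by simp
    qed
    then obtain s where "s \<in> carrier R" "r = \<pi> \<otimes> s" using nonunit_pi_mult[OF rc] by blast
    then show "r \<in> PIdl \<pi>" unfolding cgenideal_def by (intro CollectI exI[where x = s]) (simp add: m_comm)
  qed
  moreover have "PIdl \<pi> \<noteq> carrier R" using ideal_eq_carrier_iff[OF pi_closed] pi_nonunit by simp
  moreover have "PIdl \<pi> \<subseteq> carrier R" unfolding cgenideal_def by auto
  ultimately show ?thesis using I.I_maximal[OF cgenideal_ideal[OF pi_closed]] by blast
qed

lemma maximalideal_pi: "maximalideal (PIdl \<pi>) R"
proof (rule maximalidealI[OF cgenideal_ideal[OF pi_closed]])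
  show "carrier R \<noteq> PIdl \<pi>" using ideal_eq_carrier_iff[OF pi_closed] pi_nonunit by simp
next
  fix J assume J: "ideal J R" and sub: "PIdl \<pi> \<subseteq> J"
  interpret J: ideal J R by (rule J)
  show "J = PIdl \<pi> \<or> J = carrier R"
  proof (cases "J \<subseteq> PIdl \<pi>")
    case False
    then obtain r where r: "r \<in> J" "r \<notin> PIdl \<pi>" by blast
    have rc: "r \<in> carrier R" using r(1) by (rule J.Icarr)
    have "r \<in> Units R"
    proof (rule ccontr)
      assume "r \<notin> Units R"
      then obtain s where "s \<in> carrier R" "r = \<pi> \<otimes> s" using nonunit_pi_mult[OF rc] by blast
      then have "r \<in> PIdl \<pi>"
        unfolding cgenideal_def by (intro CollectI exI[where x = s]) (simp add: m_comm)
      then show False using r(2) by simp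
    qed
    then have "\<one> \<in> J" using J.I_l_closed[OF r(1), of "inv r"] by simp
    then show ?thesis using J.one_imp_carrier by simp
  qed (use sub in blast)
qed

text \<open>\<open>\<Sum>\<^sub>i min(k, l\<^sub>i)\<close> is the length of the \<open>\<pi>\<^sup>k\<close>-torsion of \<open>F \<oplus> \<Oplus>\<^sub>i R/\<pp>\<^sup>l\<^sup>i\<close>.\<close>

definition sum_min :: "('a set \<times> nat) list \<Rightarrow> nat \<Rightarrow> nat"
  where "sum_min L k = sum_list (map (\<lambda>p. min k (snd p)) L)"

lemma decomposition_modules:
  assumes dec: "decomposition R M F L"
  shows "\<forall>p\<in>set L. fst p = PIdl \<pi> \<and> 1 \<le> snd p"
    and "\<And>i. i < length L \<Longrightarrow> residue_module R (ideal_pow R (fst (L ! i)) (snd (L ! i)))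
      = residue_module R (PIdl (\<pi> [^] snd (L ! i)))"
    and "module R F"
    and "module R (product_module {..<length L}
      (\<lambda>i. residue_module R (ideal_pow R (fst (L ! i)) (snd (L ! i)))))"
proof -
  show fst: "\<forall>p\<in>set L. fst p = PIdl \<pi> \<and> 1 \<le> snd p"
    using dec maximalideal_eq unfolding decomposition_def by fastforce
  show eq: "residue_module R (ideal_pow R (fst (L ! i)) (snd (L ! i)))
      = residue_module R (PIdl (\<pi> [^] snd (L ! i)))" if "i < length L" for i
    using fst nth_mem[OF that] ideal_pow_cgenideal[OF pi_closed] by simp
  show "module R F" using dec by (simp add: decomposition_def Rmod_def finitely_presented_def)
  show "module R (product_module {..<length L}
      (\<lambda>i. residue_module R (ideal_pow R (fst (L ! i)) (snd (L ! i)))))"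
    by (rule product_module_is_module[OF cring_axioms]) (simp add: eq residue_module_is_module)
qed

text \<open>The projective part is torsion-free and contributes nothing, so the lengths see exactly
  the cyclic torsion summands. The left-hand side does not mention the decomposition.\<close>

lemma len_tors_decomposition:
  assumes M: "module R M" and dec: "decomposition R M F L"
  shows "len_tors M k = enat (sum_min L k)"
proof -
  note mods = decomposition_modules[OF dec]
  let ?N = "\<lambda>i. residue_module R (ideal_pow R (fst (L ! i)) (snd (L ! i)))"
  let ?P = "product_module {..<length L} ?N"
  have "torsion F = {\<zero>\<^bsub>F\<^esub>}"
    using dec projective_torsion_free by (simp add: decomposition_def)
  then have "tors F k = {\<zero>\<^bsub>F\<^esub>}"
    using LinearCombinations.submodule.zero_closed[OF submodule_tors[OF mods(3), of k]]
    unfolding torsion_def by blast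
  then have F0: "len_tors F k = 0" by (simp add: len_tors_def module.len_zero[OF mods(3)])
  have "len_tors M k = len_tors (direct_sum F ?P) k"
    using dec by (intro len_tors_iso[OF M direct_sum_is_module[OF mods(3,4)]])
      (simp add: decomposition_def)
  also have "\<dots> = len_tors ?P k" using len_tors_direct_sum[OF mods(3,4)] F0 by simp
  also have "\<dots> = (\<Sum>i<length L. len_tors (?N i) k)"
    by (rule len_tors_product) (simp add: mods(2) residue_module_is_module)
  also have "\<dots> = (\<Sum>i<length L. enat (min k (snd (L ! i))))"
    by (rule sum.cong) (simp_all add: mods(2) len_tors_residue)
  also have "\<dots> = enat (\<Sum>i<length L. min k (snd (L ! i)))"
  proof -
    have "(\<Sum>i<m. enat (g i)) = enat (\<Sum>i<m. g i)" for g and m :: nat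
      by (induction m) (simp_all add: zero_enat_def)
    then show ?thesis .
  qed
  also have "(\<Sum>i<length L. min k (snd (L ! i))) = sum_min L k"
    by (simp add: sum_min_def sum_list_sum_nth atLeast0LessThan)
  finally show ?thesis .
qed

text \<open>As a function of \<open>k\<close>, \<open>min k l'\<close> is linear except for a bend
  at \<open>l'\<close>, where its negated second difference is 1. The assumption
  \<open>1 \<le> l\<close> makes \<open>l - 1\<close> exact.\<close>

lemma count_list_eq_sum_min:
  assumes "\<forall>p\<in>set L. fst p = I" "1 \<le> l"
  shows "int (count_list L (I, l))
    = 2 * int (sum_min L l) - int (sum_min L (l - 1)) - int (sum_min L (l + 1))"
  using assms
proof (induction L)
  case (Cons p L)
  obtain l' where p: "p = (I, l')" using Cons.prems(1) by (cases p) simp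
  have "int (if l' = l then 1 else 0) = 2 * int (min l l') - int (min (l - 1) l') - int (min (l + 1) l')"
    using Cons.prems(2) by (auto simp: min_def)
  then show ?case using Cons p by (cases "l' = l") (simp_all add: sum_min_def)
qed (simp add: sum_min_def)

text \<open>Any two decompositions have the same \<open>sum_min\<close>, since both compute torsion
  lengths of \<open>M\<close>; hence all counts agree and the definite description is met by any
  decomposition.\<close>

lemma module_mult_eq:
  assumes M: "module R M" and dec: "decomposition R M F L" and l: "1 \<le> l"
  shows "module_mult R M (PIdl \<pi>) l = count_list L (PIdl \<pi>, l)"
  unfolding module_mult_def
proof (rule the_equality)
  show "\<exists>F L'. decomposition R M F L' \<and> count_list L (PIdl \<pi>, l) = count_list L' (PIdl \<pi>, l)"
    using dec by blast
  fix k assume "\<exists>F L. decomposition R M F L \<and> k = count_list L (PIdl \<pi>, l)"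
  then obtain F' L' where dec': "decomposition R M F' L'" and k: "k = count_list L' (PIdl \<pi>, l)"
    by blast
  have "sum_min L = sum_min L'"
    using len_tors_decomposition[OF M dec] len_tors_decomposition[OF M dec'] by (auto simp: fun_eq_iff)
  then have "int (count_list L (PIdl \<pi>, l)) = int (count_list L' (PIdl \<pi>, l))"
    using count_list_eq_sum_min[OF _ l] decomposition_modules(1)[OF dec]
      decomposition_modules(1)[OF dec'] by simp
  then show "k = count_list L (PIdl \<pi>, l)" using k by simp
qed

text \<open>Independent generators split the module into cyclic ones. The torsion-free generators
  give a free part and the nonzero torsion generators the quotients by powers of \<pi>; the
  isomorphism maps a combination to its coefficients in these quotients.\<close>

lemma ex_decomposition:
  assumes M: "module R M" and gen: "generates R M x' n"
  shows "\<exists>F L. decomposition R M F L"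
proof -
  interpret M: Module.module R M by (rule M)
  obtain x where gen: "generates R M x n" and indep: "independent R M x n"
    using ex_independent_generators[OF M gen] by blast
  have x: "\<And>i. i < n \<Longrightarrow> x i \<in> carrier M" using gen by (simp add: generates_def)
  define ps where "ps = filter (\<lambda>i. x i \<notin> torsion M) [0..<n]"
  \<comment> \<open>Zero generators are discarded: they have order 0 and would yield exponents that
    \<open>decomposition\<close> excludes.\<close>
  define qs where "qs = filter (\<lambda>i. x i \<in> torsion M \<and> x i \<noteq> \<zero>\<^bsub>M\<^esub>) [0..<n]"
  define L where "L = map (\<lambda>i. (PIdl \<pi>, ord_of M (x i))) qs"
  have ps: "i < length ps \<Longrightarrow> ps ! i < n \<and> x (ps ! i) \<notin> torsion M" for i
    using nth_mem[of i ps] by (simp add: ps_def)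
  have qs: "i < length qs \<Longrightarrow> qs ! i < n \<and> x (qs ! i) \<in> torsion M \<and> x (qs ! i) \<noteq> \<zero>\<^bsub>M\<^esub>" for i
    using nth_mem[of i qs] by (simp add: qs_def)
  obtain F z where F: "F \<in> Rmod R" and free: "freely_generates R F z (length ps)"
    using ex_free_Rmod by blast
  have FM: "module R F" using F by (simp add: Rmod_def finitely_presented_def)
  interpret F: Module.module R F by (rule FM)
  have z: "\<And>i. i < length ps \<Longrightarrow> z i \<in> carrier F"
    using free by (simp add: freely_generates_def generates_def)
  define I where "I j = PIdl (\<pi> [^] ord_of M (x (qs ! j)))" for j
  let ?P = "product_module {..<length qs} (\<lambda>j. residue_module R (I j))"
  let ?S = "direct_sum F ?P"
  note [simp] = product_module_simps direct_sum_simps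
  have res: "module R (residue_module R (I j))" for j
    unfolding I_def by (rule residue_module_is_module)
  have PM: "module R ?P" by (rule product_module_is_module[OF cring_axioms res])
  have SM: "module R ?S" by (rule direct_sum_is_module[OF FM PM])
  have reg: "module R (regular_module R)" by (rule regular_module_is_module[OF cring_axioms])
  have sub: "submodule R (I j) (regular_module R)" for j unfolding I_def by (rule submodule_pi_pow)
  let ?cos = "\<lambda>j r. I j +>\<^bsub>regular_module R\<^esub> r"
  have cos_add: "?cos j (r \<oplus> s) = ?cos j r \<oplus>\<^bsub>residue_module R (I j)\<^esub> ?cos j s"
    if "r \<in> carrier R" "s \<in> carrier R" for j r s
    using quot_module_add[OF reg sub, of r s j] that by (simp add: regular_module_def)
  have cos_smult: "?cos j (r \<otimes> s) = r \<odot>\<^bsub>residue_module R (I j)\<^esub> ?cos j s"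
    if "r \<in> carrier R" "s \<in> carrier R" for j r s
    using quot_module_smult[OF reg sub, of s r j] that by (simp add: regular_module_def)
  have cos_zero: "?cos j r = \<zero>\<^bsub>residue_module R (I j)\<^esub> \<longleftrightarrow> r \<in> I j" if "r \<in> carrier R" for j r
    using coset_eq_zero_iff[OF reg sub, of r j] that by (simp add: regular_module_def)
  have cos_carrier: "carrier (residue_module R (I j)) = ?cos j ` carrier R" for j
    by (simp add: carrier_quot_module regular_module_def)
  \<comment> \<open>Coefficients of torsion-free generators are placed on a basis of
    \<open>F\<close>, the others are reduced modulo the annihilators of their generators.\<close>
  define \<psi> where "\<psi> c = (lin_comb F (\<lambda>j. c (ps ! j)) z (length ps),
    \<lambda>j\<in>{..<length qs}. ?cos j (c (qs ! j)))" for c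
  \<comment> \<open>This equivalence is used twice: with independence it makes the map given by
    \<psi> single-valued, and it makes that map injective.\<close>
  have \<psi>_zero: "\<psi> c = \<zero>\<^bsub>?S\<^esub> \<longleftrightarrow> (\<forall>i<n. c i \<odot>\<^bsub>M\<^esub> x i = \<zero>\<^bsub>M\<^esub>)" if c: "\<And>i. i < n \<Longrightarrow> c i \<in> carrier R" for c
  proof
    assume "\<psi> c = \<zero>\<^bsub>?S\<^esub>"
    then have 1: "lin_comb F (\<lambda>j. c (ps ! j)) z (length ps) = \<zero>\<^bsub>F\<^esub>"
      and 2: "(\<lambda>j\<in>{..<length qs}. ?cos j (c (qs ! j))) = (\<lambda>j\<in>{..<length qs}. \<zero>\<^bsub>residue_module R (I j)\<^esub>)"
      by (simp_all add: \<psi>_def)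
    show "\<forall>i<n. c i \<odot>\<^bsub>M\<^esub> x i = \<zero>\<^bsub>M\<^esub>"
    proof (intro allI impI)
      fix i assume i: "i < n"
      consider "i \<in> set ps" | "i \<in> set qs" | "x i = \<zero>\<^bsub>M\<^esub>"
        using i by (auto simp: ps_def qs_def)
      then show "c i \<odot>\<^bsub>M\<^esub> x i = \<zero>\<^bsub>M\<^esub>"
      proof cases
        case 1
        then obtain j where j: "j < length ps" "i = ps ! j" by (metis in_set_conv_nth)
        have "c (ps ! j) = \<zero>"
          using freely_generatesD[OF free _ \<open>lin_comb F _ z _ = _\<close> j(1)] ps c by simp
        then show ?thesis using j x[OF i] by simp
      next
        case 2
        then obtain j where j: "j < length qs" "i = qs ! j" by (metis in_set_conv_nth)
        have "?cos j (c i) = \<zero>\<^bsub>residue_module R (I j)\<^esub>"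
          using fun_cong[OF \<open>(\<lambda>j\<in>_. _) = _\<close>, of j] j by simp
        then have "c i \<in> I j" using cos_zero[OF c[OF i]] by simp
        then obtain r where r: "r \<in> carrier R" "c i = r \<otimes> \<pi> [^] ord_of M (x i)"
          unfolding I_def j(2) cgenideal_def by blast
        have "x i \<in> torsion M" using qs[OF j(1)] j(2) by simp
        then show ?thesis unfolding r(2) using r(1) x[OF i] by (simp add: M.smult_assoc1 ord_of_kills)
      next
        case 3
        then show ?thesis using c[OF i] by simp
      qed
    qed
  next
    assume zero: "\<forall>i<n. c i \<odot>\<^bsub>M\<^esub> x i = \<zero>\<^bsub>M\<^esub>"
    have "c (ps ! j) = \<zero>" if "j < length ps" for j
      using free_coeff[OF M x, of "ps ! j" "c (ps ! j)"] c[of "ps ! j"] ps[OF that] zero by simp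
    then have "lin_comb F (\<lambda>j. c (ps ! j)) z (length ps) = \<zero>\<^bsub>F\<^esub>"
      using z by (intro F.lin_comb_all_zero) simp
    moreover have "?cos j (c (qs ! j)) = \<zero>\<^bsub>residue_module R (I j)\<^esub>" if j: "j < length qs" for j
    proof -
      have q: "qs ! j < n" "x (qs ! j) \<in> torsion M" using qs[OF j] by simp_all
      have "c (qs ! j) \<odot>\<^bsub>M\<^esub> x (qs ! j) = \<zero>\<^bsub>M\<^esub>" using zero q(1) by simp
      from tors_coeff[OF M q(2) c[OF q(1)] this] have "c (qs ! j) \<in> I j"
        unfolding I_def cgenideal_def by blast
      then show ?thesis using cos_zero[OF c[OF q(1)]] by simp
    qed
    ultimately show "\<psi> c = \<zero>\<^bsub>?S\<^esub>" by (simp add: \<psi>_def cong: restrict_cong)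
  qed
  let ?Q = "\<lambda>m s. \<exists>c. (\<forall>i<n. c i \<in> carrier R) \<and> m = lin_comb M c x n \<and> s = \<psi> c"
  have \<psi>_closed: "\<psi> c \<in> carrier ?S" if "\<forall>i<n. c i \<in> carrier R" for c
    using that ps qs z by (simp add: \<psi>_def cos_carrier)
  have "\<exists>f\<in>hom_set R M ?S. \<forall>m s. ?Q m s \<longrightarrow> f m = s"
  proof (rule hom_of_graph[OF M SM])
    fix m s assume "?Q m s"
    then obtain c where "\<forall>i<n. c i \<in> carrier R" "m = lin_comb M c x n" "s = \<psi> c" by blast
    then show "m \<in> carrier M \<and> s \<in> carrier ?S" using x \<psi>_closed[of c] by (simp del: direct_sum_simps)
  next
    fix m assume "m \<in> carrier M"
    then show "\<exists>s. ?Q m s" using gen unfolding generates_def by blast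
  next
    fix m s m' s' assume Q: "?Q m s" "?Q m' s'"
    from Q(1) obtain c where c: "\<forall>i<n. c i \<in> carrier R" "m = lin_comb M c x n" "s = \<psi> c" by blast
    from Q(2) obtain d where d: "\<forall>i<n. d i \<in> carrier R" "m' = lin_comb M d x n" "s' = \<psi> d" by blast
    have "lin_comb F (\<lambda>j. c (ps ! j) \<oplus> d (ps ! j)) z (length ps)
      = lin_comb F (\<lambda>j. c (ps ! j)) z (length ps) \<oplus>\<^bsub>F\<^esub> lin_comb F (\<lambda>j. d (ps ! j)) z (length ps)"
      using c(1) d(1) ps z by (intro F.lin_comb_add) simp_all
    then have "\<psi> (\<lambda>i. c i \<oplus> d i) = \<psi> c \<oplus>\<^bsub>?S\<^esub> \<psi> d"
      using c(1) d(1) qs by (simp add: \<psi>_def cos_add cong: restrict_cong)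
    moreover have "lin_comb M (\<lambda>i. c i \<oplus> d i) x n = m \<oplus>\<^bsub>M\<^esub> m'"
      unfolding c(2) d(2) using c(1) d(1) x by (intro M.lin_comb_add) simp_all
    ultimately show "?Q (m \<oplus>\<^bsub>M\<^esub> m') (s \<oplus>\<^bsub>?S\<^esub> s')"
      unfolding c(3) d(3) using c(1) d(1) by (intro exI[where x = "\<lambda>i. c i \<oplus> d i"]) (simp del: direct_sum_simps)
  next
    fix r m s assume r: "r \<in> carrier R" and Q: "?Q m s"
    from Q obtain c where c: "\<forall>i<n. c i \<in> carrier R" "m = lin_comb M c x n" "s = \<psi> c" by blast
    have "lin_comb F (\<lambda>j. r \<otimes> c (ps ! j)) z (length ps)
      = r \<odot>\<^bsub>F\<^esub> lin_comb F (\<lambda>j. c (ps ! j)) z (length ps)"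
      using c(1) r ps z by (intro F.lin_comb_smult) simp_all
    then have "\<psi> (\<lambda>i. r \<otimes> c i) = r \<odot>\<^bsub>?S\<^esub> \<psi> c"
      using c(1) r qs by (simp add: \<psi>_def cos_smult cong: restrict_cong)
    moreover have "lin_comb M (\<lambda>i. r \<otimes> c i) x n = r \<odot>\<^bsub>M\<^esub> m"
      unfolding c(2) using c(1) r x by (intro M.lin_comb_smult) simp_all
    ultimately show "?Q (r \<odot>\<^bsub>M\<^esub> m) (r \<odot>\<^bsub>?S\<^esub> s)"
      unfolding c(3) using c(1) r by (intro exI[where x = "\<lambda>i. r \<otimes> c i"]) (simp del: direct_sum_simps)
  next
    fix s assume "?Q \<zero>\<^bsub>M\<^esub> s"
    then obtain c where c: "\<forall>i<n. c i \<in> carrier R" "\<zero>\<^bsub>M\<^esub> = lin_comb M c x n" "s = \<psi> c" by blast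
    then have "\<forall>i<n. c i \<odot>\<^bsub>M\<^esub> x i = \<zero>\<^bsub>M\<^esub>" using indep unfolding independent_def by simp
    then show "s = \<zero>\<^bsub>?S\<^esub>" unfolding c(3) using \<psi>_zero c(1) by blast
  qed
  then obtain f where f: "f \<in> hom_set R M ?S" "\<forall>m s. ?Q m s \<longrightarrow> f m = s" ..
  have f_lc: "f (lin_comb M c x n) = \<psi> c" if "\<forall>i<n. c i \<in> carrier R" for c
    using f(2) that by blast
  interpret f: mod_hom R M ?S f by (rule mod_homI[OF M SM hom_setD(1)[OF f(1)]])
  have "inj_on f (carrier M)"
    unfolding f.inj_on_iff_kernel
  proof (intro ballI impI)
    fix m assume m: "m \<in> carrier M" "f m = \<zero>\<^bsub>?S\<^esub>"
    obtain c where c: "\<forall>i<n. c i \<in> carrier R" "m = lin_comb M c x n"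
      using gen m(1) unfolding generates_def by blast
    have "\<psi> c = \<zero>\<^bsub>?S\<^esub>" using f_lc[OF c(1)] m(2) c(2) by metis
    then have "\<forall>i<n. c i \<odot>\<^bsub>M\<^esub> x i = \<zero>\<^bsub>M\<^esub>" using \<psi>_zero c(1) by blast
    then show "m = \<zero>\<^bsub>M\<^esub>" unfolding c(2) by (intro M.lin_comb_all_zero) simp
  qed
  moreover have "carrier ?S \<subseteq> f ` carrier M"
  proof
    fix s assume s: "s \<in> carrier ?S"
    have s1: "fst s \<in> carrier F" and s2: "snd s \<in> carrier ?P"
      using s by (simp_all add: mem_Times_iff)
    have "\<exists>a. (\<forall>j<length ps. a j \<in> carrier R) \<and> fst s = lin_comb F a z (length ps)"
      using free s1 by (simp add: freely_generates_def generates_def)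
    then obtain a where a: "\<And>j. j < length ps \<Longrightarrow> a j \<in> carrier R"
      "fst s = lin_comb F a z (length ps)" by blast
    have "\<exists>r\<in>carrier R. snd s j = ?cos j r" if "j < length qs" for j
    proof -
      have "snd s j \<in> carrier (residue_module R (I j))" using s2 that by (simp add: PiE_iff)
      then show ?thesis unfolding cos_carrier by (elim imageE) blast
    qed
    then obtain b where b: "\<And>j. j < length qs \<Longrightarrow> b j \<in> carrier R"
      "\<And>j. j < length qs \<Longrightarrow> snd s j = ?cos j (b j)" by metis
    \<comment> \<open>The coefficients are reassembled from both lists. No index occurs twice and
      the lists are disjoint, so the position of an index in its list is well defined; discarded
      generators receive the coefficient zero.\<close>
    define c where "c i = (if i \<in> set ps then a (inv_into {..<length ps} ((!) ps) i)
      else if i \<in> set qs then b (inv_into {..<length qs} ((!) qs) i) else \<zero>)" for i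
    have inj: "inj_on ((!) ps) {..<length ps}" "inj_on ((!) qs) {..<length qs}"
      by (auto intro!: inj_on_nth simp: ps_def qs_def)
    have c_ps: "c (ps ! j) = a j" if "j < length ps" for j
      using that inv_into_f_f[OF inj(1)] by (simp add: c_def)
    have c_qs: "c (qs ! j) = b j" if "j < length qs" for j
    proof -
      have "qs ! j \<notin> set ps" using qs[OF that] by (simp add: ps_def)
      then show ?thesis using that inv_into_f_f[OF inj(2)] by (simp add: c_def)
    qed
    have c: "c i \<in> carrier R" for i
    proof -
      have "c i \<in> carrier R" if i: "i \<in> set ps"
      proof -
        obtain j where "j < length ps" "i = ps ! j" using i by (metis in_set_conv_nth)
        then show ?thesis using c_ps a(1) by simp
      qed
      moreover have "c i \<in> carrier R" if i: "i \<in> set qs"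
      proof -
        obtain j where "j < length qs" "i = qs ! j" using i by (metis in_set_conv_nth)
        then show ?thesis using c_qs b(1) by simp
      qed
      ultimately show ?thesis by (cases "i \<in> set ps"; cases "i \<in> set qs") (simp_all add: c_def)
    qed
    have "lin_comb F (\<lambda>j. c (ps ! j)) z (length ps) = fst s"
      unfolding a(2) using c_ps by (intro lin_comb_cong) simp_all
    moreover have "(\<lambda>j\<in>{..<length qs}. ?cos j (c (qs ! j))) = snd s"
    proof (rule extensionalityI[of _ "{..<length qs}"])
      show "snd s \<in> extensional {..<length qs}" using s2 by (simp add: PiE_iff)
    qed (use b c_qs in simp_all)
    ultimately have "\<psi> c = s" unfolding \<psi>_def by simp
    then have "s = f (lin_comb M c x n)" using f_lc c by simp
    moreover have "lin_comb M c x n \<in> carrier M" using c x by simp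
    ultimately show "s \<in> f ` carrier M" by blast
  qed
  moreover have "f ` carrier M \<subseteq> carrier ?S" using f.f_im by blast
  ultimately have "bij_betw f (carrier M) (carrier ?S)"
    unfolding bij_betw_def by (intro conjI subset_antisym)
  then have iso: "mod_iso R M ?S"
    unfolding mod_iso_def by (rule bexI[OF _ hom_setD(1)[OF f(1)]])
  have P_eq: "?P = product_module {..<length L}
      (\<lambda>i. residue_module R (ideal_pow R (fst (L ! i)) (snd (L ! i))))"
    unfolding L_def length_map
    by (rule product_module_cong) (simp add: I_def ideal_pow_cgenideal)
  have "1 \<le> ord_of M (x i)" if "i \<in> set qs" for i
  proof -
    have "x i \<in> torsion M" "x i \<noteq> \<zero>\<^bsub>M\<^esub>" "i < n" using that by (simp_all add: qs_def)
    then show ?thesis using ord_of_kills[of "x i" M] x by (cases "ord_of M (x i)") simp_all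
  qed
  then have "\<forall>(I, l)\<in>set L. maximalideal I R \<and> 1 \<le> l"
    using maximalideal_pi by (auto simp: L_def)
  then have "decomposition R M F L"
    unfolding decomposition_def
    using F freely_generates_projective[OF FM free] iso P_eq by simp
  then show ?thesis by blast
qed

end

section \<open>The homomorphism from \<open>K\<^sub>0\<close>\<close>

text \<open>The additive extension of a weight to formal sums, as it occurs in
  \<open>K0_mult\<close>, with the weight left arbitrary.\<close>

definition frag_sum :: "('m \<Rightarrow> int) \<Rightarrow> ('m \<Rightarrow>\<^sub>0 int) \<Rightarrow> int"
  where "frag_sum w c = (\<Sum>M\<in>Poly_Mapping.keys c. Poly_Mapping.lookup c M * w M)"

lemma frag_sum_superset:
  assumes "finite S" "Poly_Mapping.keys c \<subseteq> S"
  shows "frag_sum w c = (\<Sum>M\<in>S. Poly_Mapping.lookup c M * w M)"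
  unfolding frag_sum_def using assms by (intro sum.mono_neutral_left) (auto simp: in_keys_iff)

lemma frag_sum_add: "frag_sum w (c + d) = frag_sum w c + frag_sum w d"
proof -
  let ?S = "Poly_Mapping.keys c \<union> Poly_Mapping.keys d"
  have "finite ?S" by simp
  moreover have "Poly_Mapping.keys (c + d) \<subseteq> ?S" by (rule keys_add)
  ultimately show ?thesis
    using frag_sum_superset[of ?S "c + d" w] frag_sum_superset[of ?S c w] frag_sum_superset[of ?S d w]
    by (simp add: lookup_add algebra_simps sum.distrib)
qed

lemma frag_sum_uminus: "frag_sum w (- c) = - frag_sum w c"
  by (simp add: frag_sum_def sum_negf)

lemma frag_sum_diff: "frag_sum w (c - d) = frag_sum w c - frag_sum w d"
  using frag_sum_add[of w c "- d"] by (simp add: frag_sum_uminus)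

lemma frag_sum_frag_of: "frag_sum w (frag_of M) = w M"
  by (simp add: frag_sum_def)

lemma frag_sum_generate:
  assumes rel: "T \<subseteq> carrier (free_Abelian_group S)" "\<And>x. x \<in> T \<Longrightarrow> frag_sum w x = 0"
    and x: "x \<in> generate (free_Abelian_group S) T"
  shows "frag_sum w x = 0"
  using x
proof (induction rule: generate.induct)
  case one
  then show ?case by (simp add: frag_sum_def)
next
  case (incl h)
  then show ?case by (rule rel(2))
next
  case (inv h)
  then have "h \<in> carrier (free_Abelian_group S)" using rel(1) by blast
  then have "inv\<^bsub>free_Abelian_group S\<^esub> h = - h" by simp
  then show ?case using rel(2)[OF inv] by (simp add: frag_sum_uminus)
next
  case (eng h1 h2)
  then show ?case by (simp add: frag_sum_add)
qed

lemma K0_relations_subset: "K0_relations R \<subseteq> carrier (free_Abelian_group (Rmod R))"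
proof
  fix x assume "x \<in> K0_relations R"
  then obtain A B C where x: "x = frag_of C - (frag_of A + frag_of B)"
    "A \<in> Rmod R" "B \<in> Rmod R" "C \<in> Rmod R"
    unfolding K0_relations_def by blast
  have "Poly_Mapping.keys x \<subseteq> {C} \<union> ({A} \<union> {B})"
    unfolding x(1) using keys_diff[of "frag_of C" "frag_of A + frag_of B"] keys_add[of "frag_of A" "frag_of B"]
    by (simp add: keys_frag_of) blast
  then show "x \<in> carrier (free_Abelian_group (Rmod R))"
    using x(2-4) by (auto simp: carrier_free_Abelian_group_iff)
qed

lemma K0_kernel_normal: "normal (K0_kernel R) (free_Abelian_group (Rmod R))"
proof -
  interpret F: comm_group "free_Abelian_group (Rmod R)" by (rule abelian_free_Abelian_group)
  have "subgroup (K0_kernel R) (free_Abelian_group (Rmod R))"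
    unfolding K0_kernel_def by (rule F.generate_is_subgroup[OF K0_relations_subset])
  then show ?thesis by (rule F.subgroup_imp_normal)
qed

context dvr
begin

lemma torsion_iff:
  "v \<in> torsion X \<longleftrightarrow> v \<in> carrier X \<and> (\<exists>k::nat. \<pi> [^] k \<odot>\<^bsub>X\<^esub> v = \<zero>\<^bsub>X\<^esub>)"
  unfolding torsion_def tors_def by blast

text \<open>The negated second difference of torsion lengths at \<open>l\<close>, which counts the
  summands with exponent \<open>l\<close>. Being built from lengths, it makes sense on any carrier
  type, in particular for the cokernel. It is used for \<open>1 \<le> l\<close> and finite lengths,
  so \<open>l - 1\<close> and \<open>the_enat\<close> are exact.\<close>

definition mult2 :: "('a, 'm, 'x) module_scheme \<Rightarrow> nat \<Rightarrow> int"
  where "mult2 M l = 2 * int (the_enat (len_tors M l)) - int (the_enat (len_tors M (l - 1)))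
    - int (the_enat (len_tors M (l + 1)))"

lemma Rmod_module: "M \<in> Rmod R \<Longrightarrow> module R M"
  by (simp add: Rmod_def finitely_presented_def)

lemma Rmod_generates: "M \<in> Rmod R \<Longrightarrow> \<exists>n x. generates R M x n"
  using finitely_presented_imp_generates by (auto simp: Rmod_def)

lemma count_list_mult2:
  fixes M :: "('a, 'm) module"
  assumes M: "module R M" and dec: "decomposition R M F L" and l: "1 \<le> l"
  shows "int (count_list L (PIdl \<pi>, l)) = mult2 M l"
  using count_list_eq_sum_min[OF _ l, of L "PIdl \<pi>"] decomposition_modules(1)[OF dec]
  by (simp add: mult2_def len_tors_decomposition[OF M dec])

lemma ex_multiplicities:
  fixes M :: "('a, 'm) module"
  assumes M: "module R M" and gen: "generates R M x n"
  shows "\<exists>L. (\<forall>k. len_tors M k = enat (sum_min L k)) \<and>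
    (\<forall>l\<ge>1. int (count_list L (PIdl \<pi>, l)) = mult2 M l) \<and>
    (\<forall>p\<in>set L. fst p = PIdl \<pi> \<and> 1 \<le> snd p)"
proof -
  obtain F L where dec: "decomposition R M F L" using ex_decomposition[OF M gen] by blast
  show ?thesis
    by (intro exI[where x = L] conjI allI impI decomposition_modules(1)[OF dec]
        len_tors_decomposition[OF M dec] count_list_mult2[OF M dec])
qed

lemma ex_len_tors:
  fixes M :: "('a, 'm) module"
  assumes M: "module R M" and gen: "generates R M x n"
  shows "\<exists>L. \<forall>k. len_tors M k = enat (sum_min L k)"
proof -
  obtain F L where dec: "decomposition R M F L" using ex_decomposition[OF M gen] by blast
  show ?thesis by (intro exI allI) (rule len_tors_decomposition[OF M dec])
qed

lemma module_mult_mult2: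
  assumes M: "M \<in> Rmod R" and l: "1 \<le> l" shows "int (module_mult R M (PIdl \<pi>) l) = mult2 M l"
proof -
  obtain n x where gen: "generates R M x n" using Rmod_generates[OF M] by blast
  obtain F L where dec: "decomposition R M F L"
    using ex_decomposition[OF Rmod_module[OF M] gen] by blast
  show ?thesis
    using module_mult_eq[OF Rmod_module[OF M] dec l] count_list_mult2[OF Rmod_module[OF M] dec l]
    by simp
qed

lemma mult2_iso: "module R M \<Longrightarrow> module R N \<Longrightarrow> mod_iso R M N \<Longrightarrow> mult2 M l = mult2 N l"
  by (simp add: mult2_def len_tors_iso[of M N])

lemma mult2_direct_sum:
  assumes A: "A \<in> Rmod R" and B: "B \<in> Rmod R"
  shows "mult2 (direct_sum A B) l = mult2 A l + mult2 B l"
proof -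
  have fin: "\<exists>a. \<forall>k. len_tors M k = enat (a k)" if M: "M \<in> Rmod R" for M :: "'a umodule"
  proof -
    obtain n x where gen: "generates R M x n" using Rmod_generates[OF M] by blast
    show ?thesis using ex_len_tors[OF Rmod_module[OF M] gen] by metis
  qed
  obtain a b where "\<And>k. len_tors A k = enat (a k)" "\<And>k. len_tors B k = enat (b k)"
    using fin[OF A] fin[OF B] by blast
  then show ?thesis
    by (simp add: mult2_def len_tors_direct_sum[OF Rmod_module[OF A] Rmod_module[OF B]])
qed

text \<open>The weight kills the relations because \<open>mult2\<close> is additive on direct sums,
  hence it kills the subgroup they generate. So it takes a single value on the coset, which is what
  \<open>the_elem\<close> needs.\<close>

lemma K0_mult_coset:
  assumes l: "1 \<le> l" and c: "c \<in> carrier (free_Abelian_group (Rmod R))"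
  shows "K0_mult R (PIdl \<pi>) l (K0_kernel R #>\<^bsub>free_Abelian_group (Rmod R)\<^esub> c)
    = frag_sum (\<lambda>M. int (module_mult R M (PIdl \<pi>) l)) c"
proof -
  let ?w = "\<lambda>M. int (module_mult R M (PIdl \<pi>) l)"
  have ker: "frag_sum ?w h = 0" if "h \<in> K0_kernel R" for h
    using that unfolding K0_kernel_def
  proof (rule frag_sum_generate[OF K0_relations_subset, rotated])
    fix x assume "x \<in> K0_relations R"
    then obtain A B C where x: "x = frag_of C - (frag_of A + frag_of B)"
      and ABC: "A \<in> Rmod R" "B \<in> Rmod R" "C \<in> Rmod R" and iso: "mod_iso R C (direct_sum A B)"
      unfolding K0_relations_def by blast
    have "mult2 C l = mult2 A l + mult2 B l"
      using mult2_iso[OF Rmod_module[OF ABC(3)]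
          direct_sum_is_module[OF Rmod_module[OF ABC(1)] Rmod_module[OF ABC(2)]] iso]
        mult2_direct_sum[OF ABC(1,2)] by simp
    then show "frag_sum ?w x = 0"
      unfolding x frag_sum_diff frag_sum_add frag_sum_frag_of
      using module_mult_mult2[OF _ l] ABC by simp
  qed
  have zero: "0 \<in> K0_kernel R"
    using generate.one[of "free_Abelian_group (Rmod R)" "K0_relations R"] by (simp add: K0_kernel_def)
  have img: "frag_sum ?w ` (K0_kernel R #>\<^bsub>free_Abelian_group (Rmod R)\<^esub> c) = {frag_sum ?w c}"
    using ker zero by (auto simp: r_coset_def frag_sum_add image_iff)
  show ?thesis using img unfolding K0_mult_def frag_sum_def[abs_def] by simp
qed

text \<open>\<open>K0_class\<close> replaces every module by a chosen isomorphic one, even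
  \<open>M\<close> and \<open>N\<close>. As \<open>mult2\<close> is invariant under isomorphism, the
  choices disappear; for the cokernel a representative exists because it is finitely
  generated.\<close>

lemma functor_mult_eq:
  assumes pres: "presentation R G = (M, N, \<alpha>)" and M: "M \<in> Rmod R" and N: "N \<in> Rmod R"
    and C: "module R C" "generates R C x n" and C_def: "C = quot_module N (\<alpha> ` carrier M)"
    and l: "1 \<le> l"
  shows "functor_mult R G (PIdl \<pi>) l = mult2 M l - mult2 N l + mult2 C l"
proof -
  let ?F = "free_Abelian_group (Rmod R)" and ?K = "K0_kernel R"
  interpret F: comm_group ?F by (rule abelian_free_Abelian_group)
  interpret K: normal ?K ?F by (rule K0_kernel_normal)
  define rep where "rep X = (SOME M'. M' \<in> Rmod R \<and> mod_iso R M' X)" for X :: "'a umodule"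
  define C' where "C' = (SOME M'. M' \<in> Rmod R \<and> mod_iso R M' C)"
  have rep: "rep X \<in> Rmod R \<and> mod_iso R (rep X) X" if "X \<in> Rmod R" for X
  proof -
    have "\<exists>M'. M' \<in> Rmod R \<and> mod_iso R M' X" using that mod_iso_refl by (intro exI conjI)
    from someI_ex[OF this] show ?thesis unfolding rep_def .
  qed
  have C': "C' \<in> Rmod R \<and> mod_iso R C' C"
  proof -
    have "\<exists>M'. M' \<in> Rmod R \<and> mod_iso R M' C" using ex_Rmod_iso[OF C] unfolding Bex_def .
    from someI_ex[OF this] show ?thesis unfolding C'_def .
  qed
  have frag: "frag_of X \<in> carrier ?F" if "X \<in> Rmod R" for X
    using that by (simp add: carrier_free_Abelian_group_iff)
  note cl = frag[OF conjunct1[OF rep[OF M]]] frag[OF conjunct1[OF rep[OF N]]] frag[OF conjunct1[OF C']]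
  have inv_cl: "- frag_of (rep N) \<in> carrier ?F" using cl(2) by (simp add: carrier_free_Abelian_group_iff)
  have coset: "?K #>\<^bsub>?F\<^esub> c \<in> carrier (K0 R)" if "c \<in> carrier ?F" for c
    using that F.rcosetsI[OF K.subset] by (simp add: K0_def FactGroup_def)
  have "inv\<^bsub>K0 R\<^esub> (?K #>\<^bsub>?F\<^esub> frag_of (rep N)) = ?K #>\<^bsub>?F\<^esub> (- frag_of (rep N))"
    using K.inv_FactGroup[OF coset[OF cl(2), unfolded K0_def]] K.rcos_inv[OF cl(2)]
      inv_free_Abelian_group[of "frag_of (rep N)" "Rmod R"] cl(2)
    by (simp add: K0_def carrier_free_Abelian_group_iff)
  then have "lmc R G = ?K #>\<^bsub>?F\<^esub> (frag_of (rep M) + - frag_of (rep N) + frag_of C')"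
    unfolding lmc_def pres prod.case K0_class_def rep_def[symmetric] C_def[symmetric] C'_def[symmetric]
    using K.rcos_sum[OF cl(1) inv_cl] K.rcos_sum[OF _ cl(3), of "frag_of (rep M) + - frag_of (rep N)"]
      F.m_closed[OF cl(1) inv_cl]
    by (simp add: K0_def FactGroup_def)
  then have "functor_mult R G (PIdl \<pi>) l
      = frag_sum (\<lambda>M. int (module_mult R M (PIdl \<pi>) l))
          (frag_of (rep M) + - frag_of (rep N) + frag_of C')"
    unfolding functor_mult_def
    using K0_mult_coset[OF l F.m_closed[OF F.m_closed[OF cl(1) inv_cl] cl(3)]] by simp
  also have "\<dots> = mult2 (rep M) l - mult2 (rep N) l + mult2 C' l"
    unfolding frag_sum_add frag_sum_uminus frag_sum_frag_of
    using module_mult_mult2[OF _ l] rep[OF M] rep[OF N] C' by simp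
  also have "mult2 (rep M) l = mult2 M l"
    using rep[OF M] M by (intro mult2_iso) (simp_all add: Rmod_module)
  also have "mult2 (rep N) l = mult2 N l"
    using rep[OF N] N by (intro mult2_iso) (simp_all add: Rmod_module)
  also have "mult2 C' l = mult2 C l"
    using C' C(1) by (intro mult2_iso) (simp_all add: Rmod_module)
  finally show ?thesis .
qed

section \<open>The constant term as an alternating sum of torsion lengths\<close>

definition len_torsion :: "('a, 'm, 'x) module_scheme \<Rightarrow> int"
  where "len_torsion M = int (the_enat (len R M (torsion M)))"

text \<open>The increasing torsion submodules become stationary once \<open>k\<close> reaches all
  exponents of the decomposition, and there the minimum with \<open>k\<close> no longer has any
  effect.\<close>

lemma len_torsion_eq:
  fixes M :: "('a, 'm) module"
  assumes M: "module R M" and L: "\<And>k. len_tors M k = enat (sum_min L k)"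
  shows "len R M (torsion M) = enat (sum_list (map snd L))"
proof -
  \<comment> \<open>The sum of the exponents bounds each of them and is at the same time the length
    to be computed.\<close>
  define K where "K = sum_list (map snd L)"
  have big: "sum_min L k = K" if "K \<le> k" for k
  proof -
    have "snd p \<le> k" if "p \<in> set L" for p
      using member_le_sum_list[of "snd p" "map snd L"] that \<open>K \<le> k\<close> by (simp add: K_def)
    then have "map (\<lambda>p. min k (snd p)) L = map snd L" by (intro map_cong) auto
    then show ?thesis unfolding sum_min_def K_def by (rule arg_cong)
  qed
  \<comment> \<open>A further strict inclusion would increase the length, but from \<open>K\<close>
    on it is constantly the finite number \<open>K\<close>.\<close>
  have "tors M k \<subseteq> tors M K" for k
  proof (rule ccontr)
    assume *: "\<not> tors M k \<subseteq> tors M K"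
    then have "\<not> k \<le> K" using tors_mono[OF M, of k K] by blast
    then have "tors M K \<subset> tors M k" using tors_mono[OF M, of K k] * by auto
    then have "len_tors M K + 1 \<le> len_tors M k"
      unfolding len_tors_def by (intro len_strict submodule_tors M)
    then show False using L big[of K] big[of k] \<open>\<not> k \<le> K\<close> by (simp add: one_enat_def)
  qed
  then have "torsion M = tors M K" unfolding torsion_def by blast
  then show ?thesis using L[of K] big[of K] by (simp add: len_tors_def K_def)
qed

lemma sum_count_list:
  assumes "finite S" "\<And>p. p \<in> set L \<Longrightarrow> fst p = I \<and> snd p \<in> S"
  shows "(\<Sum>l\<in>S. int (count_list L (I, l)) * int l) = int (sum_list (map snd L))"
  using assms(2)
proof (induction L)
  case (Cons p L)
  obtain l' where p: "p = (I, l')" "l' \<in> S" using Cons.prems[of p] by (cases p) simp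
  have "(\<Sum>l\<in>S. int (count_list (p # L) (I, l)) * int l)
      = (\<Sum>l\<in>S. (if l = l' then int l' else 0) + int (count_list L (I, l)) * int l)"
    unfolding p(1) by (intro sum.cong) (auto simp: algebra_simps)
  also have "\<dots> = int l' + (\<Sum>l\<in>S. int (count_list L (I, l)) * int l)"
    using assms(1) p(2) by (simp add: sum.distrib)
  finally show ?case using Cons p by simp
qed simp

text \<open>Summing \<open>l\<close> over all summands with multiplicity gives the length of the
  torsion submodule. This is applied to the three modules that enter \<open>lmc\<close>.\<close>

lemma HilbP_constant:
  assumes pres: "presentation R G = (M, N, \<alpha>)" and M: "M \<in> Rmod R" and N: "N \<in> Rmod R"
    and C: "module R C" "generates R C x n" and C_def: "C = quot_module N (\<alpha> ` carrier M)"
  shows "(\<Sum>l | 1 \<le> l \<and> functor_mult R G (PIdl \<pi>) l \<noteq> 0. functor_mult R G (PIdl \<pi>) l * int l)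
    = len_torsion M - len_torsion N + len_torsion C"
proof -
  obtain m y where M_gen: "generates R M y m" using Rmod_generates[OF M] by blast
  obtain k z where N_gen: "generates R N z k" using Rmod_generates[OF N] by blast
  obtain LM where LM0: "(\<forall>k. len_tors M k = enat (sum_min LM k)) \<and>
      (\<forall>l\<ge>1. int (count_list LM (PIdl \<pi>, l)) = mult2 M l) \<and>
      (\<forall>p\<in>set LM. fst p = PIdl \<pi> \<and> 1 \<le> snd p)"
    using ex_multiplicities[OF Rmod_module[OF M] M_gen] by (rule exE)
  note LM = conjunct1[OF LM0] conjunct1[OF conjunct2[OF LM0]] conjunct2[OF conjunct2[OF LM0]]
  obtain LN where LN0: "(\<forall>k. len_tors N k = enat (sum_min LN k)) \<and>
      (\<forall>l\<ge>1. int (count_list LN (PIdl \<pi>, l)) = mult2 N l) \<and>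
      (\<forall>p\<in>set LN. fst p = PIdl \<pi> \<and> 1 \<le> snd p)"
    using ex_multiplicities[OF Rmod_module[OF N] N_gen] by (rule exE)
  note LN = conjunct1[OF LN0] conjunct1[OF conjunct2[OF LN0]] conjunct2[OF conjunct2[OF LN0]]
  obtain LC where LC0: "(\<forall>k. len_tors C k = enat (sum_min LC k)) \<and>
      (\<forall>l\<ge>1. int (count_list LC (PIdl \<pi>, l)) = mult2 C l) \<and>
      (\<forall>p\<in>set LC. fst p = PIdl \<pi> \<and> 1 \<le> snd p)"
    using ex_multiplicities[OF C] by (rule exE)
  note LC = conjunct1[OF LC0] conjunct1[OF conjunct2[OF LC0]] conjunct2[OF conjunct2[OF LC0]]
  let ?cnt = "\<lambda>L l. int (count_list L (PIdl \<pi>, l))"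
  have fm: "functor_mult R G (PIdl \<pi>) l = ?cnt LM l - ?cnt LN l + ?cnt LC l" if "1 \<le> l" for l
    using functor_mult_eq[OF pres M N C C_def that] LM(2) LN(2) LC(2) that by simp
  \<comment> \<open>A common finite range for the exponents of all three modules. Terms outside it
    vanish, so the sum over nonzero multiplicities may be taken over this set and split into
    three.\<close>
  define S where "S = snd ` set (LM @ LN @ LC)"
  have S: "finite S" "\<And>l. l \<in> S \<Longrightarrow> 1 \<le> l" using LM(3) LN(3) LC(3) by (auto simp: S_def)
  have out: "?cnt L l = 0" if "snd ` set L \<subseteq> S" "l \<notin> S" for L l
  proof -
    have "(PIdl \<pi>, l) \<notin> set L" using that by force
    then show ?thesis by (simp add: count_list_0_iff)
  qed
  have sub: "snd ` set LM \<subseteq> S" "snd ` set LN \<subseteq> S" "snd ` set LC \<subseteq> S"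
    unfolding S_def by auto
  have "(\<Sum>l | 1 \<le> l \<and> functor_mult R G (PIdl \<pi>) l \<noteq> 0. functor_mult R G (PIdl \<pi>) l * int l)
    = (\<Sum>l\<in>S. functor_mult R G (PIdl \<pi>) l * int l)"
  proof (rule sum.mono_neutral_left[OF S(1)])
    show "{l. 1 \<le> l \<and> functor_mult R G (PIdl \<pi>) l \<noteq> 0} \<subseteq> S"
    proof (intro subsetI, rule ccontr)
      fix l assume l: "l \<in> {l. 1 \<le> l \<and> functor_mult R G (PIdl \<pi>) l \<noteq> 0}" "l \<notin> S"
      then show False using fm[of l] out[OF sub(1) l(2)] out[OF sub(2) l(2)] out[OF sub(3) l(2)] by simp
    qed
    show "\<forall>l\<in>S - {l. 1 \<le> l \<and> functor_mult R G (PIdl \<pi>) l \<noteq> 0}.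
        functor_mult R G (PIdl \<pi>) l * int l = 0"
      using S(2) by auto
  qed
  also have "\<dots> = (\<Sum>l\<in>S. ?cnt LM l * int l - ?cnt LN l * int l + ?cnt LC l * int l)"
    by (intro sum.cong refl) (simp only: fm[OF S(2)] left_diff_distrib distrib_right)
  also have "\<dots> = (\<Sum>l\<in>S. ?cnt LM l * int l) - (\<Sum>l\<in>S. ?cnt LN l * int l) + (\<Sum>l\<in>S. ?cnt LC l * int l)"
    by (simp add: sum.distrib sum_subtractf)
  also have "(\<Sum>l\<in>S. ?cnt LM l * int l) = len_torsion M"
    using sum_count_list[OF S(1), of LM "PIdl \<pi>"] LM(3) len_torsion_eq[OF Rmod_module[OF M] spec[OF LM(1)]]
    by (simp add: len_torsion_def S_def)
  also have "(\<Sum>l\<in>S. ?cnt LN l * int l) = len_torsion N"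
    using sum_count_list[OF S(1), of LN "PIdl \<pi>"] LN(3) len_torsion_eq[OF Rmod_module[OF N] spec[OF LN(1)]]
    by (simp add: len_torsion_def S_def)
  also have "(\<Sum>l\<in>S. ?cnt LC l * int l) = len_torsion C"
    using sum_count_list[OF S(1), of LC "PIdl \<pi>"] LC(3) len_torsion_eq[OF C(1) spec[OF LC(1)]]
    by (simp add: len_torsion_def S_def)
  finally show ?thesis .
qed

lemma len_torsion_finite:
  fixes M :: "('a, 'm) module"
  assumes M: "module R M" and gen: "generates R M x n"
  shows "\<exists>a. len R M (torsion M) = enat a"
proof -
  obtain L where "\<And>k. len_tors M k = enat (sum_min L k)" using ex_len_tors[OF M gen] by blast
  from len_torsion_eq[OF M this] show ?thesis by (rule exI)
qed

text \<open>The image of \<open>torsion M\<close> under \<alpha> is also the kernel of the map from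
  \<open>torsion N\<close> to \<open>C\<close>. Its length therefore cancels, leaving the length of
  the kernel of \<alpha> plus the amount by which \<open>torsion C\<close> exceeds the image of
  \<open>torsion N\<close>.\<close>

lemma len_torsion_zero_iff:
  fixes M :: "('a, 'm) module"
  assumes M: "module R M" "generates R M x m" and N: "module R N" "generates R N y n"
    and \<alpha>: "\<alpha> \<in> module_hom R M N" and C_def: "C = quot_module N (\<alpha> ` carrier M)"
    and ker: "{x \<in> carrier M. \<alpha> x = \<zero>\<^bsub>N\<^esub>} \<subseteq> torsion M"
  shows "len_torsion M - len_torsion N + len_torsion C = 0 \<longleftrightarrow>
    inj_on \<alpha> (carrier M) \<and> torsion C = (\<lambda>x. \<alpha> ` carrier M +>\<^bsub>N\<^esub> x) ` torsion N"
proof -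
  let ?B = "\<alpha> ` carrier M"
  let ?g = "\<lambda>x. ?B +>\<^bsub>N\<^esub> x"
  interpret \<alpha>: mod_hom R M N \<alpha> by (rule mod_homI[OF M(1) N(1) \<alpha>])
  have B: "submodule R ?B N" by (rule \<alpha>.image_submodule[OF \<alpha>.M.submodule_carrier])
  have C: "module R C" unfolding C_def by (rule quot_module_is_module[OF N(1) B])
  have g: "?g \<in> module_hom R N C" unfolding C_def by (rule coset_hom[OF N(1) B])
  interpret g: mod_hom R N C ?g by (rule mod_homI[OF N(1) C g])
  have C_gen: "generates R C (\<lambda>i. ?g (y i)) n"
    by (rule g.generates_image[OF N(2)]) (simp add: C_def carrier_quot_module)
  obtain a where a: "len R M (torsion M) = enat a" using len_torsion_finite[OF M] by blast
  obtain b where b: "len R N (torsion N) = enat b" using len_torsion_finite[OF N] by blast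
  obtain c where c: "len R C (torsion C) = enat c" using len_torsion_finite[OF C C_gen] by blast
  note tM = submodule_torsion[OF M(1)] and tN = submodule_torsion[OF N(1)]
    and tC = submodule_torsion[OF C]
  have ker_eq: "{x \<in> torsion M. \<alpha> x = \<zero>\<^bsub>N\<^esub>} = {x \<in> carrier M. \<alpha> x = \<zero>\<^bsub>N\<^esub>}"
    using ker LinearCombinations.submodule.subset[OF tM] by blast
  have ker_sub: "submodule R {x \<in> carrier M. \<alpha> x = \<zero>\<^bsub>N\<^esub>} M"
    using \<alpha>.ker_is_submodule by (simp add: \<alpha>.ker_def)
  \<comment> \<open>The assumption on the kernel enters here: if \<open>\<alpha> w\<close> is
    torsion, some multiple of \<open>w\<close> by a power of \<pi> lies in the kernel, hence is
    torsion, and so \<open>w\<close> is torsion.\<close>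
  have B_tors: "{x \<in> torsion N. ?g x = \<zero>\<^bsub>C\<^esub>} = \<alpha> ` torsion M"
  proof (intro equalityI subsetI)
    fix v assume v: "v \<in> {x \<in> torsion N. ?g x = \<zero>\<^bsub>C\<^esub>}"
    then have "v \<in> torsion N" by simp
    then obtain k :: nat where k: "v \<in> carrier N" "\<pi> [^] k \<odot>\<^bsub>N\<^esub> v = \<zero>\<^bsub>N\<^esub>"
      unfolding torsion_iff by blast
    have "v \<in> ?B" using v coset_eq_zero_iff[OF N(1) B k(1)] by (simp add: C_def)
    then obtain w where w: "w \<in> carrier M" "v = \<alpha> w" by blast
    have "\<alpha> (\<pi> [^] k \<odot>\<^bsub>M\<^esub> w) = \<zero>\<^bsub>N\<^esub>" using k w by simp
    then have "\<pi> [^] k \<odot>\<^bsub>M\<^esub> w \<in> torsion M"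
      using subsetD[OF ker, of "\<pi> [^] k \<odot>\<^bsub>M\<^esub> w"] w(1) by simp
    then obtain j :: nat where "\<pi> [^] j \<odot>\<^bsub>M\<^esub> (\<pi> [^] k \<odot>\<^bsub>M\<^esub> w) = \<zero>\<^bsub>M\<^esub>"
      unfolding torsion_iff by blast
    then have "\<pi> [^] (j + k) \<odot>\<^bsub>M\<^esub> w = \<zero>\<^bsub>M\<^esub>" using smult_pow_add[OF M(1) w(1)] by simp
    then have "w \<in> torsion M" unfolding torsion_iff using w(1) by (intro conjI exI)
    then show "v \<in> \<alpha> ` torsion M" using w(2) by blast
  next
    fix v assume "v \<in> \<alpha> ` torsion M"
    then obtain w where "w \<in> torsion M" and w3: "v = \<alpha> w" by blast
    then obtain k :: nat where w: "w \<in> carrier M" "\<pi> [^] k \<odot>\<^bsub>M\<^esub> w = \<zero>\<^bsub>M\<^esub>" "v = \<alpha> w"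
      unfolding torsion_iff by blast
    have "\<pi> [^] k \<odot>\<^bsub>N\<^esub> \<alpha> w = \<alpha> (\<pi> [^] k \<odot>\<^bsub>M\<^esub> w)" using w(1) by (simp only: \<alpha>.f_smult pi_pow_closed)
    then have "\<pi> [^] k \<odot>\<^bsub>N\<^esub> v = \<zero>\<^bsub>N\<^esub>" unfolding w(2,3) by simp
    then have "v \<in> torsion N" unfolding torsion_iff using \<alpha>.f_im[OF w(1)] w(3) by blast
    moreover have "?g v = \<zero>\<^bsub>C\<^esub>"
      using w coset_eq_zero_iff[OF N(1) B \<alpha>.f_im[OF w(1)]] by (simp add: C_def)
    ultimately show "v \<in> {x \<in> torsion N. ?g x = \<zero>\<^bsub>C\<^esub>}" by simp
  qed
  have 1: "enat a = len R M {x \<in> carrier M. \<alpha> x = \<zero>\<^bsub>N\<^esub>} + len R N (\<alpha> ` torsion M)"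
    using \<alpha>.len_ker_im[OF tM] unfolding ker_eq a .
  have 2: "enat b = len R N (\<alpha> ` torsion M) + len R C (?g ` torsion N)"
    using g.len_ker_im[OF tN] unfolding B_tors b .
  obtain d where d: "len R M {x \<in> carrier M. \<alpha> x = \<zero>\<^bsub>N\<^esub>} = enat d"
    using 1 by (cases "len R M {x \<in> carrier M. \<alpha> x = \<zero>\<^bsub>N\<^esub>}") simp_all
  obtain e where e: "len R N (\<alpha> ` torsion M) = enat e" using 2 by (cases "len R N (\<alpha> ` torsion M)") simp_all
  obtain f where f: "len R C (?g ` torsion N) = enat f" using 2 by (cases "len R C (?g ` torsion N)") simp_all
  \<comment> \<open>\<open>d\<close> belongs to the kernel, \<open>e\<close> to the image of
    \<open>torsion M\<close>, and \<open>f\<close> to the image of \<open>torsion N\<close> in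
    \<open>C\<close>. Thus \<open>a - b + c = d + (c - f)\<close>, and both summands are
    non-negative since \<open>f \<le> c\<close>.\<close>
  have sum: "a = d + e" "b = e + f" using 1 2 unfolding d e f by simp_all
  have sub: "?g ` torsion N \<subseteq> torsion C"
  proof
    fix v assume "v \<in> ?g ` torsion N"
    then obtain w where "w \<in> torsion N" and w3: "v = ?g w" by blast
    then obtain k :: nat where w: "w \<in> carrier N" "\<pi> [^] k \<odot>\<^bsub>N\<^esub> w = \<zero>\<^bsub>N\<^esub>" "v = ?g w"
      unfolding torsion_iff by blast
    have "\<pi> [^] k \<odot>\<^bsub>C\<^esub> ?g w = ?g (\<pi> [^] k \<odot>\<^bsub>N\<^esub> w)" using w(1) by (simp only: g.f_smult pi_pow_closed)
    then have "\<pi> [^] k \<odot>\<^bsub>C\<^esub> v = \<zero>\<^bsub>C\<^esub>" unfolding w(2,3) using g.f0_is_0 by simp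
    then show "v \<in> torsion C" unfolding torsion_iff using g.f_im[OF w(1)] w(3) by blast
  qed
  have gtN: "submodule R (?g ` torsion N) C" by (rule g.image_submodule[OF tN])
  have "f \<le> c" using len_mono[OF sub tC] c f by simp
  have eq_iff: "f = c \<longleftrightarrow> torsion C = ?g ` torsion N"
  proof
    assume "f = c"
    show "torsion C = ?g ` torsion N"
    proof (rule ccontr)
      assume "torsion C \<noteq> ?g ` torsion N"
      then have "?g ` torsion N \<subset> torsion C" using sub by blast
      from len_strict[OF this gtN tC] show False using c f \<open>f = c\<close> by (simp add: one_enat_def)
    qed
  qed (use c f in simp)
  have "d = 0 \<longleftrightarrow> inj_on \<alpha> (carrier M)"
  proof -
    have "d = 0 \<longleftrightarrow> {x \<in> carrier M. \<alpha> x = \<zero>\<^bsub>N\<^esub>} = {\<zero>\<^bsub>M\<^esub>}"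
      using \<alpha>.M.len_eq_0_iff[OF ker_sub] d by (simp add: zero_enat_def)
    also have "\<dots> \<longleftrightarrow> inj_on \<alpha> (carrier M)"
      unfolding \<alpha>.inj_on_iff_kernel using \<alpha>.f0_is_0 \<alpha>.M.M.zero_closed by blast
    finally show ?thesis .
  qed
  moreover have "len_torsion M - len_torsion N + len_torsion C = int d - int f + int c"
    unfolding len_torsion_def a b c sum by simp
  ultimately show ?thesis using eq_iff \<open>f \<le> c\<close> by auto
qed

end

section \<open>Evaluation of functors\<close>

lemma hom_module_simps:
  "carrier (hom_module R act M X) = hom_set R M X"
  "\<zero>\<^bsub>hom_module R act M X\<^esub> = (\<lambda>m\<in>carrier M. \<zero>\<^bsub>X\<^esub>)"
  "f \<oplus>\<^bsub>hom_module R act M X\<^esub> g = (\<lambda>m\<in>carrier M. f m \<oplus>\<^bsub>X\<^esub> g m)"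
  "s \<odot>\<^bsub>hom_module R act M X\<^esub> f = (\<lambda>m\<in>carrier M. act s (f m))"
  by (simp_all add: hom_module_def)

lemma hom_set_eqI:
  assumes "f \<in> hom_set R M X" "g \<in> hom_set R M X" "\<And>m. m \<in> carrier M \<Longrightarrow> f m = g m"
  shows "f = g"
  using extensionalityI[OF hom_setD(2)[OF assms(1)] hom_setD(2)[OF assms(2)] assms(3)] .

text \<open>The scalars \<open>S\<close> act on \<open>X\<close> through \<open>Y\<close>, a second module structure commuting with the first.\<close>

locale scalar_action = M?: Module.module R M + X: Module.module R X + Y: Module.module S Y
  for R :: "('r, 'e) ring_scheme" and M :: "('r, 'm) module" and X :: "('r, 'x) module"
    and S :: "('s, 'f) ring_scheme" and Y :: "('s, 'x) module" +
  assumes carrier_eq: "carrier Y = carrier X" and add_eq: "add Y = add X" and zero_eq: "\<zero>\<^bsub>Y\<^esub> = \<zero>\<^bsub>X\<^esub>"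
    and commute: "r \<in> carrier R \<Longrightarrow> s \<in> carrier S \<Longrightarrow> x \<in> carrier X \<Longrightarrow>
      r \<odot>\<^bsub>X\<^esub> (s \<odot>\<^bsub>Y\<^esub> x) = s \<odot>\<^bsub>Y\<^esub> (r \<odot>\<^bsub>X\<^esub> x)"
begin

abbreviation "H \<equiv> hom_module R (smult Y) M X"

lemma Y_facts:
  "s \<in> carrier S \<Longrightarrow> x \<in> carrier X \<Longrightarrow> s \<odot>\<^bsub>Y\<^esub> x \<in> carrier X"
  "s \<in> carrier S \<Longrightarrow> x \<in> carrier X \<Longrightarrow> y \<in> carrier X \<Longrightarrow>
    s \<odot>\<^bsub>Y\<^esub> (x \<oplus>\<^bsub>X\<^esub> y) = s \<odot>\<^bsub>Y\<^esub> x \<oplus>\<^bsub>X\<^esub> s \<odot>\<^bsub>Y\<^esub> y"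
  "s \<in> carrier S \<Longrightarrow> t \<in> carrier S \<Longrightarrow> x \<in> carrier X \<Longrightarrow>
    (s \<oplus>\<^bsub>S\<^esub> t) \<odot>\<^bsub>Y\<^esub> x = s \<odot>\<^bsub>Y\<^esub> x \<oplus>\<^bsub>X\<^esub> t \<odot>\<^bsub>Y\<^esub> x"
  "s \<in> carrier S \<Longrightarrow> t \<in> carrier S \<Longrightarrow> x \<in> carrier X \<Longrightarrow>
    (s \<otimes>\<^bsub>S\<^esub> t) \<odot>\<^bsub>Y\<^esub> x = s \<odot>\<^bsub>Y\<^esub> (t \<odot>\<^bsub>Y\<^esub> x)"
  "x \<in> carrier X \<Longrightarrow> \<one>\<^bsub>S\<^esub> \<odot>\<^bsub>Y\<^esub> x = x"
  using Y.smult_closed Y.smult_r_distr Y.smult_l_distr Y.smult_assoc1 Y.smult_one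
  by (simp_all add: carrier_eq add_eq)

lemma hom_add:
  "f \<in> hom_set R M X \<Longrightarrow> g \<in> hom_set R M X \<Longrightarrow> f \<oplus>\<^bsub>H\<^esub> g \<in> hom_set R M X"
  unfolding hom_module_simps
  by (rule restrict_hom_set[OF M.module_axioms], rule module_homI)
    (simp_all add: hom_set_closed module_hom_add[OF hom_setD(1)] module_hom_smult[OF hom_setD(1)]
      X.smult_r_distr X.M.a_ac)

lemma hom_smult:
  "s \<in> carrier S \<Longrightarrow> f \<in> hom_set R M X \<Longrightarrow> s \<odot>\<^bsub>H\<^esub> f \<in> hom_set R M X"
  unfolding hom_module_simps
  by (rule restrict_hom_set[OF M.module_axioms], rule module_homI)
    (simp_all add: hom_set_closed module_hom_add[OF hom_setD(1)] module_hom_smult[OF hom_setD(1)]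
      Y_facts commute)

lemma hom_zero: "\<zero>\<^bsub>H\<^esub> \<in> hom_set R M X"
  unfolding hom_module_simps by (rule restrict_hom_set[OF M.module_axioms], rule module_homI) simp_all

lemma hom_neg: assumes "f \<in> hom_set R M X" shows "f \<oplus>\<^bsub>H\<^esub> (\<lambda>m\<in>carrier M. \<ominus>\<^bsub>X\<^esub> f m) = \<zero>\<^bsub>H\<^esub>"
  unfolding hom_module_simps using assms by (intro restrict_ext) (simp add: hom_set_closed X.M.r_neg)

lemma hom_uminus: assumes "f \<in> hom_set R M X" shows "(\<lambda>m\<in>carrier M. \<ominus>\<^bsub>X\<^esub> f m) \<in> hom_set R M X"
  using assms
  by (intro restrict_hom_set[OF M.module_axioms] module_homI)
    (simp_all add: hom_set_closed module_hom_add[OF hom_setD(1)] module_hom_smult[OF hom_setD(1)]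
      X.smult_r_minus X.M.minus_add)

lemma hom_module_is_module: "module S H"
proof (rule module_criteria, unfold hom_module_simps(1), goal_cases)
  case 1 show ?case by (rule Y.R.cring_axioms)
next
  case 2 show ?case by (rule hom_zero)
next
  case 3 show ?case using hom_add by simp
next
  case 4
  show ?case
  proof
    fix f assume "f \<in> hom_set R M X"
    from hom_neg[OF this] hom_uminus[OF this] show "\<exists>g\<in>hom_set R M X. f \<oplus>\<^bsub>H\<^esub> g = \<zero>\<^bsub>H\<^esub>" by (rule bexI)
  qed
next
  case 5 show ?case using hom_smult by simp
next
  case 6
  show ?case unfolding hom_module_simps
    by (intro allI impI restrict_ext X.M.a_comm) (simp_all add: hom_set_closed[of _ R M X])
next
  case 7
  show ?case unfolding hom_module_simps
    by (intro allI impI restrict_ext) (simp add: hom_set_closed[of _ R M X] X.M.a_assoc)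
next
  case 8
  show ?case
  proof
    fix f assume f: "f \<in> hom_set R M X"
    show "f \<oplus>\<^bsub>H\<^esub> \<zero>\<^bsub>H\<^esub> = f"
      by (rule hom_set_eqI[OF hom_add[OF f hom_zero] f])
        (simp add: hom_module_simps hom_set_closed[OF f])
  qed
next
  case 9
  show ?case unfolding hom_module_simps
    by (intro allI impI restrict_ext) (simp add: hom_set_closed[of _ R M X] Y_facts)
next
  case 10
  show ?case
  proof
    fix f assume f: "f \<in> hom_set R M X"
    show "\<one>\<^bsub>S\<^esub> \<odot>\<^bsub>H\<^esub> f = f"
      by (rule hom_set_eqI[OF hom_smult[OF Y.R.one_closed f] f])
        (simp add: hom_module_simps hom_set_closed[OF f] Y_facts)
  qed
next
  case 11
  show ?case unfolding hom_module_simps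
    by (intro allI impI restrict_ext) (simp add: hom_set_closed[of _ R M X] Y_facts)
next
  case 12
  show ?case unfolding hom_module_simps
    by (intro allI impI restrict_ext) (simp add: hom_set_closed[of _ R M X] Y_facts)
qed

end

text \<open>This says that Hom(N, X) -> Hom(M, X) is onto, i.e. that the functor presented by
  \<alpha> vanishes at \<open>X\<close>. Equality is required on the carrier only, so extensionality
  does not intrude.\<close>

definition factors ::
  "('r, 'e) ring_scheme \<Rightarrow> ('r, 'm) module \<Rightarrow> ('r, 'n) module \<Rightarrow> ('m \<Rightarrow> 'n) \<Rightarrow> ('r, 'x) module \<Rightarrow> bool"
  where "factors R M N \<alpha> X \<longleftrightarrow>
    (\<forall>h\<in>hom_set R M X. \<exists>h'\<in>hom_set R N X. \<forall>m\<in>carrier M. h' (\<alpha> m) = h m)"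

lemma compose_eq_iff:
  assumes "h \<in> hom_set R M X"
  shows "compose (carrier M) h' \<alpha> = h \<longleftrightarrow> (\<forall>m\<in>carrier M. h' (\<alpha> m) = h m)"
proof
  assume "compose (carrier M) h' \<alpha> = h"
  then show "\<forall>m\<in>carrier M. h' (\<alpha> m) = h m" by (auto simp: compose_def)
next
  assume *: "\<forall>m\<in>carrier M. h' (\<alpha> m) = h m"
  show "compose (carrier M) h' \<alpha> = h"
    by (rule extensionalityI[OF _ hom_setD(2)[OF assms]]) (use * in \<open>simp_all add: compose_def\<close>)
qed

lemma factors_iff: "factors R M N \<alpha> X \<longleftrightarrow> hom_set R M X \<subseteq> precomp_image R M N \<alpha> X"
proof -
  have "h \<in> precomp_image R M N \<alpha> X \<longleftrightarrow> (\<exists>h'\<in>hom_set R N X. \<forall>m\<in>carrier M. h' (\<alpha> m) = h m)"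
    if "h \<in> hom_set R M X" for h
    unfolding precomp_image_def image_iff compose_eq_iff[OF that, symmetric] by (simp add: eq_commute)
  then show ?thesis unfolding factors_def by blast
qed

lemma submodule_precomp_image:
  assumes sM: "scalar_action R M X S Y" and N: "module R N" and \<alpha>: "\<alpha> \<in> hom_set R M N"
  shows "submodule S (precomp_image R M N \<alpha> X) (hom_module R (smult Y) M X)"
proof -
  interpret M: scalar_action R M X S Y by (rule sM)
  have sN: "scalar_action R N X S Y"
    using sM N by (simp add: scalar_action_def)
  interpret N: scalar_action R N X S Y by (rule sN)
  interpret H: Module.module S M.H by (rule M.hom_module_is_module)
  have mem: "h \<in> precomp_image R M N \<alpha> X \<longleftrightarrow> h \<in> hom_set R M X \<and>
      (\<exists>h'\<in>hom_set R N X. \<forall>m\<in>carrier M. h' (\<alpha> m) = h m)" for h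
  proof -
    have "h \<in> hom_set R M X" if "h \<in> precomp_image R M N \<alpha> X"
      using that compose_hom_set[OF M.M.module_axioms \<alpha>] unfolding precomp_image_def by blast
    moreover have "h \<in> precomp_image R M N \<alpha> X \<longleftrightarrow> (\<exists>h'\<in>hom_set R N X. \<forall>m\<in>carrier M. h' (\<alpha> m) = h m)"
      if "h \<in> hom_set R M X"
      unfolding precomp_image_def image_iff compose_eq_iff[OF that, symmetric] by (simp add: eq_commute)
    ultimately show ?thesis by blast
  qed
  have \<alpha>c: "\<alpha> m \<in> carrier N" if "m \<in> carrier M" for m by (rule hom_set_closed[OF \<alpha> that])
  show ?thesis
  proof (rule H.submoduleI')
    show "precomp_image R M N \<alpha> X \<subseteq> carrier M.H" unfolding hom_module_simps using mem by blast
    show "\<zero>\<^bsub>M.H\<^esub> \<in> precomp_image R M N \<alpha> X"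
      unfolding mem using M.hom_zero N.hom_zero \<alpha>c
      by (intro conjI bexI[where x = "\<zero>\<^bsub>N.H\<^esub>"]) (simp_all add: hom_module_simps)
  next
    fix v w assume "v \<in> precomp_image R M N \<alpha> X" "w \<in> precomp_image R M N \<alpha> X"
    then obtain v' w' where v: "v \<in> hom_set R M X" "v' \<in> hom_set R N X" "\<forall>m\<in>carrier M. v' (\<alpha> m) = v m"
      and w: "w \<in> hom_set R M X" "w' \<in> hom_set R N X" "\<forall>m\<in>carrier M. w' (\<alpha> m) = w m"
      unfolding mem by blast
    show "v \<oplus>\<^bsub>M.H\<^esub> w \<in> precomp_image R M N \<alpha> X"
      unfolding mem using M.hom_add[OF v(1) w(1)] N.hom_add[OF v(2) w(2)] v(3) w(3) \<alpha>c
      by (intro conjI bexI[where x = "v' \<oplus>\<^bsub>N.H\<^esub> w'"]) (simp_all add: hom_module_simps)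
  next
    fix s v assume s: "s \<in> carrier S" and "v \<in> precomp_image R M N \<alpha> X"
    then obtain v' where v: "v \<in> hom_set R M X" "v' \<in> hom_set R N X" "\<forall>m\<in>carrier M. v' (\<alpha> m) = v m"
      unfolding mem by blast
    show "s \<odot>\<^bsub>M.H\<^esub> v \<in> precomp_image R M N \<alpha> X"
      unfolding mem using M.hom_smult[OF s v(1)] N.hom_smult[OF s v(2)] v(3) \<alpha>c
      by (intro conjI bexI[where x = "s \<odot>\<^bsub>N.H\<^esub> v'"]) (simp_all add: hom_module_simps)
  qed
qed

lemma quot_hom_carrier:
  assumes sM: "scalar_action R M X S Y" and N: "module R N" and \<alpha>: "\<alpha> \<in> hom_set R M N"
  defines "V \<equiv> quot_module (hom_module R (smult Y) M X) (precomp_image R M N \<alpha> X)"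
  shows "carrier V = {\<zero>\<^bsub>V\<^esub>} \<longleftrightarrow> factors R M N \<alpha> X"
proof -
  interpret M: scalar_action R M X S Y by (rule sM)
  note H = M.hom_module_is_module and K = submodule_precomp_image[OF sM N \<alpha>]
  have V: "module S V" unfolding V_def by (rule quot_module_is_module[OF H K])
  interpret V: Module.module S V by (rule V)
  have "carrier V = {\<zero>\<^bsub>V\<^esub>} \<longleftrightarrow> carrier V \<subseteq> {\<zero>\<^bsub>V\<^esub>}" using V.M.zero_closed by blast
  also have "\<dots> \<longleftrightarrow> (\<forall>h\<in>hom_set R M X. h \<in> precomp_image R M N \<alpha> X)"
    unfolding V_def carrier_quot_module image_subset_iff singleton_iff hom_module_simps(1)
    using coset_eq_zero_iff[OF H K] by (simp add: hom_module_simps(1))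
  finally show ?thesis unfolding factors_iff by blast
qed

text \<open>Homomorphisms into a direct sum are pairs of homomorphisms. To descend to one summand,
  the given map is padded with zero in the other.\<close>

lemma factors_direct_sum:
  assumes M: "module R M" and N: "module R N" and \<alpha>: "\<alpha> \<in> hom_set R M N"
    and A: "module R A" and B: "module R B"
  shows "factors R M N \<alpha> (direct_sum A B) \<longleftrightarrow> factors R M N \<alpha> A \<and> factors R M N \<alpha> B"
proof (intro iffI conjI)
  interpret A: Module.module R A by (rule A)
  interpret B: Module.module R B by (rule B)
  have \<alpha>c: "\<alpha> m \<in> carrier N" if "m \<in> carrier M" for m by (rule hom_set_closed[OF \<alpha> that])
  have pair: "(\<lambda>m\<in>carrier Z. (f m, g m)) \<in> hom_set R Z (direct_sum A B)"
    if "module R Z" "f \<in> module_hom R Z A" "g \<in> module_hom R Z B" for f g and Z :: "('a, 'z) module"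
    using that(2,3)
    by (intro restrict_hom_set[OF that(1)] module_homI)
      (simp_all add: direct_sum_simps module_hom_add module_hom_smult
        funcset_mem[OF module_hom_closed])
  have zero: "(\<lambda>_. \<zero>\<^bsub>A\<^esub>) \<in> module_hom R M A" "(\<lambda>_. \<zero>\<^bsub>B\<^esub>) \<in> module_hom R M B"
    by (rule module_homI; simp)+
  have fst: "fst \<in> module_hom R (direct_sum A B) A" and snd: "snd \<in> module_hom R (direct_sum A B) B"
    by (rule module_homI; simp add: direct_sum_simps mem_Times_iff)+
  {
    assume *: "factors R M N \<alpha> (direct_sum A B)"
    show "factors R M N \<alpha> A"
      unfolding factors_def
    proof
      fix h assume h: "h \<in> hom_set R M A"
      obtain h' where h': "h' \<in> hom_set R N (direct_sum A B)"
        "\<forall>m\<in>carrier M. h' (\<alpha> m) = (\<lambda>m\<in>carrier M. (h m, \<zero>\<^bsub>B\<^esub>)) m"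
        using bspec[OF *[unfolded factors_def] pair[OF M hom_setD(1)[OF h] zero(2)]] by (rule bexE)
      show "\<exists>h'\<in>hom_set R N A. \<forall>m\<in>carrier M. h' (\<alpha> m) = h m"
        using h'(2) \<alpha>c
        by (intro bexI[OF _ restrict_hom_set[OF N module_hom_compose[OF hom_setD(1)[OF h'(1)] fst]]]) simp
    qed
    show "factors R M N \<alpha> B"
      unfolding factors_def
    proof
      fix h assume h: "h \<in> hom_set R M B"
      obtain h' where h': "h' \<in> hom_set R N (direct_sum A B)"
        "\<forall>m\<in>carrier M. h' (\<alpha> m) = (\<lambda>m\<in>carrier M. (\<zero>\<^bsub>A\<^esub>, h m)) m"
        using bspec[OF *[unfolded factors_def] pair[OF M zero(1) hom_setD(1)[OF h]]] by (rule bexE)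
      show "\<exists>h'\<in>hom_set R N B. \<forall>m\<in>carrier M. h' (\<alpha> m) = h m"
        using h'(2) \<alpha>c
        by (intro bexI[OF _ restrict_hom_set[OF N module_hom_compose[OF hom_setD(1)[OF h'(1)] snd]]]) simp
    qed
  next
    assume *: "factors R M N \<alpha> A \<and> factors R M N \<alpha> B"
    show "factors R M N \<alpha> (direct_sum A B)"
      unfolding factors_def
    proof
      fix h assume h: "h \<in> hom_set R M (direct_sum A B)"
      have 1: "(\<lambda>m\<in>carrier M. fst (h m)) \<in> hom_set R M A" and 2: "(\<lambda>m\<in>carrier M. snd (h m)) \<in> hom_set R M B"
        by (rule restrict_hom_set[OF M module_hom_compose[OF hom_setD(1)[OF h] fst]],
            rule restrict_hom_set[OF M module_hom_compose[OF hom_setD(1)[OF h] snd]])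
      obtain f where f: "f \<in> hom_set R N A" "\<forall>m\<in>carrier M. f (\<alpha> m) = (\<lambda>m\<in>carrier M. fst (h m)) m"
        using bspec[OF conjunct1[OF *, unfolded factors_def] 1] by (rule bexE)
      obtain g where g: "g \<in> hom_set R N B" "\<forall>m\<in>carrier M. g (\<alpha> m) = (\<lambda>m\<in>carrier M. snd (h m)) m"
        using bspec[OF conjunct2[OF *, unfolded factors_def] 2] by (rule bexE)
      show "\<exists>h'\<in>hom_set R N (direct_sum A B). \<forall>m\<in>carrier M. h' (\<alpha> m) = h m"
        using f(2) g(2) \<alpha>c
        by (intro bexI[OF _ pair[OF N hom_setD(1)[OF f(1)] hom_setD(1)[OF g(1)]]]) simp
    qed
  }
qed

section \<open>The quotient field\<close>

context domain
begin

lemma fraction_eq_iff: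
  assumes "a \<in> carrier R" "b \<in> carrier R - {\<zero>}" "c \<in> carrier R" "d \<in> carrier R - {\<zero>}"
  shows "fraction R a b = fraction R c d \<longleftrightarrow> a \<otimes> d = c \<otimes> b"
proof
  assume "fraction R a b = fraction R c d"
  moreover have "(c, d) \<in> fraction R c d" using assms by (simp add: fraction_def)
  ultimately have "(c, d) \<in> fraction R a b" by simp
  then show "a \<otimes> d = c \<otimes> b" by (simp add: fraction_def)
next
  assume eq: "a \<otimes> d = c \<otimes> b"
  have "a \<otimes> f = e \<otimes> b \<longleftrightarrow> c \<otimes> f = e \<otimes> d" if ef: "e \<in> carrier R" "f \<in> carrier R" for e f
  proof -
    \<comment> \<open>Transitivity of cross multiplication: both sides are multiplied by
      \<open>d\<close>, the assumed equation is inserted, and the common factor \<open>b\<close> is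
      cancelled. Both are nonzero and the ring is a domain.\<close>
    have "a \<otimes> f = e \<otimes> b \<longleftrightarrow> (a \<otimes> f) \<otimes> d = (e \<otimes> b) \<otimes> d"
      using assms ef by (simp add: m_rcancel)
    also have "(a \<otimes> f) \<otimes> d = (c \<otimes> f) \<otimes> b"
    proof -
      have "(a \<otimes> f) \<otimes> d = (a \<otimes> d) \<otimes> f" using assms ef by (simp add: m_ac)
      also have "\<dots> = (c \<otimes> f) \<otimes> b" unfolding eq using assms ef by (simp add: m_ac)
      finally show ?thesis .
    qed
    also have "(e \<otimes> b) \<otimes> d = (e \<otimes> d) \<otimes> b" using assms ef by (simp add: m_ac)
    also have "(c \<otimes> f) \<otimes> b = (e \<otimes> d) \<otimes> b \<longleftrightarrow> c \<otimes> f = e \<otimes> d"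
      using assms ef by (simp add: m_rcancel)
    finally show ?thesis .
  qed
  then show "fraction R a b = fraction R c d" unfolding fraction_def by auto
qed

abbreviation "Q \<equiv> quot_field R"

lemma fraction_closed:
  "a \<in> carrier R \<Longrightarrow> b \<in> carrier R - {\<zero>} \<Longrightarrow> fraction R a b \<in> carrier Q"
  unfolding quot_field_def by auto

lemma carrier_quot_field:
  assumes "x \<in> carrier Q"
  obtains a b where "a \<in> carrier R" "b \<in> carrier R - {\<zero>}" "x = fraction R a b"
  using assms unfolding quot_field_def by auto

text \<open>The operations of the quotient field are unions over all representatives. If the result
  does not depend on the representatives, the union of equal nonempty families is that one
  value.\<close>

lemma fraction_UN:
  assumes ab: "a \<in> carrier R" "b \<in> carrier R - {\<zero>}" and cd: "c \<in> carrier R" "d \<in> carrier R - {\<zero>}"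
    and eq: "\<And>a' b' c' d'. a' \<in> carrier R \<Longrightarrow> b' \<in> carrier R - {\<zero>} \<Longrightarrow> c' \<in> carrier R \<Longrightarrow>
      d' \<in> carrier R - {\<zero>} \<Longrightarrow> a \<otimes> b' = a' \<otimes> b \<Longrightarrow> c \<otimes> d' = c' \<otimes> d \<Longrightarrow> f a' b' c' d' = f a b c d"
  shows "(\<Union>(a, b)\<in>fraction R a b. \<Union>(c, d)\<in>fraction R c d. f a b c d) = f a b c d"
proof -
  have "(a, b) \<in> fraction R a b" "(c, d) \<in> fraction R c d" using ab cd by (simp_all add: fraction_def)
  then have ne: "fraction R a b \<noteq> {}" "fraction R c d \<noteq> {}" by blast+
  have eq': "f a' b' c' d' = f a b c d" if "(a', b') \<in> fraction R a b" "(c', d') \<in> fraction R c d" for a' b' c' d'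
    using that by (intro eq) (simp_all add: fraction_def)
  have "(\<Union>(a, b)\<in>fraction R a b. \<Union>(c, d)\<in>fraction R c d. f a b c d)
      = (\<Union>p\<in>fraction R a b. \<Union>q\<in>fraction R c d. f a b c d)"
  proof (rule SUP_cong[OF refl])
    fix p assume p: "p \<in> fraction R a b"
    obtain a' b' where ab': "p = (a', b')" by (cases p)
    have "(\<Union>(c, d)\<in>fraction R c d. f a' b' c d) = (\<Union>q\<in>fraction R c d. f a b c d)"
    proof (rule SUP_cong[OF refl])
      fix q assume q: "q \<in> fraction R c d"
      obtain c' d' where cd': "q = (c', d')" by (cases q)
      show "(case q of (c, d) \<Rightarrow> f a' b' c d) = f a b c d"
        using eq'[OF p[unfolded ab'] q[unfolded cd']] by (simp add: cd')
    qed
    then show "(case p of (a, b) \<Rightarrow> \<Union>(c, d)\<in>fraction R c d. f a b c d) = (\<Union>q\<in>fraction R c d. f a b c d)"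
      by (simp only: ab' prod.case)
  qed
  also have "\<dots> = f a b c d" using ne by simp
  finally show ?thesis .
qed

lemma nonzero_mult: "b \<in> carrier R - {\<zero>} \<Longrightarrow> d \<in> carrier R - {\<zero>} \<Longrightarrow> b \<otimes> d \<in> carrier R - {\<zero>}"
  by (simp add: integral_iff)

lemma fraction_mult:
  assumes ab: "a \<in> carrier R" "b \<in> carrier R - {\<zero>}" and cd: "c \<in> carrier R" "d \<in> carrier R - {\<zero>}"
  shows "fraction R a b \<otimes>\<^bsub>Q\<^esub> fraction R c d = fraction R (a \<otimes> c) (b \<otimes> d)"
proof -
  have "(\<Union>(a, b)\<in>fraction R a b. \<Union>(c, d)\<in>fraction R c d. fraction R (a \<otimes> c) (b \<otimes> d))
    = fraction R (a \<otimes> c) (b \<otimes> d)"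
  proof (rule fraction_UN[OF ab cd])
    fix a' b' c' d' assume *: "a' \<in> carrier R" "b' \<in> carrier R - {\<zero>}" "c' \<in> carrier R" "d' \<in> carrier R - {\<zero>}"
      and eq: "a \<otimes> b' = a' \<otimes> b" "c \<otimes> d' = c' \<otimes> d"
    have "(a' \<otimes> c') \<otimes> (b \<otimes> d) = (a' \<otimes> b) \<otimes> (c' \<otimes> d)" using ab cd * by (simp add: m_ac)
    also have "\<dots> = (a \<otimes> c) \<otimes> (b' \<otimes> d')" unfolding eq[symmetric] using ab cd * by (simp add: m_ac)
    finally show "fraction R (a' \<otimes> c') (b' \<otimes> d') = fraction R (a \<otimes> c) (b \<otimes> d)"
      using ab cd * nonzero_mult by (subst fraction_eq_iff) simp_all
  qed
  then show ?thesis by (simp add: quot_field_def)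
qed

lemma fraction_add:
  assumes ab: "a \<in> carrier R" "b \<in> carrier R - {\<zero>}" and cd: "c \<in> carrier R" "d \<in> carrier R - {\<zero>}"
  shows "fraction R a b \<oplus>\<^bsub>Q\<^esub> fraction R c d = fraction R (a \<otimes> d \<oplus> c \<otimes> b) (b \<otimes> d)"
proof -
  have "(\<Union>(a, b)\<in>fraction R a b. \<Union>(c, d)\<in>fraction R c d. fraction R (a \<otimes> d \<oplus> c \<otimes> b) (b \<otimes> d))
    = fraction R (a \<otimes> d \<oplus> c \<otimes> b) (b \<otimes> d)"
  proof (rule fraction_UN[OF ab cd])
    fix a' b' c' d' assume *: "a' \<in> carrier R" "b' \<in> carrier R - {\<zero>}" "c' \<in> carrier R" "d' \<in> carrier R - {\<zero>}"
      and eq: "a \<otimes> b' = a' \<otimes> b" "c \<otimes> d' = c' \<otimes> d"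
    have "(a' \<otimes> d' \<oplus> c' \<otimes> b') \<otimes> (b \<otimes> d) = (a' \<otimes> b) \<otimes> (d \<otimes> d') \<oplus> (c' \<otimes> d) \<otimes> (b \<otimes> b')"
      using ab cd * by (simp add: l_distr r_distr m_ac)
    also have "\<dots> = (a \<otimes> d \<oplus> c \<otimes> b) \<otimes> (b' \<otimes> d')"
      unfolding eq[symmetric] using ab cd * by (simp add: l_distr r_distr m_ac)
    finally show "fraction R (a' \<otimes> d' \<oplus> c' \<otimes> b') (b' \<otimes> d') = fraction R (a \<otimes> d \<oplus> c \<otimes> b) (b \<otimes> d)"
      using ab cd * nonzero_mult by (subst fraction_eq_iff) simp_all
  qed
  then show ?thesis by (simp add: quot_field_def)
qed

lemma quot_field_zero_one: "\<zero>\<^bsub>Q\<^esub> = fraction R \<zero> \<one>" "\<one>\<^bsub>Q\<^esub> = fraction R \<one> \<one>"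
  by (simp_all add: quot_field_def)

lemma quot_field_field: "field Q"
proof -
  note fr = fraction_mult fraction_add quot_field_zero_one
  have one: "\<one> \<in> carrier R - {\<zero>}" by simp
  have cl: "fraction R a b \<in> carrier Q" if "a \<in> carrier R" "b \<in> carrier R - {\<zero>}" for a b
    by (rule fraction_closed[OF that])
  have "abelian_group Q"
  proof (rule abelian_groupI)
    fix x y assume x: "x \<in> carrier Q" and y: "y \<in> carrier Q"
    obtain a b where a: "a \<in> carrier R" "b \<in> carrier R - {\<zero>}" "x = fraction R a b"
      by (rule carrier_quot_field[OF x])
    obtain c d where c: "c \<in> carrier R" "d \<in> carrier R - {\<zero>}" "y = fraction R c d"
      by (rule carrier_quot_field[OF y])
    have bd: "b \<otimes> d \<in> carrier R - {\<zero>}" by (rule nonzero_mult[OF a(2) c(2)])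
    show "x \<oplus>\<^bsub>Q\<^esub> y \<in> carrier Q"
      unfolding a(3) c(3) fraction_add[OF a(1,2) c(1,2)] using a c bd by (intro cl) simp_all
    show "x \<oplus>\<^bsub>Q\<^esub> y = y \<oplus>\<^bsub>Q\<^esub> x"
      unfolding a(3) c(3) fraction_add[OF a(1,2) c(1,2)] fraction_add[OF c(1,2) a(1,2)]
      using a c by (simp add: a_ac m_ac)
    show "\<zero>\<^bsub>Q\<^esub> \<oplus>\<^bsub>Q\<^esub> x = x"
      unfolding a(3) quot_field_zero_one fraction_add[OF zero_closed one a(1,2)] using a by simp
    have neg: "\<ominus> a \<in> carrier R" using a by simp
    have "(\<ominus> a \<otimes> b \<oplus> a \<otimes> b) \<otimes> \<one> = \<zero> \<otimes> (b \<otimes> b)" using a by (simp add: l_minus l_neg)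
    then have "fraction R (\<ominus> a) b \<oplus>\<^bsub>Q\<^esub> x = \<zero>\<^bsub>Q\<^esub>"
      unfolding a(3) quot_field_zero_one fraction_add[OF neg a(2) a(1,2)]
      using a nonzero_mult[OF a(2) a(2)] by (subst fraction_eq_iff) simp_all
    then show "\<exists>y\<in>carrier Q. y \<oplus>\<^bsub>Q\<^esub> x = \<zero>\<^bsub>Q\<^esub>" by (rule bexI) (rule cl[OF neg a(2)])
    fix z assume z: "z \<in> carrier Q"
    obtain e f where e: "e \<in> carrier R" "f \<in> carrier R - {\<zero>}" "z = fraction R e f"
      by (rule carrier_quot_field[OF z])
    have df: "d \<otimes> f \<in> carrier R - {\<zero>}" by (rule nonzero_mult[OF c(2) e(2)])
    have n: "a \<otimes> d \<oplus> c \<otimes> b \<in> carrier R" "c \<otimes> f \<oplus> e \<otimes> d \<in> carrier R" using a c e by simp_all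
    show "x \<oplus>\<^bsub>Q\<^esub> y \<oplus>\<^bsub>Q\<^esub> z = x \<oplus>\<^bsub>Q\<^esub> (y \<oplus>\<^bsub>Q\<^esub> z)"
      unfolding a(3) c(3) e(3) fraction_add[OF a(1,2) c(1,2)] fraction_add[OF c(1,2) e(1,2)]
        fraction_add[OF n(1) bd e(1,2)] fraction_add[OF a(1,2) n(2) df]
      using a c e by (simp add: l_distr r_distr a_ac m_ac)
  qed (use fraction_closed quot_field_zero_one in simp)
  moreover have "Group.comm_monoid Q"
  proof (rule comm_monoidI)
    show "\<one>\<^bsub>Q\<^esub> \<in> carrier Q" using fraction_closed quot_field_zero_one by simp
    fix x y assume x: "x \<in> carrier Q" and y: "y \<in> carrier Q"
    obtain a b where a: "a \<in> carrier R" "b \<in> carrier R - {\<zero>}" "x = fraction R a b"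
      by (rule carrier_quot_field[OF x])
    obtain c d where c: "c \<in> carrier R" "d \<in> carrier R - {\<zero>}" "y = fraction R c d"
      by (rule carrier_quot_field[OF y])
    have bd: "b \<otimes> d \<in> carrier R - {\<zero>}" by (rule nonzero_mult[OF a(2) c(2)])
    show "x \<otimes>\<^bsub>Q\<^esub> y \<in> carrier Q"
      unfolding a(3) c(3) fraction_mult[OF a(1,2) c(1,2)] using a c bd by (intro cl) simp_all
    show "x \<otimes>\<^bsub>Q\<^esub> y = y \<otimes>\<^bsub>Q\<^esub> x"
      unfolding a(3) c(3) fraction_mult[OF a(1,2) c(1,2)] fraction_mult[OF c(1,2) a(1,2)]
      using a c by (simp add: m_ac)
    show "\<one>\<^bsub>Q\<^esub> \<otimes>\<^bsub>Q\<^esub> x = x"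
      unfolding a(3) quot_field_zero_one fraction_mult[OF one_closed one a(1,2)] using a by simp
    fix z assume z: "z \<in> carrier Q"
    obtain e f where e: "e \<in> carrier R" "f \<in> carrier R - {\<zero>}" "z = fraction R e f"
      by (rule carrier_quot_field[OF z])
    have df: "d \<otimes> f \<in> carrier R - {\<zero>}" by (rule nonzero_mult[OF c(2) e(2)])
    show "x \<otimes>\<^bsub>Q\<^esub> y \<otimes>\<^bsub>Q\<^esub> z = x \<otimes>\<^bsub>Q\<^esub> (y \<otimes>\<^bsub>Q\<^esub> z)"
      unfolding a(3) c(3) e(3) fraction_mult[OF a(1,2) c(1,2)] fraction_mult[OF c(1,2) e(1,2)]
        fraction_mult[OF m_closed[OF a(1) c(1)] bd e(1,2)] fraction_mult[OF a(1,2) m_closed[OF c(1) e(1)] df]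
      using a c e by (simp add: m_ac)
  qed
  moreover have "(x \<oplus>\<^bsub>Q\<^esub> y) \<otimes>\<^bsub>Q\<^esub> z = x \<otimes>\<^bsub>Q\<^esub> z \<oplus>\<^bsub>Q\<^esub> y \<otimes>\<^bsub>Q\<^esub> z"
    if x: "x \<in> carrier Q" and y: "y \<in> carrier Q" and z: "z \<in> carrier Q" for x y z
  proof -
    obtain a b where a: "a \<in> carrier R" "b \<in> carrier R - {\<zero>}" "x = fraction R a b"
      by (rule carrier_quot_field[OF x])
    obtain c d where c: "c \<in> carrier R" "d \<in> carrier R - {\<zero>}" "y = fraction R c d"
      by (rule carrier_quot_field[OF y])
    obtain e f where e: "e \<in> carrier R" "f \<in> carrier R - {\<zero>}" "z = fraction R e f"
      by (rule carrier_quot_field[OF z])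
    have nz: "b \<otimes> d \<in> carrier R - {\<zero>}" "b \<otimes> f \<in> carrier R - {\<zero>}" "d \<otimes> f \<in> carrier R - {\<zero>}"
      using nonzero_mult a(2) c(2) e(2) by blast+
    have n: "a \<otimes> d \<oplus> c \<otimes> b \<in> carrier R" using a c by simp
    \<comment> \<open>The right-hand side carries an extra factor \<open>f\<close> in numerator and
      denominator, so the fractions are compared by cross multiplication.\<close>
    show ?thesis
      unfolding a(3) c(3) e(3) fraction_add[OF a(1,2) c(1,2)] fraction_mult[OF a(1,2) e(1,2)]
        fraction_mult[OF c(1,2) e(1,2)] fraction_mult[OF n nz(1) e(1,2)]
        fraction_add[OF m_closed[OF a(1) e(1)] nz(2) m_closed[OF c(1) e(1)] nz(3)]
      using a c e nz nonzero_mult[OF nz(1) e(2)] nonzero_mult[OF nz(2,3)]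
      by (subst fraction_eq_iff) (simp_all add: l_distr r_distr a_ac m_ac)
  qed
  ultimately have "cring Q" by (intro cringI)
  then interpret Q: cring Q .
  show ?thesis
  proof (rule Q.cring_fieldI2)
    show "\<zero>\<^bsub>Q\<^esub> \<noteq> \<one>\<^bsub>Q\<^esub>"
      unfolding quot_field_zero_one using fraction_eq_iff[OF zero_closed one one_closed one] by simp
    fix x assume x: "x \<in> carrier Q" "x \<noteq> \<zero>\<^bsub>Q\<^esub>"
    obtain a b where a: "a \<in> carrier R" "b \<in> carrier R - {\<zero>}" "x = fraction R a b"
      by (rule carrier_quot_field[OF x(1)])
    have "a \<noteq> \<zero>"
      using x(2) fraction_eq_iff[OF a(1,2) zero_closed one] a unfolding a(3) quot_field_zero_one by auto
    then have a': "a \<in> carrier R - {\<zero>}" using a(1) by simp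
    have "x \<otimes>\<^bsub>Q\<^esub> fraction R b a = \<one>\<^bsub>Q\<^esub>"
      unfolding a(3) quot_field_zero_one using a a' nonzero_mult[OF a(2) a']
      by (subst fraction_mult) (simp_all add: fraction_eq_iff m_ac)
    then show "\<exists>y\<in>carrier Q. x \<otimes>\<^bsub>Q\<^esub> y = \<one>\<^bsub>Q\<^esub>"
      using a a' by (intro bexI[where x = "fraction R b a"] cl) simp_all
  qed
qed

abbreviation "QM \<equiv> quot_field_module R"

lemma quot_field_module_simps:
  "carrier QM = carrier Q" "add QM = add Q" "\<zero>\<^bsub>QM\<^esub> = \<zero>\<^bsub>Q\<^esub>"
  "r \<odot>\<^bsub>QM\<^esub> x = fraction R r \<one> \<otimes>\<^bsub>Q\<^esub> x"
  by (simp_all add: quot_field_module_def ring.defs)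

lemma quot_field_module_is_module: "module R QM"
proof -
  interpret Q: field Q by (rule quot_field_field)
  have one: "\<one> \<in> carrier R - {\<zero>}" by simp
  have cl: "fraction R r \<one> \<in> carrier Q" if "r \<in> carrier R" for r by (rule fraction_closed[OF that one])
  have add: "fraction R (r \<oplus> s) \<one> = fraction R r \<one> \<oplus>\<^bsub>Q\<^esub> fraction R s \<one>"
    if "r \<in> carrier R" "s \<in> carrier R" for r s
    using fraction_add[OF that(1) one that(2) one] that by simp
  have mult: "fraction R (r \<otimes> s) \<one> = fraction R r \<one> \<otimes>\<^bsub>Q\<^esub> fraction R s \<one>"
    if "r \<in> carrier R" "s \<in> carrier R" for r s
    using fraction_mult[OF that(1) one that(2) one] that by simp
  show ?thesis
  proof (rule module_criteria, unfold quot_field_module_simps, goal_cases)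
    case 1 show ?case by (rule cring_axioms)
  next
    case 4
    show ?case using Q.r_neg Q.a_inv_closed by blast
  next
    case 10
    show ?case unfolding quot_field_zero_one(2)[symmetric] by simp
  qed (simp_all add: cl add mult Q.a_ac Q.m_assoc Q.l_distr Q.r_distr)
qed

end

section \<open>Extension of homomorphisms to torsion-free modules\<close>

context dvr
begin

lemma torsionI: "v \<in> carrier X \<Longrightarrow> \<pi> [^] (k::nat) \<odot>\<^bsub>X\<^esub> v = \<zero>\<^bsub>X\<^esub> \<Longrightarrow> v \<in> torsion X"
  unfolding torsion_iff by (intro conjI exI)

lemma torsionE:
  assumes "v \<in> torsion X"
  obtains k :: nat where "v \<in> carrier X" "\<pi> [^] k \<odot>\<^bsub>X\<^esub> v = \<zero>\<^bsub>X\<^esub>"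
  using assms unfolding torsion_iff by (elim conjE exE)

lemma torsion_hom:
  assumes "mod_hom R M N f" "x \<in> torsion M"
  shows "f x \<in> torsion N"
proof -
  interpret f: mod_hom R M N f by (rule assms(1))
  obtain k :: nat where k: "x \<in> carrier M" "\<pi> [^] k \<odot>\<^bsub>M\<^esub> x = \<zero>\<^bsub>M\<^esub>" using assms(2) by (rule torsionE)
  have "\<pi> [^] k \<odot>\<^bsub>N\<^esub> f x = f (\<pi> [^] k \<odot>\<^bsub>M\<^esub> x)" using k(1) by (simp only: f.f_smult pi_pow_closed)
  then have "\<pi> [^] k \<odot>\<^bsub>N\<^esub> f x = \<zero>\<^bsub>N\<^esub>" unfolding k(2) using f.f0_is_0 by simp
  then show ?thesis by (rule torsionI[OF f.f_im[OF k(1)]])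
qed

text \<open>Let \<open>N'\<close> consist of the elements that some power of \<pi> moves into the
  image of \<alpha>. The quotient \<open>N / N'\<close> is finitely generated and torsion-free, so
  independent generators of it lift to a complement of \<open>N'\<close>. On the complement the
  extension is zero. On \<open>N'\<close> the value is obtained by dividing \<open>h m\<close> by a
  power of \<pi>: possible by the divisibility assumption, unique because \<open>D\<close> is
  torsion-free.\<close>

lemma extend_hom:
  fixes M :: "('a, 'm) module" and N :: "('a, 'n) module" and D :: "('a, 'd) module"
  assumes M: "module R M" and N: "module R N" "generates R N y r" and \<alpha>: "\<alpha> \<in> module_hom R M N"
    and D: "module R D" and D0: "torsion D = {\<zero>\<^bsub>D\<^esub>}" and h: "h \<in> module_hom R M D"
    and ker: "{x \<in> carrier M. \<alpha> x = \<zero>\<^bsub>N\<^esub>} \<subseteq> torsion M"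
    and div: "\<And>n m e. n \<in> carrier N \<Longrightarrow> m \<in> carrier M \<Longrightarrow> \<pi> [^] (e::nat) \<odot>\<^bsub>N\<^esub> n = \<alpha> m \<Longrightarrow>
      \<exists>d\<in>carrier D. h m = \<pi> [^] e \<odot>\<^bsub>D\<^esub> d"
  shows "\<exists>h'\<in>hom_set R N D. \<forall>m\<in>carrier M. h' (\<alpha> m) = h m"
proof -
  interpret N: Module.module R N by (rule N)
  interpret D: Module.module R D by (rule D)
  interpret \<alpha>: mod_hom R M N \<alpha> by (rule mod_homI[OF M N(1) \<alpha>])
  have hh: "mod_hom R M D h" by (rule mod_homI[OF M D h])
  interpret h: mod_hom R M D h by (rule hh)
  let ?im = "\<alpha> ` carrier M"
  define N' where "N' = {n \<in> carrier N. \<exists>e::nat. \<pi> [^] e \<odot>\<^bsub>N\<^esub> n \<in> ?im}"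
  have im: "submodule R ?im N" by (rule \<alpha>.image_submodule[OF \<alpha>.M.submodule_carrier])
  have up: "\<pi> [^] (j + e) \<odot>\<^bsub>N\<^esub> n \<in> ?im" if "n \<in> carrier N" "\<pi> [^] e \<odot>\<^bsub>N\<^esub> n \<in> ?im" for n and j e :: nat
    unfolding smult_pow_add[OF N(1) that(1)]
    by (rule LinearCombinations.submodule.smult_closed[OF im pi_pow_closed that(2)])
  have N': "submodule R N' N"
  proof (rule N.submoduleI')
    show "N' \<subseteq> carrier N" by (simp add: N'_def)
    have "\<pi> [^] (0::nat) \<odot>\<^bsub>N\<^esub> \<zero>\<^bsub>N\<^esub> \<in> ?im" using imageI[OF \<alpha>.M.M.zero_closed, of \<alpha>] \<alpha>.f0_is_0 by simp
    then show "\<zero>\<^bsub>N\<^esub> \<in> N'" unfolding N'_def by blast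
  next
    fix v w assume "v \<in> N'" "w \<in> N'"
    then obtain i j :: nat where v: "v \<in> carrier N" "\<pi> [^] i \<odot>\<^bsub>N\<^esub> v \<in> ?im"
      and w: "w \<in> carrier N" "\<pi> [^] j \<odot>\<^bsub>N\<^esub> w \<in> ?im" unfolding N'_def by blast
    have "\<pi> [^] (i + j) \<odot>\<^bsub>N\<^esub> (v \<oplus>\<^bsub>N\<^esub> w) = \<pi> [^] (j + i) \<odot>\<^bsub>N\<^esub> v \<oplus>\<^bsub>N\<^esub> \<pi> [^] (i + j) \<odot>\<^bsub>N\<^esub> w"
      using v w by (simp add: N.smult_r_distr add.commute)
    also have "\<dots> \<in> ?im"
      by (rule LinearCombinations.submodule.m_closed[OF im up[OF v] up[OF w]])
    finally show "v \<oplus>\<^bsub>N\<^esub> w \<in> N'" unfolding N'_def using v w by blast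
  next
    fix c v assume c: "c \<in> carrier R" and "v \<in> N'"
    then obtain i :: nat where v: "v \<in> carrier N" "\<pi> [^] i \<odot>\<^bsub>N\<^esub> v \<in> ?im" unfolding N'_def by blast
    have "\<pi> [^] i \<odot>\<^bsub>N\<^esub> (c \<odot>\<^bsub>N\<^esub> v) = c \<odot>\<^bsub>N\<^esub> (\<pi> [^] i \<odot>\<^bsub>N\<^esub> v)"
      by (rule smult_swap[OF N(1) v(1) pi_pow_closed c])
    also have "\<dots> \<in> ?im" by (rule LinearCombinations.submodule.smult_closed[OF im c v(2)])
    finally show "c \<odot>\<^bsub>N\<^esub> v \<in> N'" unfolding N'_def using v c by blast
  qed
  define Y where "Y = quot_module N N'"
  define g where "g n = N' +>\<^bsub>N\<^esub> n" for n
  have Y: "module R Y" unfolding Y_def by (rule quot_module_is_module[OF N(1) N'])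
  have "g \<in> module_hom R N Y" unfolding Y_def g_def by (rule coset_hom[OF N(1) N'])
  then have gh: "mod_hom R N Y g" by (rule mod_homI[OF N(1) Y])
  interpret g: mod_hom R N Y g by (rule gh)
  have g_surj: "g ` carrier N = carrier Y" unfolding Y_def carrier_quot_module g_def ..
  have g0: "g n = \<zero>\<^bsub>Y\<^esub> \<longleftrightarrow> n \<in> N'" if "n \<in> carrier N" for n
    unfolding Y_def g_def by (rule coset_eq_zero_iff[OF N(1) N' that])
  have Y0: "v = \<zero>\<^bsub>Y\<^esub>" if vt: "v \<in> torsion Y" for v
  proof -
    obtain k :: nat where k: "v \<in> carrier Y" "\<pi> [^] k \<odot>\<^bsub>Y\<^esub> v = \<zero>\<^bsub>Y\<^esub>" using vt by (rule torsionE)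
    obtain n where n: "n \<in> carrier N" "v = g n" using k(1) g_surj by blast
    have "g (\<pi> [^] k \<odot>\<^bsub>N\<^esub> n) = \<zero>\<^bsub>Y\<^esub>" using k(2) n by (simp only: g.f_smult pi_pow_closed)
    then have "\<pi> [^] k \<odot>\<^bsub>N\<^esub> n \<in> N'" using g0[of "\<pi> [^] k \<odot>\<^bsub>N\<^esub> n"] n(1) by simp
    then obtain e :: nat where "\<pi> [^] e \<odot>\<^bsub>N\<^esub> (\<pi> [^] k \<odot>\<^bsub>N\<^esub> n) \<in> ?im" unfolding N'_def by blast
    then have "\<pi> [^] (e + k) \<odot>\<^bsub>N\<^esub> n \<in> ?im" using smult_pow_add[OF N(1) n(1)] by simp
    then have "n \<in> N'" unfolding N'_def using n(1) by blast
    then show ?thesis using g0[OF n(1)] n(2) by simp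
  qed
  obtain z where z: "generates R Y z r" "independent R Y z r"
    using ex_independent_generators[OF Y g.generates_image[OF N(2) g_surj]] by blast
  have zc: "z i \<in> carrier Y" if "i < r" for i using z(1) that by (simp add: generates_def)
  \<comment> \<open>Generators that are zero in \<open>Y\<close> must be lifted to zero:
    independence controls only the terms \<open>c i z i\<close>, and for \<open>z i = 0\<close> it
    says nothing about \<open>c i\<close>.\<close>
  have "\<exists>n. i < r \<longrightarrow> n \<in> carrier N \<and> g n = z i \<and> (z i = \<zero>\<^bsub>Y\<^esub> \<longrightarrow> n = \<zero>\<^bsub>N\<^esub>)" for i
  proof (cases "z i = \<zero>\<^bsub>Y\<^esub>")
    case True
    then show ?thesis by (intro exI[where x = "\<zero>\<^bsub>N\<^esub>"]) (simp add: g.f0_is_0)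
  next
    case False
    show ?thesis
    proof (cases "i < r")
      case True
      then have "z i \<in> g ` carrier N" unfolding g_surj by (rule zc)
      then obtain n where "z i = g n" "n \<in> carrier N" by (rule imageE)
      then show ?thesis using False by (intro exI[where x = n]) simp
    qed simp
  qed
  then obtain w where w: "\<And>i. i < r \<Longrightarrow> w i \<in> carrier N" "\<And>i. i < r \<Longrightarrow> g (w i) = z i"
    "\<And>i. i < r \<Longrightarrow> z i = \<zero>\<^bsub>Y\<^esub> \<Longrightarrow> w i = \<zero>\<^bsub>N\<^esub>"
    using choice[of "\<lambda>i n. i < r \<longrightarrow> n \<in> carrier N \<and> g n = z i \<and> (z i = \<zero>\<^bsub>Y\<^esub> \<longrightarrow> n = \<zero>\<^bsub>N\<^esub>)"] by blast
  define lc where "lc c = lin_comb N c w r" for c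
  have lc: "lc c \<in> carrier N" if "\<forall>i<r. c i \<in> carrier R" for c
    unfolding lc_def using that w(1) by simp
  have g_lc: "g (lc c) = lin_comb Y c z r" if "\<forall>i<r. c i \<in> carrier R" for c
  proof -
    have "g (lc c) = lin_comb Y c (\<lambda>i. g (w i)) r" unfolding lc_def using that w(1) by (simp add: g.hom_lin_comb)
    also have "\<dots> = lin_comb Y c z r" by (rule lin_comb_cong) (simp_all add: w(2))
    finally show ?thesis .
  qed
  \<comment> \<open>A certificate that \<open>n\<close> has value \<open>d\<close>: \<open>c\<close>
    describes the component of \<open>n\<close> in the complement, the power \<open>e\<close> of
    \<pi> moves the rest to \<open>\<alpha> m\<close>, and division of \<open>h m\<close> by that
    power gives \<open>d\<close>.\<close>
  define ok where "ok n d c e m \<longleftrightarrow> n \<in> carrier N \<and> d \<in> carrier D \<and> (\<forall>i<r. c i \<in> carrier R) \<and> m \<in> carrier M \<and>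
      \<pi> [^] e \<odot>\<^bsub>N\<^esub> (n \<ominus>\<^bsub>N\<^esub> lc c) = \<alpha> m \<and> h m = \<pi> [^] e \<odot>\<^bsub>D\<^esub> d" for n d c m and e :: nat
  \<comment> \<open>Exponents can be enlarged, so two certificates may be given a common exponent
    before they are added.\<close>
  have scale: "ok n d c (j + e) (\<pi> [^] j \<odot>\<^bsub>M\<^esub> m)" if "ok n d c e m" for n d c m and j e :: nat
  proof -
    have 1: "n \<in> carrier N" "d \<in> carrier D" "\<forall>i<r. c i \<in> carrier R" "m \<in> carrier M"
      "\<pi> [^] e \<odot>\<^bsub>N\<^esub> (n \<ominus>\<^bsub>N\<^esub> lc c) = \<alpha> m" "h m = \<pi> [^] e \<odot>\<^bsub>D\<^esub> d"
      using that by (simp_all add: ok_def)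
    have 2: "n \<ominus>\<^bsub>N\<^esub> lc c \<in> carrier N" using 1(1) lc[OF 1(3)] by simp
    show ?thesis
      unfolding ok_def smult_pow_add[OF N(1) 2] smult_pow_add[OF D 1(2)] 1(5) 1(6)[symmetric]
      using 1(1-4) by (simp add: \<alpha>.f_smult h.f_smult)
  qed
  define Q where "Q n d \<longleftrightarrow> (\<exists>c e m. ok n d c e m)" for n d
  have ex: "\<exists>h'\<in>hom_set R N D. \<forall>n d. Q n d \<longrightarrow> h' n = d"
  proof (rule hom_of_graph[OF N(1) D])
    fix n d assume "Q n d" then show "n \<in> carrier N \<and> d \<in> carrier D" unfolding Q_def ok_def by blast
  next
    fix n assume n: "n \<in> carrier N"
    have "\<exists>c. (\<forall>i<r. c i \<in> carrier R) \<and> g n = lin_comb Y c z r"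
      using z(1) g.f_im[OF n] unfolding generates_def by blast
    then obtain c where c: "\<forall>i<r. c i \<in> carrier R" and gn: "g n = lin_comb Y c z r" by blast
    have nc: "n \<ominus>\<^bsub>N\<^esub> lc c \<in> carrier N" using n lc[OF c] by simp
    have "N' +>\<^bsub>N\<^esub> n = N' +>\<^bsub>N\<^esub> lc c" using gn g_lc[OF c] unfolding g_def by simp
    then have "n \<ominus>\<^bsub>N\<^esub> lc c \<in> N'" using N.coset_eq_iff[OF N' n lc[OF c]] by simp
    then obtain e :: nat and m where m: "m \<in> carrier M" "\<pi> [^] e \<odot>\<^bsub>N\<^esub> (n \<ominus>\<^bsub>N\<^esub> lc c) = \<alpha> m"
      unfolding N'_def by blast
    obtain d where d: "d \<in> carrier D" "h m = \<pi> [^] e \<odot>\<^bsub>D\<^esub> d" using div[OF nc m] by blast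
    have "ok n d c e m" unfolding ok_def using n d c m by simp
    then show "\<exists>d. Q n d" unfolding Q_def by (intro exI)
  next
    fix n d n' d' assume "Q n d" "Q n' d'"
    then obtain c e m c' e' m' where ok0: "ok n d c e m" and ok0': "ok n' d' c' e' m'"
      unfolding Q_def by (elim exE)
    define E M1 M2 where "E = e' + e" and "M1 = \<pi> [^] e' \<odot>\<^bsub>M\<^esub> m" and "M2 = \<pi> [^] e \<odot>\<^bsub>M\<^esub> m'"
    have 1: "ok n d c E M1" unfolding E_def M1_def by (rule scale[OF ok0])
    have 2: "ok n' d' c' E M2" unfolding E_def M2_def add.commute[of e'] by (rule scale[OF ok0'])
    have k1: "n \<in> carrier N" "d \<in> carrier D" "\<forall>i<r. c i \<in> carrier R" "M1 \<in> carrier M"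
      "\<pi> [^] E \<odot>\<^bsub>N\<^esub> (n \<ominus>\<^bsub>N\<^esub> lc c) = \<alpha> M1" "h M1 = \<pi> [^] E \<odot>\<^bsub>D\<^esub> d" using 1 by (simp_all add: ok_def)
    have k2: "n' \<in> carrier N" "d' \<in> carrier D" "\<forall>i<r. c' i \<in> carrier R" "M2 \<in> carrier M"
      "\<pi> [^] E \<odot>\<^bsub>N\<^esub> (n' \<ominus>\<^bsub>N\<^esub> lc c') = \<alpha> M2" "h M2 = \<pi> [^] E \<odot>\<^bsub>D\<^esub> d'" using 2 by (simp_all add: ok_def)
    note l = lc[OF k1(3)] lc[OF k2(3)]
    have lcadd: "lc (\<lambda>i. c i \<oplus> c' i) = lc c \<oplus>\<^bsub>N\<^esub> lc c'"
      unfolding lc_def using k1(3) k2(3) w(1) by (simp add: N.lin_comb_add)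
    have "n \<oplus>\<^bsub>N\<^esub> n' \<ominus>\<^bsub>N\<^esub> (lc c \<oplus>\<^bsub>N\<^esub> lc c') = (n \<ominus>\<^bsub>N\<^esub> lc c) \<oplus>\<^bsub>N\<^esub> (n' \<ominus>\<^bsub>N\<^esub> lc c')"
      using k1(1) k2(1) l by (simp add: a_minus_def N.M.minus_add N.M.a_ac)
    then have "\<pi> [^] E \<odot>\<^bsub>N\<^esub> (n \<oplus>\<^bsub>N\<^esub> n' \<ominus>\<^bsub>N\<^esub> lc (\<lambda>i. c i \<oplus> c' i)) = \<alpha> (M1 \<oplus>\<^bsub>M\<^esub> M2)"
      unfolding lcadd \<alpha>.f_add[OF k1(4) k2(4)] k1(5)[symmetric] k2(5)[symmetric]
      using k1(1) k2(1) l by (simp add: N.smult_r_distr)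
    moreover have "h (M1 \<oplus>\<^bsub>M\<^esub> M2) = \<pi> [^] E \<odot>\<^bsub>D\<^esub> (d \<oplus>\<^bsub>D\<^esub> d')"
      unfolding h.f_add[OF k1(4) k2(4)] k1(6) k2(6) using k1(2) k2(2) by (simp add: D.smult_r_distr)
    ultimately have "ok (n \<oplus>\<^bsub>N\<^esub> n') (d \<oplus>\<^bsub>D\<^esub> d') (\<lambda>i. c i \<oplus> c' i) E (M1 \<oplus>\<^bsub>M\<^esub> M2)"
      unfolding ok_def using k1(1-4) k2(1-4) by simp
    then show "Q (n \<oplus>\<^bsub>N\<^esub> n') (d \<oplus>\<^bsub>D\<^esub> d')" unfolding Q_def by (intro exI)
  next
    fix s n d assume s: "s \<in> carrier R" and "Q n d"
    then obtain c e m where "ok n d c e m" unfolding Q_def by (elim exE)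
    then have k: "n \<in> carrier N" "d \<in> carrier D" "\<forall>i<r. c i \<in> carrier R" "m \<in> carrier M"
      "\<pi> [^] e \<odot>\<^bsub>N\<^esub> (n \<ominus>\<^bsub>N\<^esub> lc c) = \<alpha> m" "h m = \<pi> [^] e \<odot>\<^bsub>D\<^esub> d" by (simp_all add: ok_def)
    have nc: "n \<ominus>\<^bsub>N\<^esub> lc c \<in> carrier N" using k(1) lc[OF k(3)] by simp
    have lcs: "lc (\<lambda>i. s \<otimes> c i) = s \<odot>\<^bsub>N\<^esub> lc c"
      unfolding lc_def using k(3) s w(1) by (simp add: N.lin_comb_smult)
    have "s \<odot>\<^bsub>N\<^esub> n \<ominus>\<^bsub>N\<^esub> s \<odot>\<^bsub>N\<^esub> lc c = s \<odot>\<^bsub>N\<^esub> (n \<ominus>\<^bsub>N\<^esub> lc c)"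
      using k(1) s lc[OF k(3)] by (simp add: a_minus_def N.smult_r_distr N.smult_r_minus)
    then have "\<pi> [^] e \<odot>\<^bsub>N\<^esub> (s \<odot>\<^bsub>N\<^esub> n \<ominus>\<^bsub>N\<^esub> lc (\<lambda>i. s \<otimes> c i)) = \<alpha> (s \<odot>\<^bsub>M\<^esub> m)"
      unfolding lcs \<alpha>.f_smult[OF s k(4)] k(5)[symmetric]
      using smult_swap[OF N(1) nc pi_pow_closed s] by simp
    moreover have "h (s \<odot>\<^bsub>M\<^esub> m) = \<pi> [^] e \<odot>\<^bsub>D\<^esub> (s \<odot>\<^bsub>D\<^esub> d)"
      unfolding h.f_smult[OF s k(4)] k(6) by (rule smult_swap[OF D k(2) s pi_pow_closed])
    ultimately have "ok (s \<odot>\<^bsub>N\<^esub> n) (s \<odot>\<^bsub>D\<^esub> d) (\<lambda>i. s \<otimes> c i) e (s \<odot>\<^bsub>M\<^esub> m)"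
      unfolding ok_def using k(1-4) s by simp
    then show "Q (s \<odot>\<^bsub>N\<^esub> n) (s \<odot>\<^bsub>D\<^esub> d)" unfolding Q_def by (intro exI)
  next
    fix d assume "Q \<zero>\<^bsub>N\<^esub> d"
    then obtain c e m where "ok \<zero>\<^bsub>N\<^esub> d c e m" unfolding Q_def by (elim exE)
    then have k: "d \<in> carrier D" "\<forall>i<r. c i \<in> carrier R" "m \<in> carrier M"
      "\<pi> [^] e \<odot>\<^bsub>N\<^esub> (\<zero>\<^bsub>N\<^esub> \<ominus>\<^bsub>N\<^esub> lc c) = \<alpha> m" "h m = \<pi> [^] e \<odot>\<^bsub>D\<^esub> d" by (simp_all add: ok_def)
    \<comment> \<open>For \<open>n = 0\<close> the complement part also lies in \<open>N'\<close>,
      hence vanishes. Then \<open>m\<close> is in the kernel of \<alpha> and thus torsion, so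
      \<open>h m\<close> is zero in the torsion-free \<open>D\<close>, and so is
      \<open>d\<close>.\<close>
    have "\<zero>\<^bsub>N\<^esub> \<ominus>\<^bsub>N\<^esub> lc c \<in> N'" unfolding N'_def using k lc[OF k(2)] by auto
    then have "lc c \<in> N'" using N.submodule_uminus[OF N'] lc[OF k(2)] by (fastforce simp: a_minus_def)
    then have "lin_comb Y c z r = \<zero>\<^bsub>Y\<^esub>" using g0[OF lc[OF k(2)]] g_lc[OF k(2)] by simp
    then have cz: "c i \<odot>\<^bsub>Y\<^esub> z i = \<zero>\<^bsub>Y\<^esub>" if "i < r" for i
      using z(2) k(2) that unfolding independent_def by blast
    have "c i \<odot>\<^bsub>N\<^esub> w i = \<zero>\<^bsub>N\<^esub>" if i: "i < r" for i
    proof (cases "c i = \<zero>")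
      case True
      then show ?thesis using w(1)[OF i] by simp
    next
      case False
      have "z i \<in> torsion Y"
        by (rule smult_eq_zero_imp_tors[OF Y zc[OF i] _ False cz[OF i]]) (use k(2) i in simp)
      then have "w i = \<zero>\<^bsub>N\<^esub>" using Y0 w(3)[OF i] by simp
      then show ?thesis using k(2) i by simp
    qed
    then have "lc c = \<zero>\<^bsub>N\<^esub>" unfolding lc_def by (rule N.lin_comb_all_zero)
    then have "\<alpha> m = \<zero>\<^bsub>N\<^esub>" using k(4) by simp
    then have "m \<in> torsion M" using ker k(3) by blast
    then have "h m \<in> torsion D" by (rule torsion_hom[OF hh])
    then have "\<pi> [^] e \<odot>\<^bsub>D\<^esub> d = \<zero>\<^bsub>D\<^esub>" using D0 k(5) by simp
    then have "d \<in> torsion D" by (rule torsionI[OF k(1)])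
    then show "d = \<zero>\<^bsub>D\<^esub>" using D0 by simp
  qed
  then obtain h' where h': "h' \<in> hom_set R N D" "\<forall>n d. Q n d \<longrightarrow> h' n = d" by (rule bexE)
  have "h' (\<alpha> m) = h m" if m: "m \<in> carrier M" for m
  proof -
    have "lc (\<lambda>i. \<zero>) = \<zero>\<^bsub>N\<^esub>" unfolding lc_def using w(1) by (intro N.lin_comb_all_zero) simp
    then have "ok (\<alpha> m) (h m) (\<lambda>i. \<zero>) 0 m" unfolding ok_def using m by simp
    then have "Q (\<alpha> m) (h m)" unfolding Q_def by (intro exI)
    then show ?thesis using h'(2) by blast
  qed
  then show ?thesis using h'(1) by blast
qed

section \<open>Factorisation through \<alpha>, torsion kernels and divisibility\<close>

lemma torsion_component:
  assumes M: "module R M" and x: "\<And>i. i < n \<Longrightarrow> x i \<in> carrier M" and c: "\<And>i. i < n \<Longrightarrow> c i \<in> carrier R"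
    and tors: "\<And>i. i < n \<Longrightarrow> x i \<notin> torsion M \<Longrightarrow> c i = \<zero>"
  shows "lin_comb M c x n \<in> torsion M"
proof -
  interpret M: Module.module R M by (rule M)
  note t = submodule_torsion[OF M]
  have "lin_comb M c x n = lin_comb M (\<lambda>_. \<one>) (\<lambda>i. c i \<odot>\<^bsub>M\<^esub> x i) n"
    by (rule lin_comb_cong_terms[OF M]) (use x c in simp)
  also have "\<dots> \<in> torsion M"
  proof (rule M.lin_comb_in_submodule[OF t])
    fix i assume i: "i < n"
    show "c i \<odot>\<^bsub>M\<^esub> x i \<in> torsion M"
    proof (cases "x i \<in> torsion M")
      case True
      show ?thesis by (rule LinearCombinations.submodule.smult_closed[OF t c[OF i] True])
    next
      case False
      have "c i \<odot>\<^bsub>M\<^esub> x i = \<zero>\<^bsub>M\<^esub>" using tors[OF i False] x[OF i] by simp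
      moreover have "\<zero>\<^bsub>M\<^esub> \<in> torsion M" by (rule torsionI[where k = 0]) simp_all
      ultimately show ?thesis by simp
    qed
  qed simp
  finally show ?thesis .
qed

text \<open>A coordinate map sends \<open>k\<close> to \<open>c i d\<close>, where
  \<open>c i\<close> is a torsion-free coordinate of \<open>k\<close>. It factors through \<alpha>
  and so kills the kernel element \<open>k\<close>; as \<open>d\<close> is not torsion,
  \<open>c i\<close> vanishes. Only torsion coordinates remain.\<close>

lemma factors_imp_ker_torsion:
  fixes M :: "('a, 'm) module" and N :: "('a, 'n) module" and D :: "('a, 'd) module"
  assumes M: "module R M" "generates R M x' n" and N: "module R N" and \<alpha>: "\<alpha> \<in> module_hom R M N"
    and D: "module R D" and d: "d \<in> carrier D" "d \<notin> torsion D" and fac: "factors R M N \<alpha> D"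
  shows "{m \<in> carrier M. \<alpha> m = \<zero>\<^bsub>N\<^esub>} \<subseteq> torsion M"
proof
  fix k assume "k \<in> {m \<in> carrier M. \<alpha> m = \<zero>\<^bsub>N\<^esub>}"
  then have k: "k \<in> carrier M" "\<alpha> k = \<zero>\<^bsub>N\<^esub>" by simp_all
  interpret \<alpha>: mod_hom R M N \<alpha> by (rule mod_homI[OF M(1) N \<alpha>])
  obtain x where x: "generates R M x n" "independent R M x n"
    using ex_independent_generators[OF M] by blast
  have xc: "x i \<in> carrier M" if "i < n" for i using x(1) that by (simp add: generates_def)
  obtain c where c: "\<forall>i<n. c i \<in> carrier R" and kc: "k = lin_comb M c x n"
    using x(1) k(1) unfolding generates_def by blast
  have "c i = \<zero>" if i: "i < n" "x i \<notin> torsion M" for i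
  proof (rule ccontr)
    assume ne: "c i \<noteq> \<zero>"
    obtain f where f: "f \<in> hom_set R M D" "f k = c i \<odot>\<^bsub>D\<^esub> d"
      using coordinate_hom[OF M(1) D x i d(1)] c unfolding kc by blast
    obtain h' where h': "h' \<in> hom_set R N D" "\<forall>m\<in>carrier M. h' (\<alpha> m) = f m"
      using bspec[OF fac[unfolded factors_def] f(1)] by (rule bexE)
    interpret h': mod_hom R N D h' by (rule mod_homI[OF N D hom_setD(1)[OF h'(1)]])
    have "c i \<odot>\<^bsub>D\<^esub> d = \<zero>\<^bsub>D\<^esub>" using bspec[OF h'(2) k(1)] f(2) k(2) h'.f0_is_0 by simp
    then have "d \<in> torsion D"
      by (rule smult_eq_zero_imp_tors[OF D d(1) c[rule_format, OF i(1)] ne])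
    then show False using d(2) by simp
  qed
  then show "k \<in> torsion M" unfolding kc using torsion_component[OF M(1) xc] c by simp
qed

text \<open>An elementwise form of surjectivity of \<open>torsion N\<close> onto the torsion of the
  cokernel: the premise says that the class of \<open>n\<close> is torsion, the conclusion that it
  has a torsion representative.\<close>

definition divisible_mod_torsion ::
  "('a, 'm) module \<Rightarrow> ('a, 'n) module \<Rightarrow> ('m \<Rightarrow> 'n) \<Rightarrow> bool"
  where "divisible_mod_torsion M N \<alpha> \<longleftrightarrow> (\<forall>n\<in>carrier N. \<forall>m\<in>carrier M. \<forall>e::nat.
    \<pi> [^] e \<odot>\<^bsub>N\<^esub> n = \<alpha> m \<longrightarrow> (\<exists>t\<in>torsion N. \<exists>m'\<in>carrier M. n = t \<oplus>\<^bsub>N\<^esub> \<alpha> m'))"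

lemma torsion_coker_iff:
  fixes M :: "('a, 'm) module" and N :: "('a, 'n) module"
  assumes M: "module R M" and N: "module R N" and \<alpha>: "\<alpha> \<in> module_hom R M N"
    and C_def: "C = quot_module N (\<alpha> ` carrier M)"
  shows "torsion C = (\<lambda>x. \<alpha> ` carrier M +>\<^bsub>N\<^esub> x) ` torsion N \<longleftrightarrow> divisible_mod_torsion M N \<alpha>"
proof -
  interpret N: Module.module R N by (rule N)
  interpret \<alpha>: mod_hom R M N \<alpha> by (rule mod_homI[OF M N \<alpha>])
  let ?im = "\<alpha> ` carrier M" let ?g = "\<lambda>x. ?im +>\<^bsub>N\<^esub> x"
  have im: "submodule R ?im N" by (rule \<alpha>.image_submodule[OF \<alpha>.M.submodule_carrier])
  have C: "module R C" unfolding C_def by (rule quot_module_is_module[OF N im])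
  have gh: "mod_hom R N C ?g" unfolding C_def
    by (rule mod_homI[OF N quot_module_is_module[OF N im] coset_hom[OF N im]])
  interpret g: mod_hom R N C ?g by (rule gh)
  have tc: "t \<in> carrier N" if "t \<in> torsion N" for t using that unfolding torsion_iff by simp
  have g_eq: "?g n = ?g t \<longleftrightarrow> (\<exists>m'\<in>carrier M. n = t \<oplus>\<^bsub>N\<^esub> \<alpha> m')" if nt: "n \<in> carrier N" "t \<in> carrier N" for n t
  proof -
    have "n \<ominus>\<^bsub>N\<^esub> t = a \<longleftrightarrow> n = t \<oplus>\<^bsub>N\<^esub> a" if a: "a \<in> carrier N" for a
    proof
      have "t \<oplus>\<^bsub>N\<^esub> (n \<ominus>\<^bsub>N\<^esub> t) = n \<oplus>\<^bsub>N\<^esub> (t \<oplus>\<^bsub>N\<^esub> \<ominus>\<^bsub>N\<^esub> t)" using nt by (simp only: a_minus_def N.M.a_ac N.M.a_closed N.M.a_inv_closed)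
      also have "\<dots> = n" using nt by (simp add: N.M.r_neg)
      finally show "n = t \<oplus>\<^bsub>N\<^esub> a" if "n \<ominus>\<^bsub>N\<^esub> t = a" unfolding that by simp
      have "(t \<oplus>\<^bsub>N\<^esub> a) \<ominus>\<^bsub>N\<^esub> t = a \<oplus>\<^bsub>N\<^esub> (t \<oplus>\<^bsub>N\<^esub> \<ominus>\<^bsub>N\<^esub> t)" using nt a by (simp only: a_minus_def N.M.a_ac N.M.a_closed N.M.a_inv_closed)
      also have "\<dots> = a" using nt a by (simp add: N.M.r_neg)
      finally show "n \<ominus>\<^bsub>N\<^esub> t = a" if "n = t \<oplus>\<^bsub>N\<^esub> a" unfolding that .
    qed
    then have "n \<ominus>\<^bsub>N\<^esub> t \<in> ?im \<longleftrightarrow> (\<exists>m'\<in>carrier M. n = t \<oplus>\<^bsub>N\<^esub> \<alpha> m')" using \<alpha>.f_im by (simp add: image_iff)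
    then show ?thesis unfolding N.coset_eq_iff[OF im nt] .
  qed
  have tors_C: "?g n \<in> torsion C \<longleftrightarrow> (\<exists>e::nat. \<exists>m\<in>carrier M. \<pi> [^] e \<odot>\<^bsub>N\<^esub> n = \<alpha> m)" if n: "n \<in> carrier N" for n
  proof -
    have "\<pi> [^] e \<odot>\<^bsub>C\<^esub> ?g n = \<zero>\<^bsub>C\<^esub> \<longleftrightarrow> (\<exists>m\<in>carrier M. \<pi> [^] e \<odot>\<^bsub>N\<^esub> n = \<alpha> m)" for e :: nat
    proof -
      have "\<pi> [^] e \<odot>\<^bsub>C\<^esub> ?g n = ?g (\<pi> [^] e \<odot>\<^bsub>N\<^esub> n)" using n by (simp only: g.f_smult pi_pow_closed)
      moreover have "?g (\<pi> [^] e \<odot>\<^bsub>N\<^esub> n) = \<zero>\<^bsub>C\<^esub> \<longleftrightarrow> \<pi> [^] e \<odot>\<^bsub>N\<^esub> n \<in> ?im"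
        unfolding C_def using n by (intro coset_eq_zero_iff[OF N im]) simp
      ultimately show ?thesis by (simp add: image_iff)
    qed
    then show ?thesis unfolding torsion_iff using g.f_im[OF n] by simp
  qed
  have C_car: "carrier C = ?g ` carrier N" unfolding C_def carrier_quot_module ..
  have sub: "?g ` torsion N \<subseteq> torsion C" using torsion_hom[OF gh] by blast
  have "torsion C = ?g ` torsion N \<longleftrightarrow> (\<forall>n\<in>carrier N. ?g n \<in> torsion C \<longrightarrow> ?g n \<in> ?g ` torsion N)"
  proof
    assume *: "\<forall>n\<in>carrier N. ?g n \<in> torsion C \<longrightarrow> ?g n \<in> ?g ` torsion N"
    have "torsion C \<subseteq> ?g ` torsion N"
    proof
      fix v assume v: "v \<in> torsion C"
      then have "v \<in> ?g ` carrier N" unfolding C_car[symmetric] torsion_iff by simp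
      then obtain n where "n \<in> carrier N" "v = ?g n" by (rule imageE)
      then show "v \<in> ?g ` torsion N" using * v by simp
    qed
    then show "torsion C = ?g ` torsion N" using sub by (rule equalityI)
  qed simp
  also have "\<dots> \<longleftrightarrow> divisible_mod_torsion M N \<alpha>"
  proof -
    have "?g n \<in> ?g ` torsion N \<longleftrightarrow> (\<exists>t\<in>torsion N. \<exists>m'\<in>carrier M. n = t \<oplus>\<^bsub>N\<^esub> \<alpha> m')" if n: "n \<in> carrier N" for n
      unfolding image_iff using g_eq[OF n tc] by simp
    moreover have "((\<exists>e::nat. \<exists>m\<in>carrier M. A e m) \<longrightarrow> X) \<longleftrightarrow> (\<forall>m\<in>carrier M. \<forall>e. A e m \<longrightarrow> X)" for A X
      by blast
    ultimately show ?thesis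
      unfolding divisible_mod_torsion_def by (intro ball_cong[OF refl]) (simp only: tors_C)
  qed
  finally show ?thesis .
qed

text \<open>Write \<open>n = t + \<alpha> m'\<close>. By injectivity of \<alpha>, the difference of
  \<open>m\<close> and the multiple of \<open>m'\<close> by the power \<open>e\<close> of \<pi> is
  torsion, so \<open>h\<close> kills it. Hence \<open>h m\<close> is that multiple of
  \<open>h m'\<close>, which is the divisibility needed for the extension.\<close>

lemma divisible_mod_torsion_imp_factors:
  fixes M :: "('a, 'm) module" and N :: "('a, 'n) module" and D :: "('a, 'd) module"
  assumes M: "module R M" and N: "module R N" "generates R N y r" and \<alpha>: "\<alpha> \<in> module_hom R M N"
    and D: "module R D" and D0: "torsion D = {\<zero>\<^bsub>D\<^esub>}"
    and inj: "inj_on \<alpha> (carrier M)" and div: "divisible_mod_torsion M N \<alpha>"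
  shows "factors R M N \<alpha> D"
  unfolding factors_def
proof
  interpret N: Module.module R N by (rule N)
  interpret \<alpha>: mod_hom R M N \<alpha> by (rule mod_homI[OF M N(1) \<alpha>])
  fix h assume h: "h \<in> hom_set R M D"
  have hh: "mod_hom R M D h" by (rule mod_homI[OF M D hom_setD(1)[OF h]])
  interpret h: mod_hom R M D h by (rule hh)
  have ker0: "m = \<zero>\<^bsub>M\<^esub>" if "m \<in> carrier M" "\<alpha> m = \<zero>\<^bsub>N\<^esub>" for m
    using inj that unfolding \<alpha>.inj_on_iff_kernel by blast
  show "\<exists>h'\<in>hom_set R N D. \<forall>m\<in>carrier M. h' (\<alpha> m) = h m"
  proof (rule extend_hom[OF M N \<alpha> D D0 hom_setD(1)[OF h]])
    have "\<zero>\<^bsub>M\<^esub> \<in> torsion M" by (rule torsionI[where k = 0]) simp_all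
    then show "{x \<in> carrier M. \<alpha> x = \<zero>\<^bsub>N\<^esub>} \<subseteq> torsion M" using ker0 by auto
  next
    fix n m and e :: nat
    assume n: "n \<in> carrier N" and m: "m \<in> carrier M" and eq: "\<pi> [^] e \<odot>\<^bsub>N\<^esub> n = \<alpha> m"
    have "\<exists>t\<in>torsion N. \<exists>m'\<in>carrier M. n = t \<oplus>\<^bsub>N\<^esub> \<alpha> m'"
      using div n m eq unfolding divisible_mod_torsion_def by blast
    then obtain t m' where t: "t \<in> torsion N" and m': "m' \<in> carrier M" and nt: "n = t \<oplus>\<^bsub>N\<^esub> \<alpha> m'" by blast
    obtain k :: nat where k: "t \<in> carrier N" "\<pi> [^] k \<odot>\<^bsub>N\<^esub> t = \<zero>\<^bsub>N\<^esub>" using t by (rule torsionE)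
    let ?m = "m \<ominus>\<^bsub>M\<^esub> \<pi> [^] e \<odot>\<^bsub>M\<^esub> m'"
    have mc: "?m \<in> carrier M" using m m' by simp
    have "\<alpha> m = \<pi> [^] e \<odot>\<^bsub>N\<^esub> t \<oplus>\<^bsub>N\<^esub> \<pi> [^] e \<odot>\<^bsub>N\<^esub> \<alpha> m'"
      unfolding eq[symmetric] nt using k(1) m' by (simp add: N.smult_r_distr)
    moreover have "\<alpha> m = \<alpha> ?m \<oplus>\<^bsub>N\<^esub> \<pi> [^] e \<odot>\<^bsub>N\<^esub> \<alpha> m'"
    proof -
      have "m = ?m \<oplus>\<^bsub>M\<^esub> \<pi> [^] e \<odot>\<^bsub>M\<^esub> m'" using m m' by (simp add: a_minus_def \<alpha>.M.M.a_assoc \<alpha>.M.M.l_neg)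
      then have "\<alpha> m = \<alpha> (?m \<oplus>\<^bsub>M\<^esub> \<pi> [^] e \<odot>\<^bsub>M\<^esub> m')" by simp
      also have "\<dots> = \<alpha> ?m \<oplus>\<^bsub>N\<^esub> \<alpha> (\<pi> [^] e \<odot>\<^bsub>M\<^esub> m')" using mc m' by (intro \<alpha>.f_add) simp_all
      also have "\<alpha> (\<pi> [^] e \<odot>\<^bsub>M\<^esub> m') = \<pi> [^] e \<odot>\<^bsub>N\<^esub> \<alpha> m'" using m' by (simp only: \<alpha>.f_smult pi_pow_closed)
      finally show ?thesis .
    qed
    ultimately have at: "\<alpha> ?m = \<pi> [^] e \<odot>\<^bsub>N\<^esub> t"
      using \<alpha>.f_im[OF mc] k(1) m' N.M.add.right_cancel[of "\<pi> [^] e \<odot>\<^bsub>N\<^esub> \<alpha> m'" "\<alpha> ?m" "\<pi> [^] e \<odot>\<^bsub>N\<^esub> t"] by simp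
    have "\<alpha> (\<pi> [^] k \<odot>\<^bsub>M\<^esub> ?m) = \<pi> [^] k \<odot>\<^bsub>N\<^esub> \<alpha> ?m" using mc by (simp only: \<alpha>.f_smult pi_pow_closed)
    also have "\<dots> = \<pi> [^] e \<odot>\<^bsub>N\<^esub> (\<pi> [^] k \<odot>\<^bsub>N\<^esub> t)"
      unfolding at by (rule smult_swap[OF N(1) k(1) pi_pow_closed pi_pow_closed])
    finally have "\<alpha> (\<pi> [^] k \<odot>\<^bsub>M\<^esub> ?m) = \<zero>\<^bsub>N\<^esub>" unfolding k(2) by simp
    then have "\<pi> [^] k \<odot>\<^bsub>M\<^esub> ?m = \<zero>\<^bsub>M\<^esub>" using mc by (intro ker0) simp_all
    then have "?m \<in> torsion M" by (rule torsionI[OF mc])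
    then have "h ?m \<in> torsion D" by (rule torsion_hom[OF hh])
    then have h0: "h ?m = \<zero>\<^bsub>D\<^esub>" using D0 by simp
    have "m = ?m \<oplus>\<^bsub>M\<^esub> \<pi> [^] e \<odot>\<^bsub>M\<^esub> m'" using m m' by (simp add: a_minus_def \<alpha>.M.M.a_assoc \<alpha>.M.M.l_neg)
    then have "h m = h (?m \<oplus>\<^bsub>M\<^esub> \<pi> [^] e \<odot>\<^bsub>M\<^esub> m')" by simp
    also have "\<dots> = h ?m \<oplus>\<^bsub>D\<^esub> h (\<pi> [^] e \<odot>\<^bsub>M\<^esub> m')" using mc m' by (intro h.f_add) simp_all
    also have "\<dots> = h (\<pi> [^] e \<odot>\<^bsub>M\<^esub> m')" unfolding h0 using m' by simp
    also have "\<dots> = \<pi> [^] e \<odot>\<^bsub>D\<^esub> h m'" using m' by (simp only: h.f_smult pi_pow_closed)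
    finally show "\<exists>d\<in>carrier D. h m = \<pi> [^] e \<odot>\<^bsub>D\<^esub> d" using h.f_im[OF m'] by (intro bexI)
  qed
qed

text \<open>The test element \<open>d\<close> behaves like an element not divisible by \<pi>.
  Composing with coordinate maps to \<open>d\<close> shows that, whenever \<open>\<pi> n\<close> is
  \<open>\<alpha> m\<close> up to torsion, all torsion-free coordinates of \<open>m\<close> are
  divisible by \<pi>; dividing them yields the required \<open>m'\<close>.\<close>

lemma factors_imp_divisible_mod_torsion:
  fixes M :: "('a, 'm) module" and N :: "('a, 'n) module" and D :: "('a, 'd) module"
  assumes M: "module R M" "generates R M x' r" and N: "module R N" and \<alpha>: "\<alpha> \<in> module_hom R M N"
    and D: "module R D" and D0: "torsion D = {\<zero>\<^bsub>D\<^esub>}"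
    and d: "d \<in> carrier D" "\<And>a s. a \<in> carrier R \<Longrightarrow> s \<in> carrier D \<Longrightarrow> a \<odot>\<^bsub>D\<^esub> d = \<pi> \<odot>\<^bsub>D\<^esub> s \<Longrightarrow> a \<in> PIdl \<pi>"
    and fac: "factors R M N \<alpha> D"
  shows "divisible_mod_torsion M N \<alpha>"
proof -
  interpret M: Module.module R M by (rule M)
  interpret N: Module.module R N by (rule N)
  interpret D: Module.module R D by (rule D)
  interpret \<alpha>: mod_hom R M N \<alpha> by (rule mod_homI[OF M(1) N \<alpha>])
  have tc: "t \<in> carrier N" if "t \<in> torsion N" for t using that unfolding torsion_iff by simp
  obtain x where x: "generates R M x r" "independent R M x r"
    using ex_independent_generators[OF M] by blast
  have xc: "x i \<in> carrier M" if "i < r" for i using x(1) that by (simp add: generates_def)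
  \<comment> \<open>One division by \<pi>. A torsion summand \<open>t\<close> is allowed in the
    premise because the conclusion produces one, and the statement has to be iterated.\<close>
  have step: "\<exists>t'\<in>torsion N. \<exists>m'\<in>carrier M. n = t' \<oplus>\<^bsub>N\<^esub> \<alpha> m'"
    if n: "n \<in> carrier N" and t: "t \<in> torsion N" and m: "m \<in> carrier M" and eq: "\<pi> \<odot>\<^bsub>N\<^esub> n = t \<oplus>\<^bsub>N\<^esub> \<alpha> m" for n t m
  proof -
    obtain c where c: "\<forall>i<r. c i \<in> carrier R" and mc: "m = lin_comb M c x r"
      using x(1) m unfolding generates_def by blast
    have div: "c i \<in> PIdl \<pi>" if i: "i < r" "x i \<notin> torsion M" for i
    proof -
      obtain f where f: "f \<in> hom_set R M D" "f m = c i \<odot>\<^bsub>D\<^esub> d"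
        using coordinate_hom[OF M(1) D x i d(1)] c unfolding mc by blast
      obtain h' where h': "h' \<in> hom_set R N D" "\<forall>m\<in>carrier M. h' (\<alpha> m) = f m"
        using bspec[OF fac[unfolded factors_def] f(1)] by (rule bexE)
      have hh: "mod_hom R N D h'" by (rule mod_homI[OF N D hom_setD(1)[OF h'(1)]])
      interpret h': mod_hom R N D h' by (rule hh)
      have "h' t = \<zero>\<^bsub>D\<^esub>" using torsion_hom[OF hh t] D0 by simp
      then have "\<pi> \<odot>\<^bsub>D\<^esub> h' n = \<zero>\<^bsub>D\<^esub> \<oplus>\<^bsub>D\<^esub> h' (\<alpha> m)"
        using h'.f_add[OF tc[OF t] \<alpha>.f_im[OF m]] h'.f_smult[OF pi_closed n] unfolding eq by simp
      also have "\<dots> = c i \<odot>\<^bsub>D\<^esub> d" using bspec[OF h'(2) m] f(2) d(1) c i(1) by simp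
      finally show ?thesis using d(2)[of "c i" "h' n"] c i(1) h'.f_im[OF n] by simp
    qed
    have "\<exists>b. b \<in> carrier R \<and> (i < r \<longrightarrow> x i \<notin> torsion M \<longrightarrow> c i = \<pi> \<otimes> b)" for i
    proof (cases "i < r \<and> x i \<notin> torsion M")
      case True
      then have "c i \<in> PIdl \<pi>" by (intro div) simp_all
      then obtain b where "b \<in> carrier R" "c i = b \<otimes> \<pi>" unfolding cgenideal_def by blast
      then show ?thesis by (intro exI[where x = b]) (simp add: m_comm)
    next
      case False
      then show ?thesis by (intro exI[where x = \<zero>]) auto
    qed
    then obtain b where b: "\<And>i. b i \<in> carrier R" "\<And>i. i < r \<Longrightarrow> x i \<notin> torsion M \<Longrightarrow> c i = \<pi> \<otimes> b i"
      using choice[of "\<lambda>i b. b \<in> carrier R \<and> (i < r \<longrightarrow> x i \<notin> torsion M \<longrightarrow> c i = \<pi> \<otimes> b)"] by blast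
    define m' where "m' = lin_comb M b x r"
    define u where "u = lin_comb M (\<lambda>i. c i \<ominus> \<pi> \<otimes> b i) x r"
    have m': "m' \<in> carrier M" unfolding m'_def using b(1) xc by simp
    have cu: "c i \<ominus> \<pi> \<otimes> b i \<in> carrier R" if "i < r" for i using c b(1) that by simp
    have "c i \<ominus> \<pi> \<otimes> b i = \<zero>" if "i < r" "x i \<notin> torsion M" for i
      using b(2)[OF that] b(1)[of i] by (simp add: a_minus_def r_neg)
    then have u: "u \<in> torsion M" unfolding u_def using torsion_component[OF M(1) xc cu] by simp
    then have uc: "u \<in> carrier M" unfolding torsion_iff by simp
    have pm: "\<pi> \<odot>\<^bsub>M\<^esub> m' = lin_comb M (\<lambda>i. \<pi> \<otimes> b i) x r"
      unfolding m'_def using b(1) xc by (simp add: M.lin_comb_smult)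
    have "u = m \<ominus>\<^bsub>M\<^esub> \<pi> \<odot>\<^bsub>M\<^esub> m'"
      unfolding u_def mc pm using c b(1) xc by (intro M.lin_comb_minus) simp_all
    then have mu: "m = u \<oplus>\<^bsub>M\<^esub> \<pi> \<odot>\<^bsub>M\<^esub> m'"
      using m m' by (simp add: a_minus_def M.M.a_assoc M.M.l_neg)
    let ?t = "n \<ominus>\<^bsub>N\<^esub> \<alpha> m'"
    have \<alpha>m': "\<alpha> m' \<in> carrier N" by (rule \<alpha>.f_im[OF m'])
    have "\<alpha> m = \<alpha> u \<oplus>\<^bsub>N\<^esub> \<pi> \<odot>\<^bsub>N\<^esub> \<alpha> m'"
      unfolding mu using \<alpha>.f_add[OF uc M.smult_closed[OF pi_closed m']] \<alpha>.f_smult[OF pi_closed m'] by simp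
    then have "\<pi> \<odot>\<^bsub>N\<^esub> ?t = t \<oplus>\<^bsub>N\<^esub> (\<alpha> u \<oplus>\<^bsub>N\<^esub> \<pi> \<odot>\<^bsub>N\<^esub> \<alpha> m') \<oplus>\<^bsub>N\<^esub> \<ominus>\<^bsub>N\<^esub> (\<pi> \<odot>\<^bsub>N\<^esub> \<alpha> m')"
      unfolding a_minus_def using n \<alpha>m' eq by (simp add: N.smult_r_distr N.smult_r_minus)
    also have "\<dots> = t \<oplus>\<^bsub>N\<^esub> \<alpha> u"
      using tc[OF t] \<alpha>.f_im[OF uc] \<alpha>m' by (simp add: N.M.a_assoc N.M.r_neg)
    also have "\<dots> \<in> torsion N"
      by (rule LinearCombinations.submodule.m_closed[OF submodule_torsion[OF N] t torsion_hom[OF \<alpha>.mod_hom_axioms u]])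
    finally obtain k :: nat where "\<pi> [^] k \<odot>\<^bsub>N\<^esub> (\<pi> \<odot>\<^bsub>N\<^esub> ?t) = \<zero>\<^bsub>N\<^esub>" by (rule torsionE)
    then have "\<pi> [^] Suc k \<odot>\<^bsub>N\<^esub> ?t = \<zero>\<^bsub>N\<^esub>" using n \<alpha>m' by (simp add: N.smult_assoc1)
    then have tt: "?t \<in> torsion N" by (rule torsionI[rotated]) (use n \<alpha>m' in simp)
    have "n = ?t \<oplus>\<^bsub>N\<^esub> \<alpha> m'" using n \<alpha>m' by (simp add: a_minus_def N.M.a_assoc N.M.l_neg)
    then show ?thesis by (intro bexI[OF _ tt] bexI[OF _ m'])
  qed
  \<comment> \<open>Induction on the exponent for the statement with a torsion summand; the plain
    statement is the case of summand zero.\<close>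
  have "\<forall>t\<in>torsion N. \<forall>m\<in>carrier M. \<pi> [^] e \<odot>\<^bsub>N\<^esub> n = t \<oplus>\<^bsub>N\<^esub> \<alpha> m \<longrightarrow>
      (\<exists>t'\<in>torsion N. \<exists>m'\<in>carrier M. n = t' \<oplus>\<^bsub>N\<^esub> \<alpha> m')" if n: "n \<in> carrier N" for n and e :: nat
  proof (induction e)
    case 0
    then show ?case using n by auto
  next
    case (Suc e)
    show ?case
    proof (intro ballI impI)
      fix t m assume t: "t \<in> torsion N" and m: "m \<in> carrier M" and eq: "\<pi> [^] Suc e \<odot>\<^bsub>N\<^esub> n = t \<oplus>\<^bsub>N\<^esub> \<alpha> m"
      have "\<pi> \<odot>\<^bsub>N\<^esub> (\<pi> [^] e \<odot>\<^bsub>N\<^esub> n) = t \<oplus>\<^bsub>N\<^esub> \<alpha> m"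
        using eq smult_swap[OF N n pi_closed pi_pow_closed] n by (simp add: N.smult_assoc1)
      then have "\<exists>t'\<in>torsion N. \<exists>m'\<in>carrier M. \<pi> [^] e \<odot>\<^bsub>N\<^esub> n = t' \<oplus>\<^bsub>N\<^esub> \<alpha> m'"
        using n by (intro step[OF _ t m]) simp
      then show "\<exists>t'\<in>torsion N. \<exists>m'\<in>carrier M. n = t' \<oplus>\<^bsub>N\<^esub> \<alpha> m'" using Suc.IH by blast
    qed
  qed note all = this
  have zt: "\<zero>\<^bsub>N\<^esub> \<in> torsion N" by (rule torsionI[where k = 0]) simp_all
  show ?thesis
    unfolding divisible_mod_torsion_def
  proof (intro ballI allI impI)
    fix n m and e :: nat assume n: "n \<in> carrier N" and m: "m \<in> carrier M" and eq: "\<pi> [^] e \<odot>\<^bsub>N\<^esub> n = \<alpha> m"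
    have "\<pi> [^] e \<odot>\<^bsub>N\<^esub> n = \<zero>\<^bsub>N\<^esub> \<oplus>\<^bsub>N\<^esub> \<alpha> m" using eq \<alpha>.f_im[OF m] by simp
    then show "\<exists>t\<in>torsion N. \<exists>m'\<in>carrier M. n = t \<oplus>\<^bsub>N\<^esub> \<alpha> m'" using all[OF n] zt m by blast
  qed
qed

end

section \<open>The completion\<close>

context dvr
begin

abbreviation "I n \<equiv> PIdl (\<pi> [^] (n::nat))"

abbreviation "A \<equiv> adic_completion R (PIdl \<pi>)"

lemma regular_module_simps:
  "carrier (regular_module R) = carrier R" "a \<oplus>\<^bsub>regular_module R\<^esub> b = a \<oplus> b"
  "\<zero>\<^bsub>regular_module R\<^esub> = \<zero>" "r \<odot>\<^bsub>regular_module R\<^esub> a = r \<otimes> a"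
  "a \<ominus>\<^bsub>regular_module R\<^esub> b = a \<ominus> b" "U +>\<^bsub>regular_module R\<^esub> a = U +> a"
  by (simp_all add: regular_module_def a_minus_def a_inv_def a_r_coset_def m_inv_def r_coset_def)

lemma residue_coset_eq_iff:
  "a \<in> carrier R \<Longrightarrow> b \<in> carrier R \<Longrightarrow> I n +> a = I n +> b \<longleftrightarrow> a \<ominus> b \<in> I n"
  using module.coset_eq_iff[OF regular_module_is_module[OF cring_axioms] submodule_pi_pow, of a b n]
  by (simp add: regular_module_simps)

lemma residue_coset_add:
  "a \<in> carrier R \<Longrightarrow> b \<in> carrier R \<Longrightarrow> (I n +> a) \<oplus>\<^bsub>residue_module R (I n)\<^esub> (I n +> b) = I n +> (a \<oplus> b)"
  using quot_module_add[OF regular_module_is_module[OF cring_axioms] submodule_pi_pow, of a b n]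
  by (simp add: regular_module_simps)

lemma residue_coset_smult:
  "a \<in> carrier R \<Longrightarrow> r \<in> carrier R \<Longrightarrow> r \<odot>\<^bsub>residue_module R (I n)\<^esub> (I n +> a) = I n +> (r \<otimes> a)"
  using quot_module_smult[OF regular_module_is_module[OF cring_axioms] submodule_pi_pow, of a r n]
  by (simp add: regular_module_simps)

lemma residue_zero: "\<zero>\<^bsub>residue_module R (I n)\<^esub> = I n +> \<zero>"
  using quot_module_zero[OF regular_module_is_module[OF cring_axioms] submodule_pi_pow, of n]
  by (simp add: regular_module_simps)

lemma residue_carrier: "carrier (residue_module R (I n)) = (\<lambda>a. I n +> a) ` carrier R"
  by (simp add: carrier_quot_module regular_module_simps)

lemma I_ideal: "ideal (I n) R"
  by (rule cgenideal_ideal) simp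

lemma I_closed:
  "a \<in> I n \<Longrightarrow> a \<in> carrier R" "\<zero> \<in> I n" "a \<in> I n \<Longrightarrow> b \<in> I n \<Longrightarrow> a \<oplus> b \<in> I n"
  "a \<in> I n \<Longrightarrow> b \<in> I n \<Longrightarrow> a \<ominus> b \<in> I n"
  "a \<in> I n \<Longrightarrow> r \<in> carrier R \<Longrightarrow> r \<otimes> a \<in> I n"
proof -
  interpret I: ideal "I n" R by (rule I_ideal)
  show "a \<in> I n \<Longrightarrow> a \<in> carrier R" "\<zero> \<in> I n" "a \<in> I n \<Longrightarrow> b \<in> I n \<Longrightarrow> a \<oplus> b \<in> I n"
    "a \<in> I n \<Longrightarrow> r \<in> carrier R \<Longrightarrow> r \<otimes> a \<in> I n"
    by (simp_all add: I.a_Hcarr I.I_l_closed)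
  show "a \<in> I n \<Longrightarrow> b \<in> I n \<Longrightarrow> a \<ominus> b \<in> I n" unfolding a_minus_def by simp
qed

lemma I_antimono: assumes "m \<le> n" shows "I n \<subseteq> I m"
proof
  fix a assume "a \<in> I n"
  then obtain y where y: "y \<in> carrier R" "a = y \<otimes> \<pi> [^] n" unfolding cgenideal_def by blast
  have "\<pi> [^] n = \<pi> [^] (n - m) \<otimes> \<pi> [^] m" using assms by (simp add: nat_pow_mult)
  then have "a = (y \<otimes> \<pi> [^] (n - m)) \<otimes> \<pi> [^] m" using y by (simp add: m_assoc)
  moreover have "y \<otimes> \<pi> [^] (n - m) \<in> carrier R" using y by simp
  ultimately show "a \<in> I m" unfolding cgenideal_def by blast
qed

lemma I_sum_coset:
  assumes "m \<le> n" "a \<in> carrier R" shows "I m <+> (I n +> a) = I m +> a"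
proof -
  have sub: "I k \<subseteq> carrier R" for k using I_closed(1) by blast
  have "I m <+> I n = I m"
  proof
    show "I m <+> I n \<subseteq> I m"
      using I_closed(3) subsetD[OF I_antimono[OF assms(1)]] unfolding set_add_def' by blast
    show "I m \<subseteq> I m <+> I n"
    proof
      fix b assume b: "b \<in> I m"
      have "b = b \<oplus> \<zero>" using I_closed(1)[OF b] by simp
      then show "b \<in> I m <+> I n" using b I_closed(2) unfolding set_add_def' by blast
    qed
  qed
  then show ?thesis using a_setmult_rcos_assoc[OF sub sub assms(2)] by simp
qed

text \<open>A coherent sequence of ring elements representing a point of the limit. The transition
  maps become congruences, and calculations take place in \<open>R\<close> rather than with
  cosets.\<close>

definition adic_rep :: "(nat \<Rightarrow> 'a) \<Rightarrow> (nat \<Rightarrow> 'a set) \<Rightarrow> bool"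
  where "adic_rep x s \<longleftrightarrow>
    (\<forall>n. x n \<in> carrier R \<and> s n = I n +> x n \<and> (\<forall>m\<le>n. x n \<ominus> x m \<in> I m))"

lemma adic_repD:
  assumes "adic_rep x s"
  shows "x n \<in> carrier R" "s n = I n +> x n" "m \<le> n \<Longrightarrow> x n \<ominus> x m \<in> I m"
  using assms unfolding adic_rep_def by blast+

lemma adic_carrier: "s \<in> carrier A \<longleftrightarrow> (\<exists>x. adic_rep x s)"
proof -
  have "s \<in> carrier A \<longleftrightarrow> (\<forall>n. s n \<in> (\<lambda>a. I n +> a) ` carrier R) \<and> (\<forall>m n. m \<le> n \<longrightarrow> s m = I m <+> s n)"
    by (simp add: adic_completion_def ideal_pow_cgenideal residue_carrier)
  also have "\<dots> \<longleftrightarrow> (\<exists>x. adic_rep x s)"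
  proof
    assume *: "(\<forall>n. s n \<in> (\<lambda>a. I n +> a) ` carrier R) \<and> (\<forall>m n. m \<le> n \<longrightarrow> s m = I m <+> s n)"
    then have "\<forall>n. \<exists>a. a \<in> carrier R \<and> s n = I n +> a" by blast
    from choice[OF this] obtain x where x: "\<And>n. x n \<in> carrier R" "\<And>n. s n = I n +> x n" by blast
    have "x n \<ominus> x m \<in> I m" if mn: "m \<le> n" for m n
    proof -
      have "s m = I m <+> s n" using * mn by blast
      then have "I m +> x m = I m +> x n" unfolding x(2) I_sum_coset[OF mn x(1)] .
      from this[symmetric] show ?thesis using residue_coset_eq_iff[OF x(1) x(1)] by simp
    qed
    then show "\<exists>x. adic_rep x s" unfolding adic_rep_def using x by (intro exI[where x = x]) simp
  next
    assume "\<exists>x. adic_rep x s"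
    then obtain x where x: "adic_rep x s" by (rule exE)
    have "s m = I m <+> s n" if mn: "m \<le> n" for m n
    proof -
      have "I m +> x n = I m +> x m"
        using adic_repD(3)[OF x mn] residue_coset_eq_iff[OF adic_repD(1)[OF x] adic_repD(1)[OF x]] by simp
      then show ?thesis unfolding adic_repD(2)[OF x] I_sum_coset[OF mn adic_repD(1)[OF x]] by simp
    qed
    then show "(\<forall>n. s n \<in> (\<lambda>a. I n +> a) ` carrier R) \<and> (\<forall>m n. m \<le> n \<longrightarrow> s m = I m <+> s n)"
      using adic_repD(1,2)[OF x] by simp
  qed
  finally show ?thesis .
qed

lemma adic_ops:
  "\<zero>\<^bsub>A\<^esub> = (\<lambda>n. I n +> \<zero>)" "(s \<oplus>\<^bsub>A\<^esub> t) n = s n \<oplus>\<^bsub>residue_module R (I n)\<^esub> t n"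
  "(r \<odot>\<^bsub>A\<^esub> s) n = r \<odot>\<^bsub>residue_module R (I n)\<^esub> s n"
  by (simp_all add: adic_completion_def product_module_simps ideal_pow_cgenideal residue_zero restrict_def)

lemma adic_rep_zero: "adic_rep (\<lambda>_. \<zero>) \<zero>\<^bsub>A\<^esub>"
  unfolding adic_rep_def adic_ops using I_closed(2) by (simp add: a_minus_def)

lemma adic_rep_add:
  assumes x: "adic_rep x s" and y: "adic_rep y t" shows "adic_rep (\<lambda>n. x n \<oplus> y n) (s \<oplus>\<^bsub>A\<^esub> t)"
  unfolding adic_rep_def
proof (intro allI conjI impI)
  fix n
  show "x n \<oplus> y n \<in> carrier R" using adic_repD(1)[OF x] adic_repD(1)[OF y] by simp
  show "(s \<oplus>\<^bsub>A\<^esub> t) n = I n +> (x n \<oplus> y n)"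
    unfolding adic_ops adic_repD(2)[OF x] adic_repD(2)[OF y]
    by (rule residue_coset_add[OF adic_repD(1)[OF x] adic_repD(1)[OF y]])
  fix m assume mn: "m \<le> n"
  have "(x n \<oplus> y n) \<ominus> (x m \<oplus> y m) = (x n \<ominus> x m) \<oplus> (y n \<ominus> y m)"
    using adic_repD(1)[OF x] adic_repD(1)[OF y] by (simp add: a_minus_def minus_add a_ac)
  then show "(x n \<oplus> y n) \<ominus> (x m \<oplus> y m) \<in> I m"
    using I_closed(3)[OF adic_repD(3)[OF x mn] adic_repD(3)[OF y mn]] by simp
qed

lemma adic_rep_smult:
  assumes x: "adic_rep x s" and r: "r \<in> carrier R" shows "adic_rep (\<lambda>n. r \<otimes> x n) (r \<odot>\<^bsub>A\<^esub> s)"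
  unfolding adic_rep_def
proof (intro allI conjI impI)
  fix n
  show "r \<otimes> x n \<in> carrier R" using adic_repD(1)[OF x] r by simp
  show "(r \<odot>\<^bsub>A\<^esub> s) n = I n +> (r \<otimes> x n)"
    unfolding adic_ops adic_repD(2)[OF x] by (rule residue_coset_smult[OF adic_repD(1)[OF x] r])
  fix m assume mn: "m \<le> n"
  have "r \<otimes> x n \<ominus> r \<otimes> x m = r \<otimes> (x n \<ominus> x m)"
    using adic_repD(1)[OF x] r by (simp add: a_minus_def r_distr r_minus)
  then show "r \<otimes> x n \<ominus> r \<otimes> x m \<in> I m" using I_closed(5)[OF adic_repD(3)[OF x mn] r] by simp
qed

text \<open>The limit is the product of the residue modules with a smaller carrier and the same
  operations. Coherent representatives show that this carrier is a submodule.\<close>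

lemma adic_module: "module R A"
proof -
  let ?P = "product_module UNIV (\<lambda>n. residue_module R (I n))"
  have P: "module R ?P" by (rule product_module_is_module[OF cring_axioms residue_module_is_module])
  interpret P: Module.module R ?P by (rule P)
  have A_eq: "A = ?P\<lparr>carrier := carrier A\<rparr>"
    by (simp add: adic_completion_def ideal_pow_cgenideal)
  have ops: "zero A = zero ?P" "add A = add ?P" "smult A = smult ?P"
    by (simp_all add: adic_completion_def ideal_pow_cgenideal)
  have "submodule R (carrier A) ?P"
  proof (rule P.submoduleI')
    show "carrier A \<subseteq> carrier ?P"
    proof
      fix s assume "s \<in> carrier A"
      then obtain x where x: "adic_rep x s" unfolding adic_carrier by (rule exE)
      show "s \<in> carrier ?P" using adic_repD(1,2)[OF x] by (simp add: product_module_simps residue_carrier PiE_iff)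
    qed
    show "\<zero>\<^bsub>?P\<^esub> \<in> carrier A" unfolding ops[symmetric] adic_carrier using adic_rep_zero by blast
  next
    fix s t assume "s \<in> carrier A" "t \<in> carrier A"
    then obtain x y where "adic_rep x s" "adic_rep y t" unfolding adic_carrier by (elim exE)
    from adic_rep_add[OF this] show "s \<oplus>\<^bsub>?P\<^esub> t \<in> carrier A" unfolding ops[symmetric] adic_carrier by blast
  next
    fix r s assume r: "r \<in> carrier R" and "s \<in> carrier A"
    then obtain x where "adic_rep x s" unfolding adic_carrier by (elim exE)
    from adic_rep_smult[OF this r] show "r \<odot>\<^bsub>?P\<^esub> s \<in> carrier A"
      unfolding ops[symmetric] adic_carrier by blast
  qed
  from P.submodule_is_module[OF this] show ?thesis using A_eq by simp
qed

lemma torsion_adic: "torsion A = {\<zero>\<^bsub>A\<^esub>}"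
proof (intro equalityI subsetI)
  fix s assume "s \<in> {\<zero>\<^bsub>A\<^esub>}"
  interpret A: Module.module R A by (rule adic_module)
  show "s \<in> torsion A" using \<open>s \<in> {\<zero>\<^bsub>A\<^esub>}\<close> by (intro torsionI[where k = 0]) simp_all
next
  fix s assume "s \<in> torsion A"
  then obtain k :: nat where s: "s \<in> carrier A" "\<pi> [^] k \<odot>\<^bsub>A\<^esub> s = \<zero>\<^bsub>A\<^esub>" by (rule torsionE)
  obtain x where x: "adic_rep x s" using s(1) unfolding adic_carrier by (rule exE)
  have xc: "x n \<in> carrier R" for n by (rule adic_repD(1)[OF x])
  have "x n \<in> I n" for n :: nat
  proof -
    \<comment> \<open>At level \<open>n\<close> the equation would determine \<open>x n\<close> only
      up to the power \<open>n - k\<close> of \<pi>. At level \<open>n + k\<close>, cancelling the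
      power \<open>k\<close> leaves divisibility by the power \<open>n\<close>, and coherence
      carries it down to \<open>x n\<close>.\<close>
    let ?j = "n + k"
    have "I ?j +> \<pi> [^] k \<otimes> x ?j = I ?j +> \<zero>"
      using adic_repD(2)[OF adic_rep_smult[OF x pi_pow_closed], of k ?j] unfolding s(2) adic_ops by simp
    then have "\<pi> [^] k \<otimes> x ?j \<in> I ?j"
      using residue_coset_eq_iff[of "\<pi> [^] k \<otimes> x ?j" \<zero> ?j] xc by (simp add: a_minus_def)
    then obtain y where y: "y \<in> carrier R" "\<pi> [^] k \<otimes> x ?j = y \<otimes> \<pi> [^] ?j" unfolding cgenideal_def by blast
    have "\<pi> [^] k \<otimes> x ?j = \<pi> [^] k \<otimes> (y \<otimes> \<pi> [^] n)"
      unfolding y(2) using y(1) by (simp add: nat_pow_mult[symmetric] m_ac)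
    then have "x ?j = y \<otimes> \<pi> [^] n" using m_lcancel[of "\<pi> [^] k" "x ?j" "y \<otimes> \<pi> [^] n"] xc y(1) by simp
    then have xj: "x ?j \<in> I n" unfolding cgenideal_def using y(1) by blast
    have "x n = x ?j \<ominus> (x ?j \<ominus> x n)" using xc by (simp add: a_minus_def minus_add r_neg1 r_neg2)
    then show ?thesis using I_closed(4)[OF xj adic_repD(3)[OF x, of n ?j]] by simp
  qed
  then have "s n = I n +> \<zero>" for n
    using residue_coset_eq_iff[of "x n" \<zero> n] xc unfolding adic_repD(2)[OF x] by (simp add: a_minus_def)
  then show "s \<in> {\<zero>\<^bsub>A\<^esub>}" unfolding adic_ops by auto
qed

text \<open>\<open>e\<close> is the image of 1. The equation at level 1 says that \<open>a\<close>
  is congruent to \<open>\<pi> x 1\<close> modulo \<pi>, so \<open>e\<close> has the property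
  required of the test element above.\<close>

lemma adic_one:
  defines "e \<equiv> \<lambda>n. I n +> \<one>"
  shows "e \<in> carrier A"
    and "\<And>a s. a \<in> carrier R \<Longrightarrow> s \<in> carrier A \<Longrightarrow> a \<odot>\<^bsub>A\<^esub> e = \<pi> \<odot>\<^bsub>A\<^esub> s \<Longrightarrow> a \<in> PIdl \<pi>"
proof -
  have e: "adic_rep (\<lambda>_. \<one>) e" unfolding adic_rep_def e_def using I_closed(2) by (simp add: a_minus_def r_neg)
  then show "e \<in> carrier A" unfolding adic_carrier by blast
  fix a s assume a: "a \<in> carrier R" and s: "s \<in> carrier A" and eq: "a \<odot>\<^bsub>A\<^esub> e = \<pi> \<odot>\<^bsub>A\<^esub> s"
  obtain x where x: "adic_rep x s" using s unfolding adic_carrier by (rule exE)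
  have x1: "x 1 \<in> carrier R" by (rule adic_repD(1)[OF x])
  have "I 1 +> a \<otimes> \<one> = I 1 +> \<pi> \<otimes> x 1"
    using adic_repD(2)[OF adic_rep_smult[OF e a], of 1] adic_repD(2)[OF adic_rep_smult[OF x pi_closed], of 1]
    unfolding eq by simp
  then have "a \<ominus> \<pi> \<otimes> x 1 \<in> I 1" using residue_coset_eq_iff[of a "\<pi> \<otimes> x 1" 1] a x1 by simp
  moreover have "\<pi> \<otimes> x 1 \<in> I 1"
    using I_closed(5)[OF _ x1, of \<pi> 1] cgenideal_self[OF pi_closed] x1 by (simp add: m_comm)
  ultimately have "(a \<ominus> \<pi> \<otimes> x 1) \<oplus> \<pi> \<otimes> x 1 \<in> I 1" by (rule I_closed(3))
  moreover have "(a \<ominus> \<pi> \<otimes> x 1) \<oplus> \<pi> \<otimes> x 1 = a" using a x1 by (simp add: a_minus_def a_assoc l_neg)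
  ultimately show "a \<in> PIdl \<pi>" by simp
qed

section \<open>The quotient field as a module\<close>

lemma quot_field_smult:
  assumes "r \<in> carrier R" "a \<in> carrier R" "b \<in> carrier R - {\<zero>}"
  shows "r \<odot>\<^bsub>QM\<^esub> fraction R a b = fraction R (r \<otimes> a) b"
proof -
  have "\<one> \<in> carrier R - {\<zero>}" by simp
  from fraction_mult[OF assms(1) this assms(2,3)] show ?thesis
    using assms by (simp add: quot_field_module_simps)
qed

lemma torsion_quot_field: "torsion QM = {\<zero>\<^bsub>QM\<^esub>}"
proof (intro equalityI subsetI)
  fix v assume "v \<in> {\<zero>\<^bsub>QM\<^esub>}"
  interpret Q: Module.module R QM by (rule quot_field_module_is_module)
  show "v \<in> torsion QM" using \<open>v \<in> {\<zero>\<^bsub>QM\<^esub>}\<close> by (intro torsionI[where k = 0]) simp_all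
next
  fix v assume "v \<in> torsion QM"
  then obtain k :: nat where v: "v \<in> carrier QM" "\<pi> [^] k \<odot>\<^bsub>QM\<^esub> v = \<zero>\<^bsub>QM\<^esub>" by (rule torsionE)
  obtain a b where ab: "a \<in> carrier R" "b \<in> carrier R - {\<zero>}" "v = fraction R a b"
    using v(1) unfolding quot_field_module_simps by (rule carrier_quot_field)
  have one: "\<one> \<in> carrier R - {\<zero>}" by simp
  have pa: "\<pi> [^] k \<otimes> a \<in> carrier R" using ab by simp
  have zero: "\<zero>\<^bsub>QM\<^esub> = fraction R \<zero> \<one>" unfolding quot_field_module_simps quot_field_zero_one ..
  have "fraction R (\<pi> [^] k \<otimes> a) b = fraction R \<zero> \<one>"
    using v(2) unfolding ab(3) zero quot_field_smult[OF pi_pow_closed ab(1,2)] .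
  then have "\<pi> [^] k \<otimes> a = \<zero>" using fraction_eq_iff[OF pa ab(2) zero_closed one] ab pa by simp
  then have "a = \<zero>" using integral_iff[of "\<pi> [^] k" a] ab(1) by simp
  then have "v = \<zero>\<^bsub>QM\<^esub>"
    unfolding ab(3) zero
    using fraction_eq_iff[OF ab(1,2) zero_closed one] ab by simp
  then show "v \<in> {\<zero>\<^bsub>QM\<^esub>}" by simp
qed

lemma quot_field_divisible:
  assumes "d \<in> carrier QM" shows "\<exists>d'\<in>carrier QM. d = \<pi> [^] (e::nat) \<odot>\<^bsub>QM\<^esub> d'"
proof -
  obtain a b where ab: "a \<in> carrier R" "b \<in> carrier R - {\<zero>}" "d = fraction R a b"
    using assms unfolding quot_field_module_simps by (rule carrier_quot_field)
  have b': "b \<otimes> \<pi> [^] e \<in> carrier R - {\<zero>}" using ab(2) by (intro nonzero_mult) simp_all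
  have "d = \<pi> [^] e \<odot>\<^bsub>QM\<^esub> fraction R a (b \<otimes> \<pi> [^] e)"
    unfolding ab(3) quot_field_smult[OF pi_pow_closed ab(1) b']
    using ab b' by (subst fraction_eq_iff) (simp_all add: m_ac)
  then show ?thesis
    by (rule bexI) (simp only: quot_field_module_simps, rule fraction_closed[OF ab(1) b'])
qed

text \<open>One direction tests with the fraction 1, which is not torsion. In the other, the
  extension lemma applies because division by powers of \<pi> is always possible in the quotient
  field.\<close>

lemma factors_quot_field_iff:
  fixes M :: "('a, 'm) module" and N :: "('a, 'n) module"
  assumes M: "module R M" "generates R M x m" and N: "module R N" "generates R N y n"
    and \<alpha>: "\<alpha> \<in> module_hom R M N"
  shows "factors R M N \<alpha> QM \<longleftrightarrow> {m \<in> carrier M. \<alpha> m = \<zero>\<^bsub>N\<^esub>} \<subseteq> torsion M"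
proof
  have one: "\<one> \<in> carrier R - {\<zero>}" by simp
  have 1: "fraction R \<one> \<one> \<in> carrier QM" unfolding quot_field_module_simps by (rule fraction_closed[OF one_closed one])
  have 2: "fraction R \<one> \<one> \<notin> torsion QM"
    unfolding torsion_quot_field singleton_iff quot_field_module_simps quot_field_zero_one
      fraction_eq_iff[OF one_closed one zero_closed one] by simp
  show "{m \<in> carrier M. \<alpha> m = \<zero>\<^bsub>N\<^esub>} \<subseteq> torsion M" if "factors R M N \<alpha> QM"
    by (rule factors_imp_ker_torsion[OF M N(1) \<alpha> quot_field_module_is_module 1 2 that])
next
  assume ker: "{m \<in> carrier M. \<alpha> m = \<zero>\<^bsub>N\<^esub>} \<subseteq> torsion M"
  show "factors R M N \<alpha> QM"
    unfolding factors_def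
  proof
    fix h assume h: "h \<in> hom_set R M QM"
    show "\<exists>h'\<in>hom_set R N QM. \<forall>m\<in>carrier M. h' (\<alpha> m) = h m"
      by (rule extend_hom[OF M(1) N \<alpha> quot_field_module_is_module torsion_quot_field hom_setD(1)[OF h] ker])
        (rule quot_field_divisible[OF hom_set_closed[OF h]])
  qed
qed

section \<open>The injective hull\<close>

lemma factors_injective:
  fixes M N :: "'a umodule"
  assumes P: "injective_module R P" and M: "module R M" and N: "module R N"
    and \<alpha>: "\<alpha> \<in> hom_set R M N" and inj: "inj_on \<alpha> (carrier M)"
  shows "factors R M N \<alpha> P"
  unfolding factors_def
proof
  fix h assume h: "h \<in> hom_set R M P"
  have "\<exists>h'\<in>hom_set R N P. compose (carrier M) h' \<alpha> = h"
    using P \<alpha> h M N inj unfolding injective_module_def by blast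
  then show "\<exists>h'\<in>hom_set R N P. \<forall>m\<in>carrier M. h' (\<alpha> m) = h m"
    unfolding compose_eq_iff[OF h] .
qed

text \<open>A nonzero \<open>k\<close> in the kernel admits a map from \<open>R k\<close> through
  the residue field into \<open>P\<close> that does not kill \<open>k\<close>. Injectivity extends
  it to \<open>M\<close>, and factorisation through \<alpha> then forces the value at
  \<open>k\<close> to be zero.\<close>

lemma factors_injective_hull_imp_inj:
  fixes M N :: "'a umodule"
  assumes P: "injective_hull R (residue_module R (PIdl \<pi>)) P" and M: "module R M" and N: "module R N"
    and \<alpha>: "\<alpha> \<in> hom_set R M N" and fac: "factors R M N \<alpha> P"
  shows "inj_on \<alpha> (carrier M)"
proof -
  interpret M: Module.module R M by (rule M)
  interpret \<alpha>: mod_hom R M N \<alpha> by (rule mod_homI[OF M N hom_setD(1)[OF \<alpha>]])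
  have P_inj: "injective_module R P" using P by (simp add: injective_hull_def)
  then have Pm: "module R P" by (simp add: injective_module_def)
  interpret P: Module.module R P by (rule Pm)
  let ?K = "residue_module R (I 1)"
  have I1: "I 1 = PIdl \<pi>" by simp
  obtain \<iota> where \<iota>: "\<iota> \<in> module_hom R ?K P" "inj_on \<iota> (carrier ?K)"
    using P unfolding injective_hull_def I1[symmetric] by blast
  interpret \<iota>: mod_hom R ?K P \<iota> by (rule mod_homI[OF residue_module_is_module Pm \<iota>(1)])
  have coset_closed: "I 1 +> r \<in> carrier ?K" if "r \<in> carrier R" for r
    unfolding residue_carrier using that by (rule imageI)
  have one: "\<iota> (I 1 +> \<one>) \<noteq> \<zero>\<^bsub>P\<^esub>"
  proof
    assume "\<iota> (I 1 +> \<one>) = \<zero>\<^bsub>P\<^esub>"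
    then have "I 1 +> \<one> = I 1 +> \<zero>"
      using \<iota>(2) coset_closed[OF one_closed] unfolding \<iota>.inj_on_iff_kernel residue_zero by blast
    then have "\<pi> [^] (0::nat) \<in> I 1" using residue_coset_eq_iff[of \<one> \<zero> 1] by (simp add: a_minus_def)
    then show False using pi_pow_dvd_iff[of 0 1] by simp
  qed
  show ?thesis
    unfolding \<alpha>.inj_on_iff_kernel
  proof (intro ballI impI, rule ccontr)
    fix k assume k: "k \<in> carrier M" "\<alpha> k = \<zero>\<^bsub>N\<^esub>" and k0: "k \<noteq> \<zero>\<^bsub>M\<^esub>"
    let ?U = "cyclic R M k" let ?X = "M\<lparr>carrier := ?U\<rparr>"
    have X: "module R ?X" by (rule M.submodule_is_module[OF M.submodule_cyclic[OF k(1)]])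
    \<comment> \<open>A scalar that kills the nonzero \<open>k\<close> is not a unit, hence lies in
      the maximal ideal. This makes the assignment of the class of \<open>r\<close> to
      \<open>r k\<close> well defined.\<close>
    have nonunit: "r \<in> I 1" if r: "r \<in> carrier R" "r \<odot>\<^bsub>M\<^esub> k = \<zero>\<^bsub>M\<^esub>" for r
    proof -
      have "r \<notin> Units R"
        using smult_unit_iff[OF M k(1) _ M.submodule_zero, of r] r(2) k0 by auto
      then obtain s where s: "s \<in> carrier R" "r = \<pi> \<otimes> s" using nonunit_pi_mult[OF r(1)] by blast
      have "\<pi> \<otimes> s \<in> I 1"
        using I_closed(5)[OF _ s(1), of \<pi> 1] cgenideal_self[OF pi_closed] s(1) by (simp add: m_comm)
      then show ?thesis unfolding s(2) .
    qed
    define G where "G m d \<longleftrightarrow> (\<exists>r\<in>carrier R. m = r \<odot>\<^bsub>M\<^esub> k \<and> d = \<iota> (I 1 +> r))" for m d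
    have "\<exists>f\<in>hom_set R ?X P. \<forall>m d. G m d \<longrightarrow> f m = d"
    proof (rule hom_of_graph[OF X Pm])
      fix m d assume "G m d"
      then obtain r where r: "r \<in> carrier R" "m = r \<odot>\<^bsub>M\<^esub> k" "d = \<iota> (I 1 +> r)" unfolding G_def by (rule bexE) simp
      show "m \<in> carrier ?X \<and> d \<in> carrier P"
        using cyclicI[OF r(1,2)] \<iota>.f_im[OF coset_closed[OF r(1)]] r(3) by simp
    next
      fix m assume "m \<in> carrier ?X"
      then obtain r where "r \<in> carrier R" "m = r \<odot>\<^bsub>M\<^esub> k" unfolding cyclic_def by auto
      then show "\<exists>d. G m d" unfolding G_def by blast
    next
      fix m d m' d' assume "G m d" "G m' d'"
      then obtain r r' where r: "r \<in> carrier R" "m = r \<odot>\<^bsub>M\<^esub> k" "d = \<iota> (I 1 +> r)"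
        and r': "r' \<in> carrier R" "m' = r' \<odot>\<^bsub>M\<^esub> k" "d' = \<iota> (I 1 +> r')" unfolding G_def by blast
      have "d \<oplus>\<^bsub>P\<^esub> d' = \<iota> (I 1 +> (r \<oplus> r'))"
        unfolding r(3) r'(3) residue_coset_add[OF r(1) r'(1), symmetric]
        by (rule \<iota>.f_add[OF coset_closed[OF r(1)] coset_closed[OF r'(1)], symmetric])
      moreover have "m \<oplus>\<^bsub>?X\<^esub> m' = (r \<oplus> r') \<odot>\<^bsub>M\<^esub> k" using r r' k(1) by (simp add: M.smult_l_distr)
      ultimately show "G (m \<oplus>\<^bsub>?X\<^esub> m') (d \<oplus>\<^bsub>P\<^esub> d')" unfolding G_def using r(1) r'(1) by blast
    next
      fix s m d assume s: "s \<in> carrier R" and "G m d"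
      then obtain r where r: "r \<in> carrier R" "m = r \<odot>\<^bsub>M\<^esub> k" "d = \<iota> (I 1 +> r)" unfolding G_def by blast
      have "s \<odot>\<^bsub>P\<^esub> d = \<iota> (I 1 +> (s \<otimes> r))"
        unfolding r(3) residue_coset_smult[OF r(1) s, symmetric]
        by (rule \<iota>.f_smult[OF s coset_closed[OF r(1)], symmetric])
      moreover have "s \<odot>\<^bsub>?X\<^esub> m = (s \<otimes> r) \<odot>\<^bsub>M\<^esub> k" using r s k(1) by (simp add: M.smult_assoc1)
      ultimately show "G (s \<odot>\<^bsub>?X\<^esub> m) (s \<odot>\<^bsub>P\<^esub> d)" unfolding G_def using r(1) s by blast
    next
      fix d assume "G \<zero>\<^bsub>?X\<^esub> d"
      then obtain r where r: "r \<in> carrier R" "\<zero>\<^bsub>M\<^esub> = r \<odot>\<^bsub>M\<^esub> k" "d = \<iota> (I 1 +> r)" unfolding G_def by auto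
      have "r \<in> I 1" using nonunit[OF r(1)] r(2) by simp
      then have "I 1 +> r = I 1 +> \<zero>" using residue_coset_eq_iff[OF r(1) zero_closed, of 1] r(1) by (simp add: a_minus_def)
      then show "d = \<zero>\<^bsub>P\<^esub>" unfolding r(3) using \<iota>.f0_is_0 unfolding residue_zero by simp
    qed
    then obtain f where f: "f \<in> hom_set R ?X P" "\<forall>m d. G m d \<longrightarrow> f m = d" by (rule bexE)
    have "G k (\<iota> (I 1 +> \<one>))" unfolding G_def using k(1) by (intro bexI[where x = \<one>]) simp_all
    from f(2)[rule_format, OF this] have fk: "f k = \<iota> (I 1 +> \<one>)" .
    have kX: "k \<in> carrier ?X" using cyclicI[OF one_closed, of k M k] k(1) by simp
    have U: "?U \<subseteq> carrier M" using M.submodule_cyclic[OF k(1)] by (simp add: LinearCombinations.submodule_def)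
    let ?i = "\<lambda>u\<in>carrier ?X. u"
    have i: "?i \<in> hom_set R ?X M"
      by (rule restrict_hom_set[OF X], rule module_homI) (use U in auto)
    have "\<exists>h\<in>hom_set R M P. compose (carrier ?X) h ?i = f"
      using bspec[OF bspec[OF spec[OF spec[OF conjunct2[OF P_inj[unfolded injective_module_def]]]] i] f(1)] X M
      by (simp add: inj_on_def)
    then obtain h where h: "h \<in> hom_set R M P" "compose (carrier ?X) h ?i = f" by (rule bexE)
    have "h k = f k" using kX unfolding h(2)[symmetric] by (simp add: compose_def)
    obtain h' where h': "h' \<in> hom_set R N P" "\<forall>m\<in>carrier M. h' (\<alpha> m) = h m"
      using bspec[OF fac[unfolded factors_def] h(1)] by (rule bexE)
    interpret h': mod_hom R N P h' by (rule mod_homI[OF N Pm hom_setD(1)[OF h'(1)]])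
    have "h k = \<zero>\<^bsub>P\<^esub>" using bspec[OF h'(2) k(1)] k(2) h'.f0_is_0 by simp
    then show False using \<open>h k = f k\<close> fk one by simp
  qed
qed

end

section \<open>The rank\<close>

text \<open>The dimension is the least cardinality of a finite generating set. Finite generation
  ensures that this minimum is attained, so dimension zero provides the empty set as a generating
  set.\<close>

lemma (in vectorspace) dim_eq_0_iff:
  assumes gen: "generates K V v n" shows "dim = 0 \<longleftrightarrow> carrier V = {\<zero>\<^bsub>V\<^esub>}"
proof -
  let ?S = "v ` {..<n}"
  have vc: "?S \<subseteq> carrier V" using gen unfolding generates_def by blast
  have "span ?S = carrier V"
  proof (rule generates_submodule[OF gen span_is_submodule[OF vc]])
    fix i assume "i < n" then show "v i \<in> span ?S" using in_own_span[OF vc] by blast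
  qed
  then have ex: "\<exists>A. finite A \<and> card A = card ?S \<and> A \<subseteq> carrier V \<and> gen_set A" using vc by blast
  have empty: "span {} = {\<zero>\<^bsub>V\<^esub>}" by (simp add: span_def lincomb_def)
  show ?thesis
  proof
    assume "dim = 0"
    moreover have "\<exists>A. finite A \<and> card A = dim \<and> A \<subseteq> carrier V \<and> gen_set A"
      unfolding dim_def by (rule LeastI[of "\<lambda>k. \<exists>A. finite A \<and> card A = k \<and> A \<subseteq> carrier V \<and> gen_set A", OF ex])
    ultimately obtain A where "finite A" "card A = 0" "gen_set A" by auto
    then show "carrier V = {\<zero>\<^bsub>V\<^esub>}" using empty by simp
  next
    assume "carrier V = {\<zero>\<^bsub>V\<^esub>}"
    then have "\<exists>A. finite A \<and> card A = 0 \<and> A \<subseteq> carrier V \<and> gen_set A"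
      using empty by (intro exI[where x = "{}"]) simp
    then have "dim \<le> 0" unfolding dim_def by (rule Least_le)
    then show "dim = 0" by simp
  qed
qed

lemma (in scalar_action) hom_lin_comb_apply:
  assumes "\<And>i. i < n \<Longrightarrow> b i \<in> carrier S" "\<And>i. i < n \<Longrightarrow> \<phi> i \<in> hom_set R M X" "m \<in> carrier M"
  shows "lin_comb H b \<phi> n m = lin_comb Y b (\<lambda>i. \<phi> i m) n"
  using assms(1,2) by (induction n) (simp_all add: hom_module_simps assms(3) zero_eq add_eq)

context dvr
begin

lemma scalar_action_self:
  fixes M :: "('a, 'm) module" and X :: "('a, 'x) module"
  assumes "module R M" "module R X" shows "scalar_action R M X R X"
  using assms smult_swap[OF assms(2)] by (simp add: scalar_action_def scalar_action_axioms_def)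

text \<open>The rank is a dimension over \<open>Q\<close>, although the homomorphisms are
  \<open>R\<close>-linear. The two actions on values commute since \<open>R\<close> acts through the
  commutative ring \<open>Q\<close>.\<close>

lemma scalar_action_quot_field:
  fixes M :: "('a, 'm) module"
  assumes "module R M" shows "scalar_action R M QM Q (regular_module Q)"
proof -
  interpret Q: field Q by (rule quot_field_field)
  have one: "\<one> \<in> carrier R - {\<zero>}" by simp
  show ?thesis
    unfolding scalar_action_def scalar_action_axioms_def
    using assms quot_field_module_is_module regular_module_is_module[OF Q.cring_axioms]
      fraction_closed[OF _ one]
    by (simp add: quot_field_module_simps Q.m_lcomm) (simp add: regular_module_def Q.m_lcomm)
qed

lemma smult_regular: "smult (regular_module Q) = mult Q"
  by (simp add: regular_module_def)

text \<open>The coordinate functions of the torsion-free generators span: every \<open>h\<close> is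
  the combination of the \<open>\<phi> i\<close> with coefficients \<open>h (x i)\<close>. This
  supplies the finite generation under which dimension zero is decisive.\<close>

lemma hom_quot_field_generated:
  fixes M :: "('a, 'm) module"
  assumes M: "module R M" and gen: "generates R M x' n"
  shows "\<exists>\<phi>. generates Q (hom_module R (mult Q) M QM) \<phi> n"
proof -
  interpret Q: field Q by (rule quot_field_field)
  interpret S: scalar_action R M QM Q "regular_module Q" by (rule scalar_action_quot_field[OF M])
  have one: "\<one> \<in> carrier R - {\<zero>}" by simp
  obtain x where x: "generates R M x n" "independent R M x n"
    using ex_independent_generators[OF M gen] by blast
  have xc: "x i \<in> carrier M" if "i < n" for i using x(1) that by (simp add: generates_def)
  have one_closed': "\<one>\<^bsub>Q\<^esub> \<in> carrier QM" by (simp add: quot_field_module_simps)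
  \<comment> \<open>Torsion generators have no coordinate function and receive the zero map, which
    keeps the family indexed by the generators.\<close>
  have "\<exists>f. i < n \<longrightarrow> f \<in> hom_set R M QM \<and> (x i \<notin> torsion M \<longrightarrow>
      (\<forall>c. (\<forall>i<n. c i \<in> carrier R) \<longrightarrow> f (lin_comb M c x n) = c i \<odot>\<^bsub>QM\<^esub> \<one>\<^bsub>Q\<^esub>)) \<and>
      (x i \<in> torsion M \<longrightarrow> f = \<zero>\<^bsub>S.H\<^esub>)" for i
  proof (cases "i < n \<and> x i \<notin> torsion M")
    case True
    then show ?thesis
      using coordinate_hom[OF M quot_field_module_is_module x _ _ one_closed', of i] by blast
  next
    case False
    then show ?thesis using S.hom_zero by (intro exI[where x = "\<zero>\<^bsub>S.H\<^esub>"]) simp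
  qed
  from choice[OF allI, OF this] obtain \<phi> where \<phi>': "\<forall>i. i < n \<longrightarrow> \<phi> i \<in> hom_set R M QM \<and>
      (x i \<notin> torsion M \<longrightarrow>
      (\<forall>c. (\<forall>i<n. c i \<in> carrier R) \<longrightarrow> \<phi> i (lin_comb M c x n) = c i \<odot>\<^bsub>QM\<^esub> \<one>\<^bsub>Q\<^esub>)) \<and>
      (x i \<in> torsion M \<longrightarrow> \<phi> i = \<zero>\<^bsub>S.H\<^esub>)" by (rule exE)
  have \<phi>: "\<phi> i \<in> hom_set R M QM" if "i < n" for i using \<phi>' that by simp
  have free: "\<phi> i (lin_comb M c x n) = c i \<odot>\<^bsub>QM\<^esub> \<one>\<^bsub>Q\<^esub>"
    if "i < n" "x i \<notin> torsion M" "\<forall>i<n. c i \<in> carrier R" for i c using \<phi>' that by simp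
  have tors: "\<phi> i = \<zero>\<^bsub>S.H\<^esub>" if "i < n" "x i \<in> torsion M" for i using \<phi>' that by simp
  have H: "module Q S.H" by (rule S.hom_module_is_module)
  interpret H: Module.module Q S.H by (rule H)
  have "generates Q S.H \<phi> n"
    unfolding generates_def hom_module_simps(1)
  proof (intro conjI allI impI ballI \<phi>)
    fix h assume h: "h \<in> hom_set R M QM"
    have hh: "mod_hom R M QM h" by (rule mod_homI[OF M quot_field_module_is_module hom_setD(1)[OF h]])
    interpret h: mod_hom R M QM h by (rule hh)
    have hx: "h (x i) \<in> carrier Q" if "i < n" for i
      using h.f_im[OF xc[OF that]] by (simp add: quot_field_module_simps)
    have closed: "lin_comb S.H (\<lambda>i. h (x i)) \<phi> n \<in> hom_set R M QM"
      using H.lin_comb_closed[of n "\<lambda>i. h (x i)" \<phi>] hx \<phi> by (simp add: hom_module_simps)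
    have "h = lin_comb S.H (\<lambda>i. h (x i)) \<phi> n"
    proof (rule hom_set_eqI[OF h closed])
      fix m assume m: "m \<in> carrier M"
      obtain c where c: "\<forall>i<n. c i \<in> carrier R" and mc: "m = lin_comb M c x n"
        using x(1) m unfolding generates_def by blast
      \<comment> \<open>For a torsion generator both sides vanish because \<open>h (x i)\<close> is
        torsion in the quotient field. Otherwise \<open>\<phi> i m\<close> is the coordinate
        \<open>c i\<close> as a fraction.\<close>
      have summand: "h (x i) \<otimes>\<^bsub>Q\<^esub> \<phi> i m = c i \<odot>\<^bsub>QM\<^esub> h (x i)" if i: "i < n" for i
      proof (cases "x i \<in> torsion M")
        case True
        have "h (x i) = \<zero>\<^bsub>QM\<^esub>" using torsion_hom[OF hh True] torsion_quot_field by simp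
        moreover have "\<phi> i m = \<zero>\<^bsub>QM\<^esub>" using tors[OF i True] m by (simp add: hom_module_simps)
        ultimately show ?thesis
          using c i fraction_closed[OF _ one, of "c i"] by (simp add: quot_field_module_simps)
      next
        case False
        show ?thesis
          using free[OF i False c] c i hx[OF i] fraction_closed[OF _ one, of "c i"]
          unfolding mc by (simp add: quot_field_module_simps Q.m_comm)
      qed
      have "h m = lin_comb QM c (\<lambda>i. h (x i)) n" unfolding mc using c xc by (simp add: h.hom_lin_comb)
      also have "\<dots> = lin_comb (regular_module Q) (\<lambda>i. h (x i)) (\<lambda>i. \<phi> i m) n"
      proof -
        have "lin_comb QM c (\<lambda>i. h (x i)) k = lin_comb (regular_module Q) (\<lambda>i. h (x i)) (\<lambda>i. \<phi> i m) k" if "k \<le> n" for k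
          using that by (induction k) (simp_all add: S.add_eq S.zero_eq smult_regular summand)
        then show ?thesis by simp
      qed
      also have "\<dots> = lin_comb S.H (\<lambda>i. h (x i)) \<phi> n m"
        by (rule S.hom_lin_comb_apply[symmetric]) (use hx \<phi> m in simp_all)
      finally show "h m = lin_comb S.H (\<lambda>i. h (x i)) \<phi> n m" .
    qed
    then show "\<exists>c. (\<forall>i<n. c i \<in> carrier Q) \<and> h = lin_comb S.H c \<phi> n"
      using hx by (intro exI[where x = "\<lambda>i. h (x i)"]) simp
  qed
  then show ?thesis unfolding smult_regular by blast
qed

lemma functor_rank_eq_0_iff:
  assumes pres: "presentation R G = (M, N, \<alpha>)" and M: "M \<in> Rmod R" and N: "N \<in> Rmod R"
    and \<alpha>: "\<alpha> \<in> hom_set R M N"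
  shows "functor_rank R G = 0 \<longleftrightarrow> factors R M N \<alpha> QM"
proof -
  interpret Q: field Q by (rule quot_field_field)
  note M' = Rmod_module[OF M] and N' = Rmod_module[OF N]
  note sM = scalar_action_quot_field[OF M']
  interpret S: scalar_action R M QM Q "regular_module Q" by (rule sM)
  let ?H = "hom_module R (mult Q) M QM" let ?K = "precomp_image R M N \<alpha> QM"
  let ?V = "quot_module ?H ?K"
  have H: "module Q ?H" using S.hom_module_is_module unfolding smult_regular .
  have K: "submodule Q ?K ?H" using submodule_precomp_image[OF sM N' \<alpha>] unfolding smult_regular .
  have V: "module Q ?V" by (rule quot_module_is_module[OF H K])
  interpret V: vectorspace Q ?V
    using V Q.field_axioms by (simp add: vectorspace_def)
  obtain n x where "generates R M x n" using Rmod_generates[OF M] by blast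
  then obtain \<phi> where "generates Q ?H \<phi> n" using hom_quot_field_generated[OF M'] by blast
  then have "generates Q ?V (\<lambda>i. ?K +>\<^bsub>?H\<^esub> \<phi> i) n"
    by (rule mod_hom.generates_image[OF mod_homI[OF H V coset_hom[OF H K]]]) (simp add: carrier_quot_module)
  from V.dim_eq_0_iff[OF this] have "functor_rank R G = 0 \<longleftrightarrow> carrier ?V = {\<zero>\<^bsub>?V\<^esub>}"
    by (simp add: functor_rank_def eval_with_def pres)
  also have "\<dots> \<longleftrightarrow> factors R M N \<alpha> QM"
    using quot_hom_carrier[OF sM N' \<alpha>] unfolding smult_regular .
  finally show ?thesis .
qed

lemma trivial_eval_functor_iff:
  fixes X :: "('a, 'x) module"
  assumes pres: "presentation R G = (M, N, \<alpha>)" and M: "M \<in> Rmod R" and N: "N \<in> Rmod R"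
    and \<alpha>: "\<alpha> \<in> hom_set R M N" and X: "module R X"
  shows "trivial_group (add_monoid (eval_functor R G X)) \<longleftrightarrow> factors R M N \<alpha> X"
proof -
  note M' = Rmod_module[OF M] and N' = Rmod_module[OF N]
  note sM = scalar_action_self[OF M' X]
  let ?V = "quot_module (hom_module R (smult X) M X) (precomp_image R M N \<alpha> X)"
  have "module R ?V"
    by (rule quot_module_is_module[OF scalar_action.hom_module_is_module[OF sM] submodule_precomp_image[OF sM N' \<alpha>]])
  then interpret V: Module.module R ?V .
  have "trivial_group (add_monoid (eval_functor R G X)) \<longleftrightarrow> carrier ?V = {\<zero>\<^bsub>?V\<^esub>}"
    using V.M.a_group by (simp add: eval_functor_def eval_with_def pres trivial_group_def)
  also have "\<dots> \<longleftrightarrow> factors R M N \<alpha> X" by (rule quot_hom_carrier[OF sM N' \<alpha>])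
  finally show ?thesis .
qed

end

lemma presentation_presents:
  assumes "fp_functor R G" and "presentation R G = (M, N, \<alpha>)"
  shows "presents R G M N \<alpha>"
proof -
  obtain M' N' \<alpha>' where "presents R G M' N' \<alpha>'" using fp_functor.ex_presentation[OF assms(1)] by blast
  then have "(\<lambda>(M, N, \<alpha>). presents R G M N \<alpha>) (M', N', \<alpha>')" by simp
  then have "(\<lambda>(M, N, \<alpha>). presents R G M N \<alpha>) (presentation R G)"
    unfolding presentation_def by (rule someI)
  then show ?thesis unfolding assms(2) by simp
qed

theorem corollary10p25:
  fixes R :: "('r, 'e) ring_scheme"
    and \<pp> :: "'r set"
    and P :: "('r, 'p) module"
    and G :: "('r, 'g) ab_functor"
  assumes "discrete_valuation_ring R"
    and "maximalideal \<pp> R"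
    and "injective_hull R (residue_module R \<pp>) P"
    and "fp_functor R G"
  shows "HilbP R G \<pp> = 0 \<longleftrightarrow>
    trivial_group (add_monoid (eval_functor R G (direct_sum P (adic_completion R \<pp>))))"
proof -
  obtain \<pi> where "dvr R \<pi>" and \<pp>: "\<pp> = cgenideal R \<pi>"
    using discrete_valuation_ring_imp_dvr[OF assms(1,2)] by blast
  interpret dvr R \<pi> by fact
  obtain M N \<alpha> where pres: "presentation R G = (M, N, \<alpha>)" by (cases "presentation R G")
  have M: "M \<in> Rmod R" and N: "N \<in> Rmod R" and \<alpha>: "\<alpha> \<in> hom_set R M N"
    using presentation_presents[OF assms(4) pres] by (simp_all add: presents_def)
  note M' = Rmod_module[OF M] and N' = Rmod_module[OF N] and \<alpha>' = hom_setD(1)[OF \<alpha>]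
  obtain m x where gM: "generates R M x m" using Rmod_generates[OF M] by blast
  obtain n y where gN: "generates R N y n" using Rmod_generates[OF N] by blast
  have P: "injective_hull R (residue_module R (cgenideal R \<pi>)) P" using assms(3) unfolding \<pp> .
  have P_inj: "injective_module R P" using P by (simp add: injective_hull_def)
  then have Pm: "module R P" by (simp add: injective_module_def)
  interpret \<alpha>: mod_hom R M N \<alpha> by (rule mod_homI[OF M' N' \<alpha>'])
  define C where "C = quot_module N (\<alpha> ` carrier M)"
  have im: "submodule R (\<alpha> ` carrier M) N" by (rule \<alpha>.image_submodule[OF \<alpha>.M.submodule_carrier])
  have C: "module R C" unfolding C_def by (rule quot_module_is_module[OF N' im])
  have gC: "generates R C (\<lambda>i. \<alpha> ` carrier M +>\<^bsub>N\<^esub> y i) n"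
    by (rule mod_hom.generates_image[OF mod_homI[OF N' C coset_hom[OF N' im, folded C_def]] gN])
      (simp add: C_def carrier_quot_module)
  let ?inj = "inj_on \<alpha> (carrier M)" and ?div = "divisible_mod_torsion M N \<alpha>"
  let ?ker = "{m \<in> carrier M. \<alpha> m = \<zero>\<^bsub>N\<^esub>} \<subseteq> torsion M"
  have inj_ker: ?ker if ?inj
  proof -
    have "\<zero>\<^bsub>M\<^esub> \<in> torsion M" by (rule torsionI[where k = 0]) simp_all
    then show ?thesis using that unfolding \<alpha>.inj_on_iff_kernel by auto
  qed
  have "HilbP R G \<pp> = 0 \<longleftrightarrow> len_torsion M - len_torsion N + len_torsion C = 0 \<and> functor_rank R G = 0"
    unfolding HilbP_def \<pp> HilbP_constant[OF pres M N C gC C_def] by simp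
  also have "functor_rank R G = 0 \<longleftrightarrow> ?ker"
    using functor_rank_eq_0_iff[OF pres M N \<alpha>] factors_quot_field_iff[OF M' gM N' gN \<alpha>'] by simp
  \<comment> \<open>The equivalence for lengths is available only under the kernel condition. On the
    right it need not be listed, since injectivity of \<alpha> implies it.\<close>
  also have "len_torsion M - len_torsion N + len_torsion C = 0 \<and> ?ker \<longleftrightarrow> ?inj \<and> ?div"
    using len_torsion_zero_iff[OF M' gM N' gN \<alpha>' C_def] torsion_coker_iff[OF M' N' \<alpha>' C_def] inj_ker by blast
  also have "\<dots> \<longleftrightarrow> factors R M N \<alpha> P \<and> factors R M N \<alpha> A"
  proof
    assume *: "?inj \<and> ?div"
    then show "factors R M N \<alpha> P \<and> factors R M N \<alpha> A"
      using factors_injective[OF P_inj M' N' \<alpha>]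
        divisible_mod_torsion_imp_factors[OF M' N' gN \<alpha>' adic_module torsion_adic] by simp
  next
    assume *: "factors R M N \<alpha> P \<and> factors R M N \<alpha> A"
    then show "?inj \<and> ?div"
      using factors_injective_hull_imp_inj[OF P M' N' \<alpha>]
        factors_imp_divisible_mod_torsion[OF M' gM N' \<alpha>' adic_module torsion_adic adic_one] by simp
  qed
  also have "\<dots> \<longleftrightarrow> factors R M N \<alpha> (direct_sum P A)"
    by (rule factors_direct_sum[OF M' N' \<alpha> Pm adic_module, symmetric])
  also have "\<dots> \<longleftrightarrow> trivial_group (add_monoid (eval_functor R G (direct_sum P (adic_completion R \<pp>))))"
    unfolding \<pp>
    by (rule trivial_eval_functor_iff[OF pres M N \<alpha> direct_sum_is_module[OF Pm adic_module], symmetric])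
  finally show ?thesis .
qed

end
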